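(* Let $C$ be a coalgebra in an abelian monoidal category $(\mathcal{M},\otimes,\mathbf{1})$. Then the following conditions are equivalent: (a) $\mathbf{H}^2(M,C)=0$ for all $M\in{}^C\mathcal{M}^C$. (b) If $i:D\to E$ is a coalgebra homomorphism in $\mathcal M$ that has a retraction in $\mathcal{M}$ and $D\wedge D=E$, then any coalgebra homomorphism $f:D\to C$ can be extended to a coalgebra homomorphism $g:E\to C$ (i.e. $gi=f$).
   Context: $(\mathcal{M},\otimes,\mathbf{1})$ is a monoidal category with $\mathcal{M}$ abelian. A coalgebra in $\mathcal{M}$ is an algebra in the opposite monoidal category $\mathcal{M}^\circ$; ${}^C\mathcal{M}^C$ is the (abelian) category of $(C,C)$-bicomodules in $\mathcal{M}$, i.e. of $(C,C)$-bimodules in $\mathcal{M}^\circ$. Let $\mathcal{I}$ be the class of monomorphisms of ${}^C\mathcal{M}^C$ that have a retraction in $\mathcal{M}$. A bicomodule $Q$ is $\mathcal{I}$-injective if ${}^C\mathcal{M}^C(j,Q)$ is surjective for all $j\in\mathcal{I}$. $\mathbf{Ext}^\bullet_{\mathcal{I}}(M,N)$ denotes the cohomology of ${}^C\mathcal{M}^C(M,Q^\bullet)$, where $0\to N\to Q^0\to Q^1\to\cdots$ is an exact sequence with all $Q^n$ $\mathcal{I}$-injective and in which the monomorphism in the canonical (mono)$\circ$(epi) factorization of each map is in $\mathcal{I}$. Hochschild cohomology: $\mathbf{H}^\bullet(M,C)=\mathbf{Ext}^\bullet_{\mathcal{I}}(M,C)$ (equivalently, the Hochschild cohomology of the algebra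 $C$ in $\mathcal{M}^\circ$ with coefficients in the bimodule $M$). For $i:D\to E$ as in (b), let $\pi:E\to L$ be the cokernel of $i$ and $\Delta_E$ the comultiplication of $E$; $D\wedge D:=\mathrm{Ker}\bigl((\pi\otimes\pi)\Delta_E\bigr)$, so $D\wedge D=E$ means $(\pi\otimes\pi)\Delta_E=0$. *)

theory Defs
  imports "HOL-Algebra.Elementary_Groups"
begin

section \<open>Categories\<close>

text \<open>
  A category is given by a set of objects and, for each pair of objects, a set of morphisms.
  The sets \<open>Mor X Y\<close> are not required to be disjoint: a morphism is to be thought of as an
  element of type \<open>'m\<close> together with its source and target. So the morphisms of bicomodules
  can be literally a subset of the morphisms of the base category.
\<close>

record ('o, 'm) cat =
  Ob   :: "'o set"
  Mor  :: "'o \<Rightarrow> 'o \<Rightarrow> 'm set"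
  idm  :: "'o \<Rightarrow> 'm"
  comp :: "'m \<Rightarrow> 'm \<Rightarrow> 'm"  (infixl "\<cdot>\<index>" 75)

record ('o, 'm) ab_cat = "('o, 'm) cat" +
  add_mor  :: "'m \<Rightarrow> 'm \<Rightarrow> 'm"  (infixl "\<boxplus>\<index>" 65)
  zero_mor :: "'o \<Rightarrow> 'o \<Rightarrow> 'm"

record ('o, 'm) mon_cat = "('o, 'm) ab_cat" +
  tens_ob  :: "'o \<Rightarrow> 'o \<Rightarrow> 'o"  (infixl "\<otimes>\<^sub>o\<index>" 80)
  tens_mor :: "'m \<Rightarrow> 'm \<Rightarrow> 'm"  (infixl "\<otimes>\<^sub>m\<index>" 80)
  unit_ob  :: "'o"
  assoc    :: "'o \<Rightarrow> 'o \<Rightarrow> 'o \<Rightarrow> 'm"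
  lunit    :: "'o \<Rightarrow> 'm"
  runit    :: "'o \<Rightarrow> 'm"

locale category =
  fixes B (structure)
  assumes idm_in: "X \<in> Ob B \<Longrightarrow> idm B X \<in> Mor B X X"
    and comp_in: "\<lbrakk>X \<in> Ob B; Y \<in> Ob B; Z \<in> Ob B; f \<in> Mor B X Y; g \<in> Mor B Y Z\<rbrakk>
          \<Longrightarrow> g \<cdot> f \<in> Mor B X Z"
    and idm_left: "\<lbrakk>X \<in> Ob B; Y \<in> Ob B; f \<in> Mor B X Y\<rbrakk> \<Longrightarrow> idm B Y \<cdot> f = f"
    and idm_right: "\<lbrakk>X \<in> Ob B; Y \<in> Ob B; f \<in> Mor B X Y\<rbrakk> \<Longrightarrow> f \<cdot> idm B X = f"
    and comp_assoc: "\<lbrakk>W \<in> Ob B; X \<in> Ob B; Y \<in> Ob B; Z \<in> Ob B;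
          f \<in> Mor B W X; g \<in> Mor B X Y; h \<in> Mor B Y Z\<rbrakk> \<Longrightarrow> (h \<cdot> g) \<cdot> f = h \<cdot> (g \<cdot> f)"

definition hom_group :: "('o, 'm, 'z) ab_cat_scheme \<Rightarrow> 'o \<Rightarrow> 'o \<Rightarrow> 'm monoid" where
  "hom_group B X Y = \<lparr>carrier = Mor B X Y, monoid.mult = add_mor B, one = zero_mor B X Y\<rparr>"

locale preadditive_category = category +
  assumes hom_comm_group: "\<lbrakk>X \<in> Ob B; Y \<in> Ob B\<rbrakk> \<Longrightarrow> comm_group (hom_group B X Y)"
    and comp_add_left: "\<lbrakk>X \<in> Ob B; Y \<in> Ob B; Z \<in> Ob B;
          f \<in> Mor B X Y; g \<in> Mor B Y Z; g' \<in> Mor B Y Z\<rbrakk>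
          \<Longrightarrow> (g \<boxplus> g') \<cdot> f = (g \<cdot> f) \<boxplus> (g' \<cdot> f)"
    and comp_add_right: "\<lbrakk>X \<in> Ob B; Y \<in> Ob B; Z \<in> Ob B;
          f \<in> Mor B X Y; f' \<in> Mor B X Y; g \<in> Mor B Y Z\<rbrakk>
          \<Longrightarrow> g \<cdot> (f \<boxplus> f') = (g \<cdot> f) \<boxplus> (g \<cdot> f')"

context
  fixes B :: "('o, 'm, 'z) ab_cat_scheme" (structure)
begin

definition is_iso where
  "is_iso X Y f \<longleftrightarrow> f \<in> Mor B X Y \<and> (\<exists>g\<in>Mor B Y X. g \<cdot> f = idm B X \<and> f \<cdot> g = idm B Y)"

definition has_retraction where
  "has_retraction X Y f \<longleftrightarrow> f \<in> Mor B X Y \<and> (\<exists>r\<in>Mor B Y X. r \<cdot> f = idm B X)"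

definition is_mono where
  "is_mono X Y f \<longleftrightarrow> f \<in> Mor B X Y \<and>
     (\<forall>W\<in>Ob B. \<forall>g\<in>Mor B W X. \<forall>h\<in>Mor B W X. f \<cdot> g = f \<cdot> h \<longrightarrow> g = h)"

definition is_epi where
  "is_epi X Y f \<longleftrightarrow> f \<in> Mor B X Y \<and>
     (\<forall>Z\<in>Ob B. \<forall>g\<in>Mor B Y Z. \<forall>h\<in>Mor B Y Z. g \<cdot> f = h \<cdot> f \<longrightarrow> g = h)"

text \<open>\<open>k : K \<rightarrow> X\<close> is a kernel of \<open>f : X \<rightarrow> Y\<close>, and \<open>c : Y \<rightarrow> L\<close> is a cokernel of \<open>f\<close>.\<close>

definition is_kernel where
  "is_kernel X Y f K k \<longleftrightarrow> f \<in> Mor B X Y \<and> K \<in> Ob B \<and> k \<in> Mor B K X \<and> f \<cdot> k = zero_mor B K Y \<and>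
     (\<forall>W\<in>Ob B. \<forall>h\<in>Mor B W X. f \<cdot> h = zero_mor B W Y \<longrightarrow> (\<exists>!u. u \<in> Mor B W K \<and> k \<cdot> u = h))"

definition is_cokernel where
  "is_cokernel X Y f L c \<longleftrightarrow> f \<in> Mor B X Y \<and> L \<in> Ob B \<and> c \<in> Mor B Y L \<and> c \<cdot> f = zero_mor B X L \<and>
     (\<forall>Z\<in>Ob B. \<forall>h\<in>Mor B Y Z. h \<cdot> f = zero_mor B X Z \<longrightarrow> (\<exists>!u. u \<in> Mor B L Z \<and> u \<cdot> c = h))"

definition is_biproduct where
  "is_biproduct X Y P \<longleftrightarrow> P \<in> Ob B \<and>
     (\<exists>i\<in>Mor B X P. \<exists>j\<in>Mor B Y P. \<exists>p\<in>Mor B P X. \<exists>q\<in>Mor B P Y.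
        p \<cdot> i = idm B X \<and> q \<cdot> j = idm B Y \<and> q \<cdot> i = zero_mor B X Y \<and> p \<cdot> j = zero_mor B Y X \<and>
        (i \<cdot> p) \<boxplus> (j \<cdot> q) = idm B P)"

text \<open>The canonical factorization \<open>f = j p : X \<rightarrow> I \<rightarrow> Y\<close>, where \<open>p\<close> is a coimage and \<open>j\<close> is an
  image of \<open>f\<close>.\<close>

definition canonical_factorization where
  "canonical_factorization X Y f I p j \<longleftrightarrow> f = j \<cdot> p \<and>
     (\<exists>K k. is_kernel X Y f K k \<and> is_cokernel K X k I p) \<and>
     (\<exists>L c. is_cokernel X Y f L c \<and> is_kernel Y L c I j)"

text \<open>Exactness of \<open>X \<rightarrow> Y \<rightarrow> Z\<close> at \<open>Y\<close>: the image of \<open>f\<close> is the kernel of \<open>g\<close>.\<close>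

definition exact_at where
  "exact_at X Y Z f g \<longleftrightarrow>
     (\<exists>I p j. canonical_factorization X Y f I p j \<and> is_kernel Y Z g I j)"

end

locale abelian_category = preadditive_category +
  assumes zero_object: "\<exists>Z\<in>Ob B. idm B Z = zero_mor B Z Z"
    and biproduct_ex: "\<lbrakk>X \<in> Ob B; Y \<in> Ob B\<rbrakk> \<Longrightarrow> \<exists>P. is_biproduct B X Y P"
    and kernel_ex: "\<lbrakk>X \<in> Ob B; Y \<in> Ob B; f \<in> Mor B X Y\<rbrakk> \<Longrightarrow> \<exists>K k. is_kernel B X Y f K k"
    and cokernel_ex: "\<lbrakk>X \<in> Ob B; Y \<in> Ob B; f \<in> Mor B X Y\<rbrakk> \<Longrightarrow> \<exists>L c. is_cokernel B X Y f L c"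
    and mono_normal: "\<lbrakk>X \<in> Ob B; Y \<in> Ob B; is_mono B X Y f\<rbrakk>
          \<Longrightarrow> \<exists>Z g. Z \<in> Ob B \<and> is_kernel B Y Z g X f"
    and epi_normal: "\<lbrakk>X \<in> Ob B; Y \<in> Ob B; is_epi B X Y f\<rbrakk>
          \<Longrightarrow> \<exists>W g. W \<in> Ob B \<and> is_cokernel B W X g Y f"

locale monoidal_category = category M for M (structure) +
  assumes unit_in: "unit_ob M \<in> Ob M"
    and tens_ob_in: "\<lbrakk>X \<in> Ob M; Y \<in> Ob M\<rbrakk> \<Longrightarrow> X \<otimes>\<^sub>o Y \<in> Ob M"
    and tens_mor_in: "\<lbrakk>X \<in> Ob M; X' \<in> Ob M; Y \<in> Ob M; Y' \<in> Ob M; f \<in> Mor M X X'; g \<in> Mor M Y Y'\<rbrakk>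
          \<Longrightarrow> f \<otimes>\<^sub>m g \<in> Mor M (X \<otimes>\<^sub>o Y) (X' \<otimes>\<^sub>o Y')"
    and tens_idm: "\<lbrakk>X \<in> Ob M; Y \<in> Ob M\<rbrakk> \<Longrightarrow> idm M X \<otimes>\<^sub>m idm M Y = idm M (X \<otimes>\<^sub>o Y)"
    and tens_comp: "\<lbrakk>X \<in> Ob M; X' \<in> Ob M; X'' \<in> Ob M; Y \<in> Ob M; Y' \<in> Ob M; Y'' \<in> Ob M;
          f \<in> Mor M X X'; f' \<in> Mor M X' X''; g \<in> Mor M Y Y'; g' \<in> Mor M Y' Y''\<rbrakk>
          \<Longrightarrow> (f' \<cdot> f) \<otimes>\<^sub>m (g' \<cdot> g) = (f' \<otimes>\<^sub>m g') \<cdot> (f \<otimes>\<^sub>m g)"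
    and assoc_iso: "\<lbrakk>X \<in> Ob M; Y \<in> Ob M; Z \<in> Ob M\<rbrakk>
          \<Longrightarrow> is_iso M ((X \<otimes>\<^sub>o Y) \<otimes>\<^sub>o Z) (X \<otimes>\<^sub>o (Y \<otimes>\<^sub>o Z)) (assoc M X Y Z)"
    and assoc_natural: "\<lbrakk>X \<in> Ob M; X' \<in> Ob M; Y \<in> Ob M; Y' \<in> Ob M; Z \<in> Ob M; Z' \<in> Ob M;
          f \<in> Mor M X X'; g \<in> Mor M Y Y'; h \<in> Mor M Z Z'\<rbrakk>
          \<Longrightarrow> assoc M X' Y' Z' \<cdot> ((f \<otimes>\<^sub>m g) \<otimes>\<^sub>m h) = (f \<otimes>\<^sub>m (g \<otimes>\<^sub>m h)) \<cdot> assoc M X Y Z"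
    and lunit_iso: "X \<in> Ob M \<Longrightarrow> is_iso M (unit_ob M \<otimes>\<^sub>o X) X (lunit M X)"
    and lunit_natural: "\<lbrakk>X \<in> Ob M; Y \<in> Ob M; f \<in> Mor M X Y\<rbrakk>
          \<Longrightarrow> lunit M Y \<cdot> (idm M (unit_ob M) \<otimes>\<^sub>m f) = f \<cdot> lunit M X"
    and runit_iso: "X \<in> Ob M \<Longrightarrow> is_iso M (X \<otimes>\<^sub>o unit_ob M) X (runit M X)"
    and runit_natural: "\<lbrakk>X \<in> Ob M; Y \<in> Ob M; f \<in> Mor M X Y\<rbrakk>
          \<Longrightarrow> runit M Y \<cdot> (f \<otimes>\<^sub>m idm M (unit_ob M)) = f \<cdot> runit M X"
    and pentagon: "\<lbrakk>W \<in> Ob M; X \<in> Ob M; Y \<in> Ob M; Z \<in> Ob M\<rbrakk>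
          \<Longrightarrow> assoc M W X (Y \<otimes>\<^sub>o Z) \<cdot> assoc M (W \<otimes>\<^sub>o X) Y Z =
            (idm M W \<otimes>\<^sub>m assoc M X Y Z) \<cdot> assoc M W (X \<otimes>\<^sub>o Y) Z \<cdot> (assoc M W X Y \<otimes>\<^sub>m idm M Z)"
    and triangle: "\<lbrakk>X \<in> Ob M; Y \<in> Ob M\<rbrakk>
          \<Longrightarrow> (idm M X \<otimes>\<^sub>m lunit M Y) \<cdot> assoc M X (unit_ob M) Y = runit M X \<otimes>\<^sub>m idm M Y"

text \<open>
  The tensor product is required to be additive in each variable, so that the category of
  bicomodules is preadditive. No exactness of the tensor product is required: kernels of
  bicomodule morphisms are only used where they are asserted to exist.
\<close>

locale abelian_monoidal_category =
  abelian_category M + monoidal_category M for M (structure) +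
  assumes tens_add_left: "\<lbrakk>X \<in> Ob M; X' \<in> Ob M; Y \<in> Ob M; Y' \<in> Ob M;
          f \<in> Mor M X X'; f' \<in> Mor M X X'; g \<in> Mor M Y Y'\<rbrakk>
          \<Longrightarrow> (f \<boxplus> f') \<otimes>\<^sub>m g = (f \<otimes>\<^sub>m g) \<boxplus> (f' \<otimes>\<^sub>m g)"
    and tens_add_right: "\<lbrakk>X \<in> Ob M; X' \<in> Ob M; Y \<in> Ob M; Y' \<in> Ob M;
          f \<in> Mor M X X'; g \<in> Mor M Y Y'; g' \<in> Mor M Y Y'\<rbrakk>
          \<Longrightarrow> f \<otimes>\<^sub>m (g \<boxplus> g') = (f \<otimes>\<^sub>m g) \<boxplus> (f \<otimes>\<^sub>m g')"

section \<open>Relative injectivity and relative Ext\<close>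

text \<open>\<open>J X Y j\<close> means that \<open>j : X \<rightarrow> Y\<close> belongs to the class \<open>J\<close>.\<close>

definition relative_injective ::
  "('o, 'm, 'z) cat_scheme \<Rightarrow> ('o \<Rightarrow> 'o \<Rightarrow> 'm \<Rightarrow> bool) \<Rightarrow> 'o \<Rightarrow> bool" where
  "relative_injective B J Q \<longleftrightarrow> Q \<in> Ob B \<and>
     (\<forall>X\<in>Ob B. \<forall>Y\<in>Ob B. \<forall>j. J X Y j \<longrightarrow> (\<lambda>g. comp B g j) ` Mor B Y Q = Mor B X Q)"

definition image_in ::
  "('o, 'm, 'z) ab_cat_scheme \<Rightarrow> ('o \<Rightarrow> 'o \<Rightarrow> 'm \<Rightarrow> bool) \<Rightarrow> 'o \<Rightarrow> 'o \<Rightarrow> 'm \<Rightarrow> bool" where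
  "image_in B J X Y f \<longleftrightarrow> (\<exists>I p j. canonical_factorization B X Y f I p j \<and> J I Y j)"

text \<open>The sequence \<open>0 \<rightarrow> N \<rightarrow> Q 0 \<rightarrow> Q 1 \<rightarrow> \<dots>\<close> with maps \<open>e, d 0, d 1, \<dots>\<close>; exactness at \<open>N\<close>
  means that \<open>e\<close> is a monomorphism.\<close>

definition relative_injective_resolution ::
  "('o, 'm, 'z) ab_cat_scheme \<Rightarrow> ('o \<Rightarrow> 'o \<Rightarrow> 'm \<Rightarrow> bool) \<Rightarrow> 'o
     \<Rightarrow> (nat \<Rightarrow> 'o) \<Rightarrow> 'm \<Rightarrow> (nat \<Rightarrow> 'm) \<Rightarrow> bool" where
  "relative_injective_resolution B J N Q e d \<longleftrightarrow>
     N \<in> Ob B \<and> (\<forall>n. relative_injective B J (Q n)) \<and>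
     e \<in> Mor B N (Q 0) \<and> (\<forall>n. d n \<in> Mor B (Q n) (Q (Suc n))) \<and>
     is_mono B N (Q 0) e \<and> exact_at B N (Q 0) (Q 1) e (d 0) \<and>
     (\<forall>n. exact_at B (Q n) (Q (Suc n)) (Q (Suc (Suc n))) (d n) (d (Suc n))) \<and>
     image_in B J N (Q 0) e \<and> (\<forall>n. image_in B J (Q n) (Q (Suc n)) (d n))"

text \<open>The \<open>n\<close>-th cohomology group of the complex \<open>B(X, Q 0) \<rightarrow> B(X, Q 1) \<rightarrow> \<dots>\<close>.\<close>

definition cocycles ::
  "('o, 'm, 'z) ab_cat_scheme \<Rightarrow> 'o \<Rightarrow> (nat \<Rightarrow> 'o) \<Rightarrow> (nat \<Rightarrow> 'm) \<Rightarrow> nat \<Rightarrow> 'm set" where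
  "cocycles B X Q d n = {f \<in> Mor B X (Q n). comp B (d n) f = zero_mor B X (Q (Suc n))}"

fun coboundaries ::
  "('o, 'm, 'z) ab_cat_scheme \<Rightarrow> 'o \<Rightarrow> (nat \<Rightarrow> 'o) \<Rightarrow> (nat \<Rightarrow> 'm) \<Rightarrow> nat \<Rightarrow> 'm set" where
  "coboundaries B X Q d 0 = {zero_mor B X (Q 0)}"
| "coboundaries B X Q d (Suc n) = comp B (d n) ` Mor B X (Q n)"

definition hom_cohomology ::
  "('o, 'm, 'z) ab_cat_scheme \<Rightarrow> 'o \<Rightarrow> (nat \<Rightarrow> 'o) \<Rightarrow> (nat \<Rightarrow> 'm) \<Rightarrow> nat \<Rightarrow> 'm set monoid" where
  "hom_cohomology B X Q d n =
     (hom_group B X (Q n))\<lparr>carrier := cocycles B X Q d n\<rparr> Mod coboundaries B X Q d n"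

text \<open>By the comparison theorem the group does not depend, up to isomorphism, on the resolution,
  so an arbitrary one is chosen.\<close>

definition Ext ::
  "('o, 'm, 'z) ab_cat_scheme \<Rightarrow> ('o \<Rightarrow> 'o \<Rightarrow> 'm \<Rightarrow> bool) \<Rightarrow> nat \<Rightarrow> 'o \<Rightarrow> 'o \<Rightarrow> 'm set monoid" where
  "Ext B J n X N =
     (let (Q, e, d) = (SOME (Q, e, d). relative_injective_resolution B J N Q e d)
      in hom_cohomology B X Q d n)"

section \<open>Coalgebras and bicomodules\<close>

record ('o, 'm) coalg =
  cobj   :: 'o
  comult :: 'm
  counit :: 'm

record ('o, 'm) bicomod =
  bobj   :: 'o
  lcoact :: 'm
  rcoact :: 'm

context
  fixes M :: "('o, 'm, 'z) mon_cat_scheme" (structure)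
begin

definition coalgebra :: "('o, 'm) coalg \<Rightarrow> bool" where
  "coalgebra C \<longleftrightarrow> (let X = cobj C; \<Delta> = comult C; \<epsilon> = counit C in
     X \<in> Ob M \<and> \<Delta> \<in> Mor M X (X \<otimes>\<^sub>o X) \<and> \<epsilon> \<in> Mor M X (unit_ob M) \<and>
     assoc M X X X \<cdot> ((\<Delta> \<otimes>\<^sub>m idm M X) \<cdot> \<Delta>) = (idm M X \<otimes>\<^sub>m \<Delta>) \<cdot> \<Delta> \<and>
     lunit M X \<cdot> ((\<epsilon> \<otimes>\<^sub>m idm M X) \<cdot> \<Delta>) = idm M X \<and>
     runit M X \<cdot> ((idm M X \<otimes>\<^sub>m \<epsilon>) \<cdot> \<Delta>) = idm M X)"

definition coalgebra_hom :: "('o, 'm) coalg \<Rightarrow> ('o, 'm) coalg \<Rightarrow> 'm set" where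
  "coalgebra_hom C D = {f \<in> Mor M (cobj C) (cobj D).
     (f \<otimes>\<^sub>m f) \<cdot> comult C = comult D \<cdot> f \<and> counit D \<cdot> f = counit C}"

definition bicomodule :: "('o, 'm) coalg \<Rightarrow> ('o, 'm) bicomod \<Rightarrow> bool" where
  "bicomodule C V \<longleftrightarrow> (let X = cobj C; \<Delta> = comult C; \<epsilon> = counit C;
                             Y = bobj V; l = lcoact V; r = rcoact V in
     Y \<in> Ob M \<and> l \<in> Mor M Y (X \<otimes>\<^sub>o Y) \<and> r \<in> Mor M Y (Y \<otimes>\<^sub>o X) \<and>
     assoc M X X Y \<cdot> ((\<Delta> \<otimes>\<^sub>m idm M Y) \<cdot> l) = (idm M X \<otimes>\<^sub>m l) \<cdot> l \<and>
     lunit M Y \<cdot> ((\<epsilon> \<otimes>\<^sub>m idm M Y) \<cdot> l) = idm M Y \<and>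
     assoc M Y X X \<cdot> ((r \<otimes>\<^sub>m idm M X) \<cdot> r) = (idm M Y \<otimes>\<^sub>m \<Delta>) \<cdot> r \<and>
     runit M Y \<cdot> ((idm M Y \<otimes>\<^sub>m \<epsilon>) \<cdot> r) = idm M Y \<and>
     assoc M X Y X \<cdot> ((l \<otimes>\<^sub>m idm M X) \<cdot> r) = (idm M X \<otimes>\<^sub>m r) \<cdot> l)"

definition bicomodule_cat :: "('o, 'm) coalg \<Rightarrow> (('o, 'm) bicomod, 'm) ab_cat" where
  "bicomodule_cat C = \<lparr>
     Ob = {V. bicomodule C V},
     Mor = (\<lambda>V W. {f \<in> Mor M (bobj V) (bobj W).
              (idm M (cobj C) \<otimes>\<^sub>m f) \<cdot> lcoact V = lcoact W \<cdot> f \<and>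
              (f \<otimes>\<^sub>m idm M (cobj C)) \<cdot> rcoact V = rcoact W \<cdot> f}),
     idm = (\<lambda>V. idm M (bobj V)),
     comp = comp M,
     add_mor = add_mor M,
     zero_mor = (\<lambda>V W. zero_mor M (bobj V) (bobj W))\<rparr>"

definition regular_bicomodule :: "('o, 'm) coalg \<Rightarrow> ('o, 'm) bicomod" where
  "regular_bicomodule C = \<lparr>bobj = cobj C, lcoact = comult C, rcoact = comult C\<rparr>"

definition split_mono ::
  "('o, 'm) coalg \<Rightarrow> ('o, 'm) bicomod \<Rightarrow> ('o, 'm) bicomod \<Rightarrow> 'm \<Rightarrow> bool" where
  "split_mono C V W j \<longleftrightarrow>
     is_mono (bicomodule_cat C) V W j \<and> has_retraction M (bobj V) (bobj W) j"

definition Hochschild_cohomology ::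
  "('o, 'm) coalg \<Rightarrow> nat \<Rightarrow> ('o, 'm) bicomod \<Rightarrow> 'm set monoid" where
  "Hochschild_cohomology C n V =
     Ext (bicomodule_cat C) (split_mono C) n V (regular_bicomodule C)"

text \<open>\<open>w : W \<rightarrow> E\<close> represents the subobject \<open>D \<and> D\<close> of \<open>E\<close>, for \<open>i : D \<rightarrow> E\<close>.\<close>

definition is_wedge_square ::
  "('o, 'm) coalg \<Rightarrow> ('o, 'm) coalg \<Rightarrow> 'm \<Rightarrow> 'o \<Rightarrow> 'm \<Rightarrow> bool" where
  "is_wedge_square D E i W w \<longleftrightarrow>
     (\<exists>L \<pi>. is_cokernel M (cobj D) (cobj E) i L \<pi> \<and>
            is_kernel M (cobj E) (L \<otimes>\<^sub>o L) ((\<pi> \<otimes>\<^sub>m \<pi>) \<cdot> comult E) W w)"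

text \<open>\<open>D \<and> D = E\<close> as subobjects of \<open>E\<close>.\<close>

definition wedge_square_total :: "('o, 'm) coalg \<Rightarrow> ('o, 'm) coalg \<Rightarrow> 'm \<Rightarrow> bool" where
  "wedge_square_total D E i \<longleftrightarrow> is_wedge_square D E i (cobj E) (idm M (cobj E))"

end

end

theory Submission
  imports Defs
begin

text \<open>
  Let \<open>J\<close> be the cokernel of \<open>\<Delta> : C \<rightarrow> C \<otimes> C\<close>. Bicomodule maps \<open>V \<rightarrow> J\<close> are the same as coderivations
  \<open>V \<rightarrow> C\<close>, and since \<open>C \<otimes> C\<close> is relatively injective, dimension shifting shows that (a) holds iff \<open>J\<close> is
  relatively injective, that is, iff coderivations extend along bicomodule maps that split in \<open>\<M>\<close>.

  If (b) holds, a coderivation \<open>z : V \<rightarrow> C\<close> is extended along \<open>V \<rightarrow> W\<close> by lifting the coalgebra map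
  \<open>(1, z) : C \<oplus> V \<rightarrow> C\<close> to the trivial extension \<open>C \<oplus> W\<close>.

  Conversely, let \<open>J\<close> be relatively injective, so that the coaction \<open>J \<rightarrow> C \<otimes> J\<close> has a bicolinear retraction
  \<open>s\<close>. Extend \<open>f\<close> to a morphism \<open>g\<^sub>0 : E \<rightarrow> C\<close> and write \<open>a * b = (a \<otimes> b) \<Delta>\<close> for maps \<open>a\<close>, \<open>b\<close> on \<open>E\<close>; then
  \<open>a * b = 0\<close> if \<open>a\<close> and \<open>b\<close> vanish on \<open>D\<close>. The failure \<open>z = g\<^sub>0 * g\<^sub>0 - \<Delta> g\<^sub>0\<close> is a 2-cocycle, and it is
  the coboundary of \<open>\<eta> + \<mu>\<close>, where \<open>\<eta> = \<partial> s (g\<^sub>0 * P z)\<close> for the projection \<open>P : C \<otimes> C \<rightarrow> J\<close> and the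
  universal coderivation \<open>\<partial>\<close>, and \<open>\<mu> = (\<epsilon> \<otimes> 1) z\<close> compensates for the lack of normalization of \<open>z\<close>.
  Hence \<open>g\<^sub>0 - \<eta> - \<mu>\<close> is comultiplicative. It preserves the counit automatically: the difference
  \<open>n\<close> of the two counits of \<open>E\<close> vanishes on \<open>D\<close>, so \<open>n * n = 0\<close>, and this forces \<open>n = 0\<close>.
\<close>

text \<open>The tensor product is not assumed exact, so bicomodules are not known to form an abelian
  category. Every quotient bicomodule that is formed belongs to a map with a retraction in
  \<open>M\<close>; it carries coactions by transport along a section. In particular
  \<open>J\<close> exists because a counit retracts \<open>\<Delta>\<close>. For the converse
  direction the equation is linearized: if \<open>h\<close> vanishes on \<open>D\<close>, then
  \<open>h \<star> h = 0\<close>, so \<open>g0 - h\<close> is comultiplicative iff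
  \<open>\<Delta> h + z = g0 \<star> h + h \<star> g0\<close>. By the coderivation identity,
  \<open>del w\<close> solves this up to the term \<open>g0 \<star> \<mu>\<close> as soon as
  \<open>w\<close> is left colinear over \<open>g0\<close> and fails to be right colinear by the
  same defect \<open>q\<close> as \<open>y = P z\<close>. The arrow \<open>y\<close> has the correct
  defect but need not be left colinear. Passing to \<open>s (g0 \<star> y)\<close> enforces left
  colinearity, and since \<open>s\<close> is right colinear and splits the coaction, the defect
  remains \<open>q\<close>. The cokernel of \<open>D \<rightarrow> E\<close> is never turned into a
  bicomodule: arrows on \<open>E\<close> that vanish on \<open>D\<close> take its place, and next to
  them \<open>g0\<close> behaves like a coalgebra homomorphism.\<close>

section \<open>Arrows with source and target\<close>

text \<open>Typed morphisms, with \<open>None\<close> as the value of every ill-typed composite or sum. The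
  associativity and additivity laws then hold without side conditions.\<close>

type_synonym ('o, 'm) arrow = "('o \<times> 'm \<times> 'o) option"

definition src :: "('o, 'm) arrow \<Rightarrow> 'o" where "src a = fst (the a)"
definition mor :: "('o, 'm) arrow \<Rightarrow> 'm" where "mor a = fst (snd (the a))"
definition tgt :: "('o, 'm) arrow \<Rightarrow> 'o" where "tgt a = snd (snd (the a))"

context category
begin

definition arrow_of where
  "arrow_of X f Y = (if X \<in> Ob B \<and> Y \<in> Ob B \<and> f \<in> Mor B X Y then Some (X, f, Y) else None)"

definition arr where
  "arr a \<longleftrightarrow> (\<exists>X f Y. X \<in> Ob B \<and> Y \<in> Ob B \<and> f \<in> Mor B X Y \<and> a = Some (X, f, Y))"

definition cmp (infixr "\<bullet>" 75) where
  "b \<bullet> a = (if arr a \<and> arr b \<and> tgt a = src b then Some (src a, mor b \<cdot> mor a, tgt b) else None)"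

definition ident where "ident X = arrow_of X (idm B X) X"

lemma arr_None [simp]: "\<not> arr None"
  by (simp add: arr_def)

lemma arr_arrow_of: "X \<in> Ob B \<Longrightarrow> Y \<in> Ob B \<Longrightarrow> f \<in> Mor B X Y \<Longrightarrow> arr (arrow_of X f Y)"
  by (simp add: arr_def arrow_of_def)

lemma arrow_of_sel:
  assumes "X \<in> Ob B" "Y \<in> Ob B" "f \<in> Mor B X Y"
  shows "src (arrow_of X f Y) = X" "mor (arrow_of X f Y) = f" "tgt (arrow_of X f Y) = Y"
  using assms by (simp_all add: src_def mor_def tgt_def arrow_of_def)

lemma arr_Ob: "arr a \<Longrightarrow> src a \<in> Ob B" "arr a \<Longrightarrow> tgt a \<in> Ob B"
  by (auto simp: arr_def src_def tgt_def)

lemma mor_in: "arr a \<Longrightarrow> mor a \<in> Mor B (src a) (tgt a)"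
  by (auto simp: arr_def src_def tgt_def mor_def)

lemma arrow_of_collapse: "arr a \<Longrightarrow> arrow_of (src a) (mor a) (tgt a) = a"
  by (auto simp: arr_def src_def tgt_def mor_def arrow_of_def)

lemma arrow_eqI:
  "arr a \<Longrightarrow> arr b \<Longrightarrow> src a = src b \<Longrightarrow> tgt a = tgt b \<Longrightarrow> mor a = mor b \<Longrightarrow> a = b"
  by (metis arrow_of_collapse)

lemma arr_cmp [simp]: "arr (b \<bullet> a) \<longleftrightarrow> arr a \<and> arr b \<and> tgt a = src b"
  by (auto simp: cmp_def arr_def src_def tgt_def mor_def intro: comp_in)

lemma cmp_sel:
  assumes "arr a" "arr b" "tgt a = src b"
  shows "src (b \<bullet> a) = src a" "tgt (b \<bullet> a) = tgt b" "mor (b \<bullet> a) = mor b \<cdot> mor a"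
  using assms by (simp_all add: cmp_def src_def tgt_def mor_def)

lemma not_arr_cmp: "\<not> arr (b \<bullet> a) \<Longrightarrow> b \<bullet> a = None"
  unfolding arr_cmp by (auto simp: cmp_def)

text \<open>Both bracketings are typed under the same conditions and are \<open>None\<close>
  otherwise. As a simp rule it brings every composite into right-nested form.\<close>

lemma cmp_assoc [simp]: "(c \<bullet> b) \<bullet> a = c \<bullet> b \<bullet> a"
proof (cases "arr a \<and> arr b \<and> arr c \<and> tgt a = src b \<and> tgt b = src c")
  case True
  then have "(mor c \<cdot> mor b) \<cdot> mor a = mor c \<cdot> (mor b \<cdot> mor a)"
    by (intro comp_assoc[of "src a" "tgt a" "tgt b" "tgt c"]) (auto simp: arr_Ob mor_in dest: mor_in)
  with True show ?thesis
    by (intro arrow_eqI) (simp_all add: cmp_sel)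
next
  case False
  then have "\<not> arr ((c \<bullet> b) \<bullet> a)" "\<not> arr (c \<bullet> b \<bullet> a)"
    by (auto simp: cmp_sel)
  then show ?thesis
    by (metis not_arr_cmp)
qed

lemma arr_ident [simp]: "arr (ident X) \<longleftrightarrow> X \<in> Ob B"
  by (auto simp: ident_def arrow_of_def arr_def idm_in)

lemma ident_sel [simp]:
  "X \<in> Ob B \<Longrightarrow> src (ident X) = X" "X \<in> Ob B \<Longrightarrow> tgt (ident X) = X" "X \<in> Ob B \<Longrightarrow> mor (ident X) = idm B X"
  by (simp_all add: ident_def arrow_of_sel idm_in)

lemma ident_cmp [simp]: "arr a \<Longrightarrow> tgt a = X \<Longrightarrow> ident X \<bullet> a = a"
  using arr_Ob[of a] mor_in[of a] by (intro arrow_eqI) (auto simp: cmp_sel idm_left)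

lemma cmp_ident [simp]: "arr a \<Longrightarrow> src a = X \<Longrightarrow> a \<bullet> ident X = a"
  using arr_Ob[of a] mor_in[of a] by (intro arrow_eqI) (auto simp: cmp_sel idm_right)

lemma cmp_arrow_of:
  assumes "X \<in> Ob B" "Y \<in> Ob B" "Z \<in> Ob B" "f \<in> Mor B X Y" "g \<in> Mor B Y Z"
  shows "arrow_of Y g Z \<bullet> arrow_of X f Y = arrow_of X (g \<cdot> f) Z"
  using assms comp_in[OF assms] by (intro arrow_eqI) (simp_all add: arr_arrow_of arrow_of_sel cmp_sel)

text \<open>In right-nested form the left-hand side of an equation \<open>b \<bullet> a = c\<close>
  is no longer a subterm of a longer composite; this variant still applies there.\<close>

lemma cmp_tail: "b \<bullet> a = c \<Longrightarrow> b \<bullet> a \<bullet> x = c \<bullet> x"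
  using cmp_assoc[of b a x] by (simp del: cmp_assoc)

lemma mor_cmp_eq: "b \<bullet> a = c \<Longrightarrow> arr a \<Longrightarrow> arr b \<Longrightarrow> tgt a = src b \<Longrightarrow> mor b \<cdot> mor a = mor c"
  using cmp_sel(3)[of a b] by simp

lemma arrow_eq_iff:
  "arr a \<Longrightarrow> arr b \<Longrightarrow> src a = src b \<Longrightarrow> tgt a = tgt b \<Longrightarrow> a = b \<longleftrightarrow> mor a = mor b"
  by (auto intro: arrow_eqI)

end

context preadditive_category
begin

definition add_arrow (infixl "\<^bold>+" 65) where
  "a \<^bold>+ b = (if arr a \<and> arr b \<and> src a = src b \<and> tgt a = tgt b
             then Some (src a, mor a \<boxplus> mor b, tgt a) else None)"

definition neg ("\<^bold>- _" [81] 80) where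
  "neg a = (if arr a then Some (src a, m_inv (hom_group B (src a) (tgt a)) (mor a), tgt a) else None)"

definition zero_arrow where "zero_arrow X Y = arrow_of X (zero_mor B X Y) Y"

lemma hom_group_simps:
  "carrier (hom_group B X Y) = Mor B X Y" "monoid.mult (hom_group B X Y) = add_mor B"
  "one (hom_group B X Y) = zero_mor B X Y"
  by (simp_all add: hom_group_def)

lemma
  assumes "X \<in> Ob B" "Y \<in> Ob B"
  shows add_mor_in: "f \<in> Mor B X Y \<Longrightarrow> g \<in> Mor B X Y \<Longrightarrow> f \<boxplus> g \<in> Mor B X Y"
    and zero_mor_in: "zero_mor B X Y \<in> Mor B X Y"
    and inv_mor_in: "f \<in> Mor B X Y \<Longrightarrow> m_inv (hom_group B X Y) f \<in> Mor B X Y"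
    and add_mor_assoc: "f \<in> Mor B X Y \<Longrightarrow> g \<in> Mor B X Y \<Longrightarrow> h \<in> Mor B X Y
          \<Longrightarrow> (f \<boxplus> g) \<boxplus> h = f \<boxplus> (g \<boxplus> h)"
    and add_mor_commute: "f \<in> Mor B X Y \<Longrightarrow> g \<in> Mor B X Y \<Longrightarrow> f \<boxplus> g = g \<boxplus> f"
    and add_zero_mor: "f \<in> Mor B X Y \<Longrightarrow> f \<boxplus> zero_mor B X Y = f"
    and add_inv_mor: "f \<in> Mor B X Y \<Longrightarrow> f \<boxplus> m_inv (hom_group B X Y) f = zero_mor B X Y"
proof -
  interpret H: comm_group "hom_group B X Y"
    by (rule hom_comm_group[OF assms])
  note [simp] = hom_group_simps
  show "f \<in> Mor B X Y \<Longrightarrow> g \<in> Mor B X Y \<Longrightarrow> f \<boxplus> g \<in> Mor B X Y"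
    using H.m_closed by simp
  show "zero_mor B X Y \<in> Mor B X Y"
    using H.one_closed by simp
  show "f \<in> Mor B X Y \<Longrightarrow> m_inv (hom_group B X Y) f \<in> Mor B X Y"
    using H.inv_closed by simp
  show "f \<in> Mor B X Y \<Longrightarrow> g \<in> Mor B X Y \<Longrightarrow> h \<in> Mor B X Y \<Longrightarrow> (f \<boxplus> g) \<boxplus> h = f \<boxplus> (g \<boxplus> h)"
    using H.m_assoc by simp
  show "f \<in> Mor B X Y \<Longrightarrow> g \<in> Mor B X Y \<Longrightarrow> f \<boxplus> g = g \<boxplus> f"
    using H.m_comm by simp
  show "f \<in> Mor B X Y \<Longrightarrow> f \<boxplus> zero_mor B X Y = f"
    using H.r_one by simp
  show "f \<in> Mor B X Y \<Longrightarrow> f \<boxplus> m_inv (hom_group B X Y) f = zero_mor B X Y"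
    using H.r_inv by simp
qed

lemma arr_add [simp]: "arr (a \<^bold>+ b) \<longleftrightarrow> arr a \<and> arr b \<and> src a = src b \<and> tgt a = tgt b"
  using add_mor_in by (auto simp: add_arrow_def arr_def src_def tgt_def mor_def)

lemma add_sel:
  assumes "arr a" "arr b" "src a = src b" "tgt a = tgt b"
  shows "src (a \<^bold>+ b) = src b" "tgt (a \<^bold>+ b) = tgt b" "mor (a \<^bold>+ b) = mor a \<boxplus> mor b"
  using assms by (simp_all add: add_arrow_def src_def tgt_def mor_def)

lemma not_arr_add: "\<not> arr (a \<^bold>+ b) \<Longrightarrow> a \<^bold>+ b = None"
  unfolding arr_add by (auto simp: add_arrow_def)

lemma arr_neg [simp]: "arr (\<^bold>- a) \<longleftrightarrow> arr a"
  using inv_mor_in by (auto simp: neg_def arr_def src_def tgt_def mor_def)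

lemma neg_sel [simp]:
  assumes "arr a"
  shows "src (\<^bold>- a) = src a" "tgt (\<^bold>- a) = tgt a"
  using assms by (simp_all add: neg_def src_def tgt_def mor_def)

lemma mor_neg: "arr a \<Longrightarrow> mor (\<^bold>- a) = m_inv (hom_group B (src a) (tgt a)) (mor a)"
  by (simp add: neg_def src_def tgt_def mor_def)

lemma arr_zero [simp]: "arr (zero_arrow X Y) \<longleftrightarrow> X \<in> Ob B \<and> Y \<in> Ob B"
  by (auto simp: zero_arrow_def arrow_of_def arr_def zero_mor_in)

lemma zero_sel [simp]:
  assumes "X \<in> Ob B" "Y \<in> Ob B"
  shows "src (zero_arrow X Y) = X" "tgt (zero_arrow X Y) = Y" "mor (zero_arrow X Y) = zero_mor B X Y"
  using assms by (simp_all add: zero_arrow_def arrow_of_sel zero_mor_in)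

lemma add_commute: "a \<^bold>+ b = b \<^bold>+ a"
proof (cases "arr (a \<^bold>+ b)")
  case True
  then show ?thesis
    using mor_in[of a] mor_in[of b] arr_Ob[of a]
    by (intro arrow_eqI) (auto simp: add_sel intro: add_mor_commute)
next
  case False
  then have "\<not> arr (b \<^bold>+ a)"
    by auto
  with False show ?thesis
    by (metis not_arr_add)
qed

lemma add_assoc: "(a \<^bold>+ b) \<^bold>+ c = a \<^bold>+ (b \<^bold>+ c)"
proof (cases "arr ((a \<^bold>+ b) \<^bold>+ c)")
  case True
  then show ?thesis
    using mor_in[of a] mor_in[of b] mor_in[of c] arr_Ob[of a]
    by (intro arrow_eqI) (auto simp: add_sel intro: add_mor_assoc)
next
  case False
  then have "\<not> arr (a \<^bold>+ (b \<^bold>+ c))"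
    by (auto simp: add_sel)
  with False show ?thesis
    by (metis not_arr_add)
qed

lemma add_left_commute: "a \<^bold>+ (b \<^bold>+ c) = b \<^bold>+ (a \<^bold>+ c)"
  by (metis add_assoc add_commute)

lemmas add_ac = add_assoc add_commute add_left_commute

lemma add_zero [simp]:
  assumes "arr a" "src a = X" "tgt a = Y"
  shows "a \<^bold>+ zero_arrow X Y = a" "zero_arrow X Y \<^bold>+ a = a"
proof -
  show *: "a \<^bold>+ zero_arrow X Y = a"
    using assms mor_in[of a] arr_Ob[of a]
    by (intro arrow_eqI) (auto simp: add_sel add_zero_mor)
  then show "zero_arrow X Y \<^bold>+ a = a"
    by (simp add: add_commute)
qed

lemma add_neg:
  assumes "arr a" shows "a \<^bold>+ \<^bold>- a = zero_arrow (src a) (tgt a)"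
  using assms mor_in[of a] arr_Ob[of a]
  by (intro arrow_eqI) (auto simp: add_sel mor_neg add_inv_mor)

text \<open>\<open>None\<close> absorbs every summand, so cancellation holds for typed sums
  only.\<close>

lemma add_right_cancel:
  assumes "a \<^bold>+ c = b \<^bold>+ c" "arr (a \<^bold>+ c)"
  shows "a = b"
proof -
  have "arr (b \<^bold>+ c)" using assms by simp
  have "(a \<^bold>+ c) \<^bold>+ \<^bold>- c = (b \<^bold>+ c) \<^bold>+ \<^bold>- c" using assms(1) by simp
  then show ?thesis
    using assms(2) \<open>arr (b \<^bold>+ c)\<close> by (simp add: add_assoc add_neg)
qed

lemma add_left_cancel: "c \<^bold>+ a = c \<^bold>+ b \<Longrightarrow> arr (c \<^bold>+ a) \<Longrightarrow> a = b"
  by (metis add_commute add_right_cancel)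

lemma neg_unique: "a \<^bold>+ b = zero_arrow X Y \<Longrightarrow> X \<in> Ob B \<Longrightarrow> Y \<in> Ob B \<Longrightarrow> b = \<^bold>- a"
proof -
  assume *: "a \<^bold>+ b = zero_arrow X Y" "X \<in> Ob B" "Y \<in> Ob B"
  then have **: "arr (a \<^bold>+ b)" "src (a \<^bold>+ b) = X" "tgt (a \<^bold>+ b) = Y" by simp_all
  then have "arr a" "arr b" "src a = src b" "tgt a = tgt b" by simp_all
  moreover from this ** have "src b = X" "tgt b = Y" by (simp_all add: add_sel)
  ultimately have "src a = X" "tgt a = Y" "arr a" "arr b" "src b = X" "tgt b = Y"
    by simp_all
  then show "b = \<^bold>- a"
    using * add_neg[of a] by (intro add_left_cancel[of a b "\<^bold>- a"]) auto
qed

lemma cmp_add_left: "(b \<^bold>+ c) \<bullet> a = b \<bullet> a \<^bold>+ c \<bullet> a"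
proof (cases "arr ((b \<^bold>+ c) \<bullet> a)")
  case True
  then have "(mor b \<boxplus> mor c) \<cdot> mor a = mor b \<cdot> mor a \<boxplus> mor c \<cdot> mor a"
    by (intro comp_add_left[of "src a" "tgt a" "tgt c"]) (auto simp: arr_Ob mor_in add_sel dest: mor_in)
  with True show ?thesis
    by (intro arrow_eqI) (auto simp: add_sel cmp_sel)
next
  case False
  then have "\<not> arr (b \<bullet> a \<^bold>+ c \<bullet> a)"
    by (auto simp: add_sel cmp_sel)
  with False show ?thesis
    by (metis not_arr_add not_arr_cmp)
qed

lemma cmp_add_right: "a \<bullet> (b \<^bold>+ c) = a \<bullet> b \<^bold>+ a \<bullet> c"
proof (cases "arr (a \<bullet> (b \<^bold>+ c))")
  case True
  then have "mor a \<cdot> (mor b \<boxplus> mor c) = mor a \<cdot> mor b \<boxplus> mor a \<cdot> mor c"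
    by (intro comp_add_right[of "src c" "tgt c" "tgt a"]) (auto simp: arr_Ob mor_in add_sel dest: mor_in)
  with True show ?thesis
    by (intro arrow_eqI) (auto simp: add_sel cmp_sel)
next
  case False
  then have "\<not> arr (a \<bullet> b \<^bold>+ a \<bullet> c)"
    by (auto simp: add_sel cmp_sel)
  with False show ?thesis
    by (metis not_arr_add not_arr_cmp)
qed

text \<open>Applied to composites and to tensor products, this derives their absorption laws for
  zero from additivity alone.\<close>

lemma zero_unique: "a \<^bold>+ a = a \<Longrightarrow> arr a \<Longrightarrow> a = zero_arrow (src a) (tgt a)"
  by (rule add_left_cancel[of a]) (simp_all)

lemma cmp_zero [simp]:
  "arr a \<Longrightarrow> src a = Y \<Longrightarrow> X \<in> Ob B \<Longrightarrow> a \<bullet> zero_arrow X Y = zero_arrow X (tgt a)"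
  using zero_unique[of "a \<bullet> zero_arrow X Y"] arr_Ob[of a]
  by (simp add: cmp_add_right[symmetric] cmp_sel)

lemma zero_cmp [simp]:
  "arr a \<Longrightarrow> tgt a = X \<Longrightarrow> Y \<in> Ob B \<Longrightarrow> zero_arrow X Y \<bullet> a = zero_arrow (src a) Y"
  using zero_unique[of "zero_arrow X Y \<bullet> a"] arr_Ob[of a]
  by (simp add: cmp_add_left[symmetric] cmp_sel)

lemma not_arr_neg: "\<not> arr a \<Longrightarrow> \<^bold>- a = None"
  by (simp add: neg_def)

lemma neg_cmp: "(\<^bold>- b) \<bullet> a = \<^bold>- (b \<bullet> a)"
proof (cases "arr (b \<bullet> a)")
  case True
  then have "b \<bullet> a \<^bold>+ (\<^bold>- b) \<bullet> a = zero_arrow (src a) (tgt b)"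
    using arr_Ob[of b] by (simp add: cmp_add_left[symmetric] add_neg)
  then show ?thesis
    using True arr_Ob by (intro neg_unique) auto
next
  case False
  then have "\<not> arr ((\<^bold>- b) \<bullet> a)" by auto
  with False show ?thesis by (metis not_arr_cmp not_arr_neg)
qed

lemma cmp_neg: "b \<bullet> (\<^bold>- a) = \<^bold>- (b \<bullet> a)"
proof (cases "arr (b \<bullet> a)")
  case True
  then have "b \<bullet> a \<^bold>+ b \<bullet> (\<^bold>- a) = zero_arrow (src a) (tgt b)"
    using arr_Ob[of a] by (simp add: cmp_add_right[symmetric] add_neg)
  then show ?thesis
    using True arr_Ob by (intro neg_unique) auto
next
  case False
  then have "\<not> arr (b \<bullet> (\<^bold>- a))" by auto
  with False show ?thesis by (metis not_arr_cmp not_arr_neg)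
qed

end

section \<open>Dimension shifting\<close>

context category
begin

definition mono_arrow where
  "mono_arrow k \<longleftrightarrow> arr k \<and> (\<forall>u v. arr u \<and> arr v \<and> src u = src v \<and> tgt u = src k \<and> tgt v = src k
      \<and> k \<bullet> u = k \<bullet> v \<longrightarrow> u = v)"

definition epi_arrow where
  "epi_arrow c \<longleftrightarrow> arr c \<and> (\<forall>u v. arr u \<and> arr v \<and> tgt u = tgt v \<and> src u = tgt c \<and> src v = tgt c
      \<and> u \<bullet> c = v \<bullet> c \<longrightarrow> u = v)"

lemma mono_arrowD:
  "mono_arrow k \<Longrightarrow> k \<bullet> u = k \<bullet> v \<Longrightarrow> arr u \<Longrightarrow> arr v \<Longrightarrow> src u = src v \<Longrightarrow> tgt u = src k
    \<Longrightarrow> tgt v = src k \<Longrightarrow> u = v"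
  by (simp add: mono_arrow_def)

lemma epi_arrowD:
  "epi_arrow c \<Longrightarrow> u \<bullet> c = v \<bullet> c \<Longrightarrow> arr u \<Longrightarrow> arr v \<Longrightarrow> tgt u = tgt v \<Longrightarrow> src u = tgt c
    \<Longrightarrow> src v = tgt c \<Longrightarrow> u = v"
  by (simp add: epi_arrow_def)

lemma split_mono_arrow:
  assumes "arr k" "arr r" "src r = tgt k" "r \<bullet> k = ident (src k)" shows "mono_arrow k"
  unfolding mono_arrow_def
proof (intro conjI allI impI; (elim conjE)?)
  fix u v assume *: "arr u" "arr v" "src u = src v" "tgt u = src k" "tgt v = src k" "k \<bullet> u = k \<bullet> v"
  have "(r \<bullet> k) \<bullet> u = (r \<bullet> k) \<bullet> v" using *(6) by simp
  then show "u = v" using assms *(1-5) by (simp del: cmp_assoc)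
qed (fact assms)

lemma split_epi_arrow:
  assumes "arr c" "arr s" "tgt s = src c" "c \<bullet> s = ident (tgt c)" shows "epi_arrow c"
  unfolding epi_arrow_def
proof (intro conjI allI impI; (elim conjE)?)
  fix u v assume *: "arr u" "arr v" "tgt u = tgt v" "src u = tgt c" "src v = tgt c" "u \<bullet> c = v \<bullet> c"
  have "u \<bullet> c \<bullet> s = v \<bullet> c \<bullet> s" using *(6) by (metis cmp_assoc)
  then show "u = v" using assms *(1-5) by simp
qed (fact assms)

end

context preadditive_category
begin

text \<open>Only surjectivity requires an argument: precomposition with a morphism \<open>j\<close>
  lands in \<open>Mor B X Q\<close> anyway.\<close>

lemma relative_injectiveI:
  assumes "Q \<in> Ob B" "\<And>X Y j. J X Y j \<Longrightarrow> j \<in> Mor B X Y"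
    and "\<And>X Y j h. X \<in> Ob B \<Longrightarrow> Y \<in> Ob B \<Longrightarrow> J X Y j \<Longrightarrow> h \<in> Mor B X Q \<Longrightarrow> \<exists>g\<in>Mor B Y Q. g \<cdot> j = h"
  shows "relative_injective B J Q"
proof -
  have "(\<lambda>g. g \<cdot> j) ` Mor B Y Q = Mor B X Q" if "X \<in> Ob B" "Y \<in> Ob B" "J X Y j" for X Y j
    using assms(1) assms(2)[OF that(3)] assms(3)[OF that] that(1,2) comp_in[of X Y Q j]
    by (force simp: image_iff)
  then show ?thesis
    using assms(1) by (simp add: relative_injective_def)
qed

lemma relative_injectiveE:
  assumes "relative_injective B J Q" "X \<in> Ob B" "Y \<in> Ob B" "J X Y j" "j \<in> Mor B X Y"
    and h: "arr h" "src h = X" "tgt h = Q"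
  obtains g where "arr g" "src g = Y" "tgt g = Q" "g \<bullet> arrow_of X j Y = h"
proof -
  have "mor h \<in> (\<lambda>g. g \<cdot> j) ` Mor B Y Q"
    using assms mor_in[of h] by (auto simp: relative_injective_def)
  then obtain g where "g \<in> Mor B Y Q" "g \<cdot> j = mor h" by auto
  then show ?thesis
    using that[of "arrow_of Y g Q"] assms arrow_of_collapse[of h] arr_Ob[of h]
    by (auto simp: arr_arrow_of arrow_of_sel cmp_arrow_of)
qed

lemma is_mono_iff:
  assumes "X \<in> Ob B" "Y \<in> Ob B"
  shows "is_mono B X Y f \<longleftrightarrow> f \<in> Mor B X Y \<and> mono_arrow (arrow_of X f Y)" (is "?l \<longleftrightarrow> ?r")
proof
  assume l: ?l
  then have f: "f \<in> Mor B X Y" by (simp add: is_mono_def)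
  have "u = v" if "arr u" "arr v" "src u = src v" "tgt u = X" "tgt v = X"
    "arrow_of X f Y \<bullet> u = arrow_of X f Y \<bullet> v" for u v
  proof -
    have "f \<cdot> mor u = f \<cdot> mor v"
      using arg_cong[OF that(6), of mor] that(1-5) assms f by (simp add: cmp_sel arrow_of_sel arr_arrow_of)
    then have "mor u = mor v"
      using l that mor_in[of u] mor_in[of v] arr_Ob[of u] by (auto simp: is_mono_def)
    then show ?thesis using that by (intro arrow_eqI) auto
  qed
  then show ?r
    using f assms by (auto simp: mono_arrow_def arr_arrow_of arrow_of_sel)
next
  assume r: ?r
  have "g = h" if "W \<in> Ob B" "g \<in> Mor B W X" "h \<in> Mor B W X" "f \<cdot> g = f \<cdot> h" for W g h
  proof -
    have "arrow_of W g X = arrow_of W h X"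
      using r that assms by - (rule mono_arrowD[of "arrow_of X f Y"], auto simp: arr_arrow_of arrow_of_sel cmp_arrow_of)
    then show ?thesis using that assms by (metis arrow_of_sel(2))
  qed
  then show ?l using r by (auto simp: is_mono_def)
qed

section \<open>Kernels and cokernels of typed arrows\<close>

definition kernel_arrow where
  "kernel_arrow f k \<longleftrightarrow> arr f \<and> mono_arrow k \<and> tgt k = src f \<and> f \<bullet> k = zero_arrow (src k) (tgt f) \<and>
     (\<forall>h. arr h \<and> tgt h = src f \<and> f \<bullet> h = zero_arrow (src h) (tgt f)
        \<longrightarrow> (\<exists>u. arr u \<and> src u = src h \<and> tgt u = src k \<and> k \<bullet> u = h))"

definition cokernel_arrow where
  "cokernel_arrow f c \<longleftrightarrow> arr f \<and> epi_arrow c \<and> src c = tgt f \<and> c \<bullet> f = zero_arrow (src f) (tgt c) \<and>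
     (\<forall>h. arr h \<and> src h = tgt f \<and> h \<bullet> f = zero_arrow (src f) (tgt h)
        \<longrightarrow> (\<exists>u. arr u \<and> src u = tgt c \<and> tgt u = tgt h \<and> u \<bullet> c = h))"

lemma kernel_arrowD:
  assumes "kernel_arrow f k"
  shows "arr f" "mono_arrow k" "arr k" "tgt k = src f" "f \<bullet> k = zero_arrow (src k) (tgt f)"
  using assms by (auto simp: kernel_arrow_def mono_arrow_def)

lemma cokernel_arrowD:
  assumes "cokernel_arrow f c"
  shows "arr f" "epi_arrow c" "arr c" "src c = tgt f" "c \<bullet> f = zero_arrow (src f) (tgt c)"
  using assms by (auto simp: cokernel_arrow_def epi_arrow_def)

lemma kernel_factor:
  assumes "kernel_arrow f k" "arr h" "tgt h = src f" "f \<bullet> h = zero_arrow (src h) (tgt f)"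
  obtains u where "arr u" "src u = src h" "tgt u = src k" "k \<bullet> u = h"
  using assms unfolding kernel_arrow_def by blast

lemma cokernel_factor:
  assumes "cokernel_arrow f c" "arr h" "src h = tgt f" "h \<bullet> f = zero_arrow (src f) (tgt h)"
  obtains u where "arr u" "src u = tgt c" "tgt u = tgt h" "u \<bullet> c = h"
  using assms unfolding cokernel_arrow_def by blast

text \<open>The unique existence splits into existence and monicity of \<open>k\<close>. Monicity
  follows because \<open>f\<close> kills every \<open>k \<bullet> u\<close>, so that
  \<open>u\<close> is the unique factorization of that composite.\<close>

lemma is_kernel_iff:
  assumes "X \<in> Ob B" "Y \<in> Ob B"
  shows "is_kernel B X Y f K k \<longleftrightarrow> f \<in> Mor B X Y \<and> K \<in> Ob B \<and> k \<in> Mor B K X \<and>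
    kernel_arrow (arrow_of X f Y) (arrow_of K k X)" (is "?l \<longleftrightarrow> ?r")
proof
  assume l: ?l
  then have t: "f \<in> Mor B X Y" "K \<in> Ob B" "k \<in> Mor B K X" "f \<cdot> k = zero_mor B K Y"
    by (auto simp: is_kernel_def)
  let ?f = "arrow_of X f Y" and ?k = "arrow_of K k X"
  note simps = arr_arrow_of arrow_of_sel cmp_sel arr_Ob zero_mor_in
  have z: "?f \<bullet> ?k = zero_arrow K Y"
    using t assms by (simp add: cmp_arrow_of zero_arrow_def)
  have ex1: "\<exists>!u. u \<in> Mor B (src h) K \<and> k \<cdot> u = mor h"
    if "arr h" "tgt h = X" "?f \<bullet> h = zero_arrow (src h) Y" for h
  proof -
    have "f \<cdot> mor h = zero_mor B (src h) Y"
      using arg_cong[OF that(3), of mor] that(1,2) t assms by (simp add: simps)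
    then show ?thesis
      using l that mor_in[of h] arr_Ob[of h] by (auto simp: is_kernel_def)
  qed
  have m: "u = v" if *: "arr u" "arr v" "src u = src v" "tgt u = K" "tgt v = K" "?k \<bullet> u = ?k \<bullet> v" for u v
  proof -
    have "(?f \<bullet> ?k) \<bullet> u = zero_arrow (src u) Y"
      unfolding z using *(1-5) t assms by simp
    then have "?f \<bullet> ?k \<bullet> u = zero_arrow (src u) Y"
      by (simp only: cmp_assoc)
    then have "\<exists>!u'. u' \<in> Mor B (src u) K \<and> k \<cdot> u' = mor (?k \<bullet> u)"
      using ex1[of "?k \<bullet> u"] *(1-5) t assms by (simp add: simps)
    moreover have "k \<cdot> mor u = mor (?k \<bullet> u)" "k \<cdot> mor v = mor (?k \<bullet> v)"
      using *(1-5) t assms by (simp_all add: simps)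
    ultimately have "mor u = mor v"
      using *(6) *(1-5) mor_in[of u] mor_in[of v] by (metis (no_types, lifting))
    then show ?thesis using * by (intro arrow_eqI) auto
  qed
  have e: "\<exists>u. arr u \<and> src u = src h \<and> tgt u = K \<and> ?k \<bullet> u = h"
    if *: "arr h" "tgt h = X" "?f \<bullet> h = zero_arrow (src h) Y" for h
  proof -
    obtain u where u: "u \<in> Mor B (src h) K" "k \<cdot> u = mor h" using ex1[OF *] by blast
    then show ?thesis
      using * t assms arr_Ob[of h] arrow_of_collapse[of h]
      by (intro exI[of _ "arrow_of (src h) u K"]) (auto simp: simps cmp_arrow_of)
  qed
  show ?r
    using t assms m e z by (auto simp: kernel_arrow_def mono_arrow_def simps)
next
  assume r: ?r
  let ?f = "arrow_of X f Y" and ?k = "arrow_of K k X"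
  note simps = arr_arrow_of arrow_of_sel cmp_sel arr_Ob zero_mor_in
  have z: "f \<cdot> k = zero_mor B K Y"
    using arg_cong[OF kernel_arrowD(5)[of ?f ?k], of mor] r assms by (simp add: simps)
  have "\<exists>!u. u \<in> Mor B W K \<and> k \<cdot> u = h"
    if *: "W \<in> Ob B" "h \<in> Mor B W X" "f \<cdot> h = zero_mor B W Y" for W h
  proof -
    have "?f \<bullet> arrow_of W h X = zero_arrow W Y"
      using r * assms by (simp add: simps cmp_arrow_of zero_arrow_def)
    then obtain u where u: "arr u" "src u = W" "tgt u = K" "?k \<bullet> u = arrow_of W h X"
      using r * assms by (elim conjE kernel_factor[of ?f ?k "arrow_of W h X"]) (auto simp: simps)
    have "mor u \<in> Mor B W K" "k \<cdot> mor u = h"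
      using u(1-3) mor_in[of u] arg_cong[OF u(4), of mor] * r assms by (auto simp: simps)
    moreover have "u' = mor u" if **: "u' \<in> Mor B W K" "k \<cdot> u' = h" for u'
    proof -
      have "arrow_of W u' K = u"
        using r u * ** assms by - (rule mono_arrowD[of ?k], auto simp: simps cmp_arrow_of dest: kernel_arrowD)
      then show ?thesis using * ** r by (metis arrow_of_sel(2))
    qed
    ultimately show ?thesis by blast
  qed
  then show ?l using r z by (auto simp: is_kernel_def)
qed

lemma is_cokernel_iff:
  assumes "X \<in> Ob B" "Y \<in> Ob B"
  shows "is_cokernel B X Y f L c \<longleftrightarrow> f \<in> Mor B X Y \<and> L \<in> Ob B \<and> c \<in> Mor B Y L \<and>
    cokernel_arrow (arrow_of X f Y) (arrow_of Y c L)" (is "?l \<longleftrightarrow> ?r")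
proof
  assume l: ?l
  then have t: "f \<in> Mor B X Y" "L \<in> Ob B" "c \<in> Mor B Y L" "c \<cdot> f = zero_mor B X L"
    by (auto simp: is_cokernel_def)
  let ?f = "arrow_of X f Y" and ?c = "arrow_of Y c L"
  note simps = arr_arrow_of arrow_of_sel cmp_sel arr_Ob zero_mor_in
  have z: "?c \<bullet> ?f = zero_arrow X L"
    using t assms by (simp add: cmp_arrow_of zero_arrow_def)
  have ex1: "\<exists>!u. u \<in> Mor B L (tgt h) \<and> u \<cdot> c = mor h"
    if "arr h" "src h = Y" "h \<bullet> ?f = zero_arrow X (tgt h)" for h
  proof -
    have "mor h \<cdot> f = zero_mor B X (tgt h)"
      using arg_cong[OF that(3), of mor] that(1,2) t assms by (simp add: simps)
    then show ?thesis
      using l that mor_in[of h] arr_Ob[of h] by (auto simp: is_cokernel_def)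
  qed
  have m: "u = v" if *: "arr u" "arr v" "tgt u = tgt v" "src u = L" "src v = L" "u \<bullet> ?c = v \<bullet> ?c" for u v
  proof -
    have "(u \<bullet> ?c) \<bullet> ?f = zero_arrow X (tgt u)"
      unfolding cmp_assoc z using *(1-5) t assms by simp
    then have "\<exists>!u'. u' \<in> Mor B L (tgt u) \<and> u' \<cdot> c = mor (u \<bullet> ?c)"
      using ex1[of "u \<bullet> ?c"] *(1-5) t assms by (simp add: simps)
    moreover have "mor u \<cdot> c = mor (u \<bullet> ?c)" "mor v \<cdot> c = mor (v \<bullet> ?c)"
      using *(1-5) t assms by (simp_all add: simps)
    ultimately have "mor u = mor v"
      using *(6) *(1-5) mor_in[of u] mor_in[of v] by (metis (no_types, lifting))
    then show ?thesis using * by (intro arrow_eqI) auto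
  qed
  have e: "\<exists>u. arr u \<and> src u = L \<and> tgt u = tgt h \<and> u \<bullet> ?c = h"
    if *: "arr h" "src h = Y" "h \<bullet> ?f = zero_arrow X (tgt h)" for h
  proof -
    obtain u where u: "u \<in> Mor B L (tgt h)" "u \<cdot> c = mor h" using ex1[OF *] by blast
    then show ?thesis
      using * t assms arr_Ob[of h] arrow_of_collapse[of h]
      by (intro exI[of _ "arrow_of L u (tgt h)"]) (auto simp: simps cmp_arrow_of)
  qed
  show ?r
    using t assms m e z by (auto simp: cokernel_arrow_def epi_arrow_def simps)
next
  assume r: ?r
  let ?f = "arrow_of X f Y" and ?c = "arrow_of Y c L"
  note simps = arr_arrow_of arrow_of_sel cmp_sel arr_Ob zero_mor_in
  have z: "c \<cdot> f = zero_mor B X L"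
    using arg_cong[OF cokernel_arrowD(5)[of ?f ?c], of mor] r assms by (simp add: simps)
  have "\<exists>!u. u \<in> Mor B L Z \<and> u \<cdot> c = h"
    if *: "Z \<in> Ob B" "h \<in> Mor B Y Z" "h \<cdot> f = zero_mor B X Z" for Z h
  proof -
    have "arrow_of Y h Z \<bullet> ?f = zero_arrow X Z"
      using r * assms by (simp add: simps cmp_arrow_of zero_arrow_def)
    then obtain u where u: "arr u" "src u = L" "tgt u = Z" "u \<bullet> ?c = arrow_of Y h Z"
      using r * assms by (elim conjE cokernel_factor[of ?f ?c "arrow_of Y h Z"]) (auto simp: simps)
    have "mor u \<in> Mor B L Z" "mor u \<cdot> c = h"
      using u(1-3) mor_in[of u] arg_cong[OF u(4), of mor] * r assms by (auto simp: simps)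
    moreover have "u' = mor u" if **: "u' \<in> Mor B L Z" "u' \<cdot> c = h" for u'
    proof -
      have "arrow_of L u' Z = u"
        using r u * ** assms by - (rule epi_arrowD[of ?c], auto simp: simps cmp_arrow_of dest: cokernel_arrowD)
      then show ?thesis using * ** r by (metis arrow_of_sel(2))
    qed
    ultimately show ?thesis by blast
  qed
  then show ?l using r z by (auto simp: is_cokernel_def)
qed

text \<open>Factorizations through \<open>k\<close>, composed with \<open>t\<close>, become
  factorizations through \<open>k'\<close>, and \<open>k'\<close> is monic. Two images of one map
  are compared in this way.\<close>

lemma kernel_arrow_transfer:
  assumes "kernel_arrow f k" "mono_arrow k'" "tgt k' = src f" "f \<bullet> k' = zero_arrow (src k') (tgt f)"
    and "arr t" "src t = src k" "tgt t = src k'" "k' \<bullet> t = k"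
  shows "kernel_arrow f k'"
  unfolding kernel_arrow_def
proof (intro conjI allI impI; (elim conjE)?)
  fix h assume "arr h" "tgt h = src f" "f \<bullet> h = zero_arrow (src h) (tgt f)"
  then obtain u where u: "arr u" "src u = src h" "tgt u = src k" "k \<bullet> u = h"
    using assms(1) by (elim kernel_factor)
  have "k' \<bullet> t \<bullet> u = h"
    using u(4) assms(8) by (metis cmp_assoc)
  then show "\<exists>u. arr u \<and> src u = src h \<and> tgt u = src k' \<and> k' \<bullet> u = h"
    using u assms by (intro exI[of _ "t \<bullet> u"]) (auto simp: cmp_sel)
qed (use assms in \<open>auto dest: kernel_arrowD\<close>)

text \<open>The two images of \<open>f\<close> are kernels of cokernels of \<open>f\<close>, hence factor through each other.\<close>

lemma exact_at_kernel:
  assumes "X \<in> Ob B" "Y \<in> Ob B" "Z \<in> Ob B"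
    and "exact_at B X Y Z f g" "canonical_factorization B X Y f I p j"
  shows "kernel_arrow (arrow_of Y g Z) (arrow_of I j Y)"
proof -
  obtain I' p' j' where *: "canonical_factorization B X Y f I' p' j'" "is_kernel B Y Z g I' j'"
    using assms(4) by (auto simp: exact_at_def)
  obtain L c L' c' where c: "is_cokernel B X Y f L c" "is_kernel B Y L c I j"
    "is_cokernel B X Y f L' c'" "is_kernel B Y L' c' I' j'"
    using *(1) assms(5) unfolding canonical_factorization_def by blast
  have ob: "L \<in> Ob B" "L' \<in> Ob B" "I \<in> Ob B" "I' \<in> Ob B" "f \<in> Mor B X Y" "j \<in> Mor B I Y" "j' \<in> Mor B I' Y"
    "g \<in> Mor B Y Z" "c \<in> Mor B Y L" "c' \<in> Mor B Y L'"
    using c *(2) by (auto simp: is_cokernel_def is_kernel_def)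
  define F C C' J J' G where defs: "F = arrow_of X f Y" "C = arrow_of Y c L" "C' = arrow_of Y c' L'"
     "J = arrow_of I j Y" "J' = arrow_of I' j' Y" "G = arrow_of Y g Z"
  have [simp]: "arr F" "src F = X" "tgt F = Y" "arr C" "src C = Y" "tgt C = L" "arr C'" "src C' = Y" "tgt C' = L'"
     "arr J" "src J = I" "tgt J = Y" "arr J'" "src J' = I'" "tgt J' = Y" "arr G" "src G = Y" "tgt G = Z"
    using ob assms(1-3) by (simp_all add: defs arr_arrow_of arrow_of_sel)
  note ob[simp] assms(1-3)[simp]
  have k: "cokernel_arrow F C" "cokernel_arrow F C'" "kernel_arrow C J" "kernel_arrow C' J'" "kernel_arrow G J'"
    using c * ob assms(1-3) by (auto simp: defs is_kernel_iff is_cokernel_iff)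
  obtain a where a: "arr a" "src a = L" "tgt a = L'" "a \<bullet> C = C'"
    using k(1) cokernel_arrowD[OF k(2)] by (elim cokernel_factor[of _ _ C']) auto
  obtain a' where a': "arr a'" "src a' = L'" "tgt a' = L" "a' \<bullet> C' = C"
    using k(2) cokernel_arrowD[OF k(1)] by (elim cokernel_factor[of _ _ C]) auto
  have "C' \<bullet> J = zero_arrow I L'"
    using a kernel_arrowD[OF k(3)] by (simp flip: a(4))
  then obtain t where t: "arr t" "src t = I" "tgt t = I'" "J' \<bullet> t = J"
    using k(4) by (elim kernel_factor[of _ _ J]) auto
  have "C \<bullet> J' = zero_arrow I' L"
    using a' kernel_arrowD[OF k(4)] by (simp flip: a'(4))
  then obtain t' where t': "arr t'" "src t' = I'" "tgt t' = I" "J \<bullet> t' = J'"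
    using k(3) by (elim kernel_factor[of _ _ J']) auto
  have "G \<bullet> J = (G \<bullet> J') \<bullet> t"
    by (simp add: t)
  then have "G \<bullet> J = zero_arrow I Z"
    using kernel_arrowD[OF k(5)] t by simp
  then have "kernel_arrow G J"
    using k(5) kernel_arrowD[OF k(3)] t' by (intro kernel_arrow_transfer[of G J' J t']) auto
  then show ?thesis by (simp add: defs)
qed

text \<open>The coimage is a cokernel of some kernel of \<open>f\<close>. Any two kernels factor
  through each other and are therefore killed by the same arrows, so the given \<open>k\<close>
  serves as well.\<close>

lemma coimage_cokernel:
  assumes "X \<in> Ob B" "Y \<in> Ob B"
    and "canonical_factorization B X Y f I p j" "kernel_arrow (arrow_of X f Y) k"
  shows "cokernel_arrow k (arrow_of X p I)"
proof -
  obtain K' k' where c: "is_kernel B X Y f K' k'" "is_cokernel B K' X k' I p"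
    using assms(3) by (auto simp: canonical_factorization_def)
  then have ob: "K' \<in> Ob B" "I \<in> Ob B" "f \<in> Mor B X Y" "k' \<in> Mor B K' X" "p \<in> Mor B X I"
    by (auto simp: is_kernel_def is_cokernel_def)
  with c have *: "kernel_arrow (arrow_of X f Y) (arrow_of K' k' X)"
      "cokernel_arrow (arrow_of K' k' X) (arrow_of X p I)"
    using assms(1,2) by (auto simp: is_kernel_iff is_cokernel_iff)
  define F P k'' where defs: "F = arrow_of X f Y" "P = arrow_of X p I" "k'' = arrow_of K' k' X"
  have [simp]: "arr F" "src F = X" "tgt F = Y" "arr P" "src P = X" "tgt P = I" "arr k''" "src k'' = K'" "tgt k'' = X"
    using ob assms(1-2) by (simp_all add: defs arr_arrow_of arrow_of_sel)
  note ob(1,2)[simp] assms(1-2)[simp]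
  have k: "kernel_arrow F k''" "cokernel_arrow k'' P" "kernel_arrow F k"
    using * assms by (simp_all add: defs)
  note kk = kernel_arrowD[OF k(3)]
  obtain u where u: "arr u" "src u = src k" "tgt u = K'" "k'' \<bullet> u = k"
    using k(1) kk by (elim kernel_factor[of _ _ k]) auto
  obtain v where v: "arr v" "src v = K'" "tgt v = src k" "k \<bullet> v = k''"
    using k(3) kernel_arrowD[OF k(1)] by (elim kernel_factor[of _ _ k'']) auto
  have "P \<bullet> k = (P \<bullet> k'') \<bullet> u" by (simp add: u)
  then have z: "P \<bullet> k = zero_arrow (src k) I"
    using u cokernel_arrowD[OF k(2)] by simp
  have "\<exists>u. arr u \<and> src u = I \<and> tgt u = tgt h \<and> u \<bullet> P = h"
    if h: "arr h" "src h = X" "h \<bullet> k = zero_arrow (src k) (tgt h)" for h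
  proof -
    have "h \<bullet> k'' = (h \<bullet> k) \<bullet> v" by (simp add: v)
    then have "h \<bullet> k'' = zero_arrow K' (tgt h)" using h v arr_Ob by simp
    then show ?thesis
      using cokernel_factor[OF k(2), of h] h by auto
  qed
  then have "cokernel_arrow k P"
    using kk cokernel_arrowD(2)[OF k(2)] z by (auto simp: cokernel_arrow_def)
  then show ?thesis by (simp add: defs)
qed

text \<open>Because \<open>p\<close> can be cancelled on the right, \<open>j\<close> and
  \<open>j \<bullet> p\<close> are killed by the same arrows.\<close>

lemma cokernel_arrow_epi_cmp:
  assumes "cokernel_arrow j c" "epi_arrow p" "tgt p = src j"
  shows "cokernel_arrow (j \<bullet> p) c"
proof -
  note jj = cokernel_arrowD[OF assms(1)]
  have p: "arr p" using assms(2) by (simp add: epi_arrow_def)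
  have "c \<bullet> j \<bullet> p = (c \<bullet> j) \<bullet> p" by simp
  then have z: "c \<bullet> j \<bullet> p = zero_arrow (src p) (tgt c)"
    using jj p assms(3) arr_Ob[of c] by (simp del: cmp_assoc)
  have "h \<bullet> j = zero_arrow (src j) (tgt h)"
    if "arr h" "src h = tgt j" "h \<bullet> j \<bullet> p = zero_arrow (src p) (tgt h)" for h
    using that jj p assms arr_Ob[of h] arr_Ob[of j]
    by - (rule epi_arrowD[OF assms(2)], auto simp: cmp_sel)
  then show ?thesis
    using assms jj p z by (auto simp: cokernel_arrow_def cmp_sel)
qed

text \<open>The identity of \<open>L'\<close> is \<open>a b + c' t\<close> for maps through \<open>L\<close> and \<open>Q'\<close>, where \<open>a\<close> and \<open>b\<close> are
  induced by maps \<open>Q \<rightarrow> Q'\<close> and \<open>Q' \<rightarrow> Q\<close> under \<open>N\<close> (as in Schanuel's lemma).\<close>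

lemma relative_injective_cokernel:
  assumes cok: "cokernel_arrow e c" "cokernel_arrow e' c'"
    and a: "arr a" "src a = tgt e" "tgt a = tgt e'" "a \<bullet> e = e'"
    and b: "arr b" "src b = tgt e'" "tgt b = tgt e" "b \<bullet> e' = e"
    and inj: "relative_injective B J (tgt c)" "relative_injective B J (tgt e')"
    and J: "\<And>X Y j. J X Y j \<Longrightarrow> j \<in> Mor B X Y"
  shows "relative_injective B J (tgt c')"
proof -
  note cc = cokernel_arrowD[OF cok(1)] cokernel_arrowD[OF cok(2)]
  have sr: "src e' = src e" using a cc by (metis cmp_sel(1))
  have ob: "tgt c \<in> Ob B" "tgt c' \<in> Ob B" "tgt e' \<in> Ob B" "src e \<in> Ob B" using cc arr_Ob by auto
  obtain a1 where a1: "arr a1" "src a1 = tgt c" "tgt a1 = tgt c'" "a1 \<bullet> c = c' \<bullet> a"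
    using cok(1) cc a sr by (elim cokernel_factor[of _ _ "c' \<bullet> a"]) (auto simp: cmp_sel)
  obtain b1 where b1: "arr b1" "src b1 = tgt c'" "tgt b1 = tgt c" "b1 \<bullet> c' = c \<bullet> b"
    using cok(2) cc b sr by (elim cokernel_factor[of _ _ "c \<bullet> b"]) (auto simp: cmp_sel)
  have "(ident (tgt e') \<^bold>+ \<^bold>- (a \<bullet> b)) \<bullet> e' = zero_arrow (src e') (tgt e')"
    using a b cc ob by (simp add: cmp_add_left neg_cmp add_neg)
  then obtain t where t: "arr t" "src t = tgt c'" "tgt t = tgt e'" "t \<bullet> c' = ident (tgt e') \<^bold>+ \<^bold>- (a \<bullet> b)"
    using cok(2) cc b a ob by (elim cokernel_factor[of _ _ "ident (tgt e') \<^bold>+ \<^bold>- (a \<bullet> b)"]) (auto simp: cmp_sel add_sel)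
  \<comment> \<open>The decomposition of the identity is tested after composition with the
    epimorphism \<open>c'\<close>, where the terms \<open>c' \<bullet> a \<bullet> b\<close>
    cancel.\<close>
  have "a1 \<bullet> b1 \<bullet> c' = c' \<bullet> a \<bullet> b"
    by (metis a1(4) b1(4) cmp_assoc)
  moreover have "c' \<bullet> t \<bullet> c' = c' \<^bold>+ \<^bold>- (c' \<bullet> a \<bullet> b)"
    using t cc by (simp add: cmp_add_right cmp_neg)
  ultimately have "(a1 \<bullet> b1 \<^bold>+ c' \<bullet> t) \<bullet> c' = ident (tgt c') \<bullet> c'"
    using cc a b by (simp add: cmp_add_left add_left_commute[of _ c'] add_neg cmp_sel arr_Ob)
  then have id: "a1 \<bullet> b1 \<^bold>+ c' \<bullet> t = ident (tgt c')"
    using cc a1 b1 t ob by - (rule epi_arrowD[OF cc(7)], auto simp: cmp_sel add_sel)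
  have "\<exists>g\<in>Mor B Y (tgt c'). g \<cdot> j = h"
    if XY: "X \<in> Ob B" "Y \<in> Ob B" "J X Y j" "h \<in> Mor B X (tgt c')" for X Y j h
  proof -
    have j: "j \<in> Mor B X Y" using J XY by simp
    define H where "H = arrow_of X h (tgt c')"
    have H: "arr H" "src H = X" "tgt H = tgt c'" "mor H = h"
      using XY ob by (simp_all add: H_def arr_arrow_of arrow_of_sel)
    let ?j = "arrow_of X j Y"
    \<comment> \<open>The components of \<open>H\<close> through \<open>tgt c\<close> and through
      \<open>tgt e'\<close> are extended separately and then recombined.\<close>
    obtain g1 where g1: "arr g1" "src g1 = Y" "tgt g1 = tgt c" "g1 \<bullet> ?j = b1 \<bullet> H"
      using b1 H XY j by (elim relative_injectiveE[OF inj(1), of X Y j "b1 \<bullet> H"]) (auto simp: cmp_sel)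
    obtain g2 where g2: "arr g2" "src g2 = Y" "tgt g2 = tgt e'" "g2 \<bullet> ?j = t \<bullet> H"
      using t H XY j by (elim relative_injectiveE[OF inj(2), of X Y j "t \<bullet> H"]) (auto simp: cmp_sel)
    let ?g = "a1 \<bullet> g1 \<^bold>+ c' \<bullet> g2"
    have g: "arr ?g" "src ?g = Y" "tgt ?g = tgt c'"
      using a1 g1 g2 cc by (auto simp: cmp_sel add_sel)
    have "?g \<bullet> ?j = (a1 \<bullet> b1 \<^bold>+ c' \<bullet> t) \<bullet> H"
      by (simp add: cmp_add_left g1 g2)
    then have "?g \<bullet> ?j = H" using id H ob by simp
    moreover have "mor (?g \<bullet> ?j) = mor ?g \<cdot> j"
      using g XY j by (subst cmp_sel(3)) (simp_all only: arr_arrow_of arrow_of_sel)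
    ultimately have "mor ?g \<cdot> j = h" using H by simp
    then show ?thesis using mor_in[OF g(1)] g by auto
  qed
  then show ?thesis
    using ob J by (intro relative_injectiveI) auto
qed

lemma neg_zero [simp]: "X \<in> Ob B \<Longrightarrow> Y \<in> Ob B \<Longrightarrow> \<^bold>- zero_arrow X Y = zero_arrow X Y"
  by (rule neg_unique[of _ _ X Y, symmetric]) auto

lemma canonical_factorizationD:
  assumes "X \<in> Ob B" "Y \<in> Ob B" "canonical_factorization B X Y f I p j"
  shows "I \<in> Ob B" "f \<in> Mor B X Y" "p \<in> Mor B X I" "j \<in> Mor B I Y"
    and "arrow_of X f Y = arrow_of I j Y \<bullet> arrow_of X p I"
    and "epi_arrow (arrow_of X p I)" "mono_arrow (arrow_of I j Y)"
    and "\<exists>k. kernel_arrow (arrow_of X f Y) k \<and> cokernel_arrow k (arrow_of X p I)"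
proof -
  obtain K k L c where c: "is_kernel B X Y f K k" "is_cokernel B K X k I p"
    "is_cokernel B X Y f L c" "is_kernel B Y L c I j" and f: "f = j \<cdot> p"
    using assms(3) by (auto simp: canonical_factorization_def)
  show ob: "I \<in> Ob B" "f \<in> Mor B X Y" "p \<in> Mor B X I" "j \<in> Mor B I Y"
    using c by (auto simp: is_kernel_def is_cokernel_def)
  have ob': "K \<in> Ob B" "L \<in> Ob B"
    using c by (auto simp: is_kernel_def is_cokernel_def)
  show "arrow_of X f Y = arrow_of I j Y \<bullet> arrow_of X p I"
    using ob assms f by (simp add: cmp_arrow_of)
  have k: "kernel_arrow (arrow_of X f Y) (arrow_of K k X)" "cokernel_arrow (arrow_of K k X) (arrow_of X p I)"
    "kernel_arrow (arrow_of Y c L) (arrow_of I j Y)"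
    using c ob' ob assms(1,2) by (auto simp: is_kernel_iff is_cokernel_iff)
  then show "\<exists>k. kernel_arrow (arrow_of X f Y) k \<and> cokernel_arrow k (arrow_of X p I)" by blast
  show "epi_arrow (arrow_of X p I)" "mono_arrow (arrow_of I j Y)"
    using k by (auto dest: kernel_arrowD cokernel_arrowD)
qed

text \<open>If \<open>e\<close> is monic, the epimorphism in its canonical factorization is invertible.\<close>

lemma relative_injective_extend_mono:
  assumes ob: "N \<in> Ob B" "Q \<in> Ob B" and "is_mono B N Q e"
    and can: "canonical_factorization B N Q e I p j" and "J I Q j"
    and inj: "relative_injective B J Q'" and h: "arr h" "src h = N" "tgt h = Q'"
  obtains g where "arr g" "src g = Q" "tgt g = Q'" "g \<bullet> arrow_of N e Q = h"
proof -
  note c = canonical_factorizationD[OF ob can]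
  define E P where "E = arrow_of N e Q" and "P = arrow_of N p I"
  have E: "arr E" "src E = N" "tgt E = Q" and P: "arr P" "src P = N" "tgt P = I"
    using ob c(1-4) by (simp_all add: E_def P_def arr_arrow_of arrow_of_sel)
  obtain k where k: "kernel_arrow E k" "cokernel_arrow k P"
    using c(8) by (auto simp: E_def P_def)
  note kk = kernel_arrowD[OF k(1)]
  have "mono_arrow E"
    using assms(3) ob by (simp add: is_mono_iff E_def)
  \<comment> \<open>As \<open>E\<close> is monic, its kernel is a zero arrow. The identity of
    \<open>N\<close> kills it and thus factors through the coimage \<open>P\<close>, which gives a
    left inverse \<open>u\<close> of \<open>P\<close>.\<close>
  then have "k = zero_arrow (src k) N"
    using E kk arr_Ob[of k] ob by - (rule mono_arrowD[of E], auto)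
  then have "ident N \<bullet> k = zero_arrow (src k) N"
    using kk E by simp
  then obtain u where u: "arr u" "src u = I" "tgt u = N" "u \<bullet> P = ident N"
    using k(2) kk E P ob by (elim cokernel_factor[of _ _ "ident N"]) auto
  obtain g where g: "arr g" "src g = Q" "tgt g = Q'" "g \<bullet> arrow_of I j Q = h \<bullet> u"
    using u h ob c \<open>J I Q j\<close> by (elim relative_injectiveE[OF inj, of I Q j "h \<bullet> u"]) (auto simp: cmp_sel)
  have "g \<bullet> E = (g \<bullet> arrow_of I j Q) \<bullet> P"
    using c(5) by (simp add: E_def P_def)
  also have "\<dots> = h"
    using g u h by simp
  finally show ?thesis using that g by (simp add: E_def)
qed

text \<open>With \<open>I 0\<close> and \<open>I 1\<close> the images of \<open>d 0\<close> and \<open>d 1\<close>, the second cohomology vanishes for all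
  \<open>V\<close> iff \<open>Q 1 \<rightarrow> I 1\<close> splits, iff \<open>I 0\<close> is a retract of \<open>Q 1\<close>.\<close>

lemma Ext2_vanishing_iff:
  assumes J: "\<And>X Y j. J X Y j \<Longrightarrow> j \<in> Mor B X Y"
    and res: "relative_injective_resolution B J N Q e d"
    and Q': "relative_injective B J Q'" "J N Q' e'" "is_cokernel B N Q' e' L c"
  shows "(\<forall>V\<in>Ob B. cocycles B V Q d 2 = coboundaries B V Q d 2) \<longleftrightarrow> relative_injective B J L"
proof -
  have ob [simp]: "N \<in> Ob B" "Q' \<in> Ob B" "Q n \<in> Ob B" for n
    using res Q' by (auto simp: relative_injective_resolution_def relative_injective_def)
  have dm: "d n \<in> Mor B (Q n) (Q (Suc n))" for n
    using res by (auto simp: relative_injective_resolution_def)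
  define E D where "E = arrow_of N e (Q 0)" and "D n = arrow_of (Q n) (d n) (Q (Suc n))" for n
  have em: "e \<in> Mor B N (Q 0)" "is_mono B N (Q 0) e"
    using res by (auto simp: relative_injective_resolution_def)
  have [simp]: "arr E" "src E = N" "tgt E = Q 0" "arr (D n)" "src (D n) = Q n" "tgt (D n) = Q (Suc n)"
      "mor (D n) = d n" for n
    using em dm by (simp_all add: E_def D_def arr_arrow_of arrow_of_sel)
  obtain I p j where can: "canonical_factorization B N (Q 0) e I p j" "J I (Q 0) j"
    using res by (auto simp: relative_injective_resolution_def image_in_def)
  have "\<exists>I p j. canonical_factorization B (Q n) (Q (Suc n)) (d n) I p j \<and> J I (Q (Suc n)) j" for n
    using res by (auto simp: relative_injective_resolution_def image_in_def)
  then obtain I' p' j' where can': "canonical_factorization B (Q n) (Q (Suc n)) (d n) (I' n) (p' n) (j' n)"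
    "J (I' n) (Q (Suc n)) (j' n)" for n
    by metis
  define P F where "P n = arrow_of (Q n) (p' n) (I' n)" and "F n = arrow_of (I' n) (j' n) (Q (Suc n))" for n
  note c = canonical_factorizationD[OF _ _ can(1)] and c' = canonical_factorizationD[OF _ _ can'(1)]
  have [simp]: "I' n \<in> Ob B" "arr (P n)" "src (P n) = Q n" "tgt (P n) = I' n"
    "arr (F n)" "src (F n) = I' n" "tgt (F n) = Q (Suc n)" for n
    using c'[of n] by (simp_all add: P_def F_def arr_arrow_of arrow_of_sel)
  have D_eq: "D n = F n \<bullet> P n" for n
    using c'[of n] by (simp add: D_def F_def P_def)
  have epi: "epi_arrow (P n)" and mono: "mono_arrow (F n)" for n
    using c'[of n] by (simp_all add: F_def P_def)
  have "kernel_arrow (D 0) (arrow_of I j (Q 0))"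
    using res can(1) unfolding D_def
    by (intro exact_at_kernel[of N _ _ e]) (auto simp: relative_injective_resolution_def)
  \<comment> \<open>By exactness the image of \<open>e\<close> is a kernel of \<open>d 0\<close>, so
    the coimage of \<open>d 0\<close> is the cokernel of that image, and hence of
    \<open>e\<close>.\<close>
  then have "cokernel_arrow (arrow_of I j (Q 0)) (P 0)"
    unfolding D_def P_def using can' by (intro coimage_cokernel[of _ "Q 1"]) auto
  then have cok0: "cokernel_arrow E (P 0)"
    using c by (auto simp: E_def arrow_of_sel intro!: cokernel_arrow_epi_cmp)
  have ker: "kernel_arrow (D (Suc n)) (F n)" for n
    using res can'(1)[of n] unfolding D_def F_def
    by (intro exact_at_kernel[of "Q n" _ _ "d n"]) (auto simp: relative_injective_resolution_def)
  then have cok: "cokernel_arrow (F n) (P (Suc n))" for n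
    using can'(1)[of "Suc n"] unfolding D_def P_def by (intro coimage_cokernel[of _ "Q (Suc (Suc n))"]) auto

  have em': "e' \<in> Mor B N Q'" "L \<in> Ob B" "c \<in> Mor B Q' L"
    using Q' by (auto simp: is_cokernel_def)
  define E' C where "E' = arrow_of N e' Q'" and "C = arrow_of Q' c L"
  have [simp]: "arr E'" "src E' = N" "tgt E' = Q'" "arr C" "src C = Q'" "tgt C = L"
    using em' by (simp_all add: E'_def C_def arr_arrow_of arrow_of_sel)
  have cok': "cokernel_arrow E' C"
    using Q'(3) by (simp add: is_cokernel_iff E'_def C_def)
  \<comment> \<open>The class contains \<open>e'\<close> itself, but only the image part of
    \<open>e\<close>; hence the different rules for extending along \<open>e\<close> and along
    \<open>e'\<close>.\<close>
  obtain a where a: "arr a" "src a = Q 0" "tgt a = Q'" "a \<bullet> E = E'"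
    by (rule relative_injective_extend_mono[OF ob(1) ob(3) em(2) can Q'(1), of E']) (auto simp: E_def)
  have injQ: "relative_injective B J (Q n)" for n
    using res by (auto simp: relative_injective_resolution_def)
  obtain b where b: "arr b" "src b = Q'" "tgt b = Q 0" "b \<bullet> E' = E"
    by (rule relative_injectiveE[OF injQ[of 0] ob(1) ob(2) Q'(2) em'(1), of E]) (auto simp: E'_def)
  have "relative_injective B J (I' 0) \<longleftrightarrow> relative_injective B J L"
    using relative_injective_cokernel[OF cok0 cok' _ _ _ a(4) _ _ _ b(4) _ _ J]
      relative_injective_cokernel[OF cok' cok0 _ _ _ b(4) _ _ _ a(4) _ _ J] a b injQ[of 0] Q'(1)
    by auto
  moreover have "relative_injective B J (I' 0)"
    if H2: "\<forall>V\<in>Ob B. cocycles B V Q d 2 = coboundaries B V Q d 2"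
  proof -
    \<comment> \<open>Vanishing is exploited at the universal cocycle, the inclusion
      \<open>F 1\<close> of \<open>V = I' 1\<close>. Writing it as a coboundary yields a section
      \<open>t\<close> of \<open>P 1\<close>.\<close>
    have "D 2 \<bullet> F 1 = zero_arrow (I' 1) (Q 3)"
      using kernel_arrowD(5)[OF ker[of 1]] by (simp add: numeral_eq_Suc)
    then have "mor (F 1) \<in> cocycles B (I' 1) Q d 2"
      using mor_in[of "F 1"] mor_cmp_eq[of "D 2" "F 1"]
      by (auto simp: cocycles_def cmp_sel numeral_eq_Suc)
    then have "mor (F 1) \<in> coboundaries B (I' 1) Q d 2"
      using H2 by simp
    then obtain t0 where t0: "t0 \<in> Mor B (I' 1) (Q 1)" "mor (F 1) = d 1 \<cdot> t0"
      by (auto simp: numeral_2_eq_2)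
    define t where "t = arrow_of (I' 1) t0 (Q 1)"
    have [simp]: "arr t" "src t = I' 1" "tgt t = Q 1" "mor t = t0"
      using t0 by (simp_all add: t_def arr_arrow_of arrow_of_sel)
    have "F 1 = D 1 \<bullet> t"
      using t0 by (intro arrow_eqI) (simp_all add: cmp_sel)
    then have Pt: "P 1 \<bullet> t = ident (I' 1)"
      by - (rule mono_arrowD[OF mono[of 1]], auto simp: D_eq cmp_sel)
    \<comment> \<open>The idempotent complementary to \<open>t \<bullet> P 1\<close> lands in the
      kernel \<open>F 0\<close> of \<open>D 1\<close>; its factor \<open>s\<close> is a retraction
      of \<open>F 0\<close>. So \<open>I' 0\<close> is a retract of the relatively injective
      \<open>Q 1\<close>.\<close>
    have "D 1 \<bullet> (ident (Q 1) \<^bold>+ \<^bold>- (t \<bullet> P 1)) = zero_arrow (Q 1) (Q 2)"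
      using cmp_tail[OF Pt] by (simp add: cmp_add_right cmp_neg D_eq add_neg cmp_sel numeral_2_eq_2)
    then obtain s where s: "arr s" "src s = Q 1" "tgt s = I' 0" "F 0 \<bullet> s = ident (Q 1) \<^bold>+ \<^bold>- (t \<bullet> P 1)"
      using ker[of 0]
      by (elim kernel_factor[of _ _ "ident (Q 1) \<^bold>+ \<^bold>- (t \<bullet> P 1)"]) (auto simp: cmp_sel add_sel numeral_2_eq_2)
    have "(F 0 \<bullet> s) \<bullet> F 0 = F 0 \<^bold>+ \<^bold>- (t \<bullet> P 1 \<bullet> F 0)"
      unfolding s(4) by (simp add: cmp_add_left neg_cmp)
    also have "\<dots> = F 0"
      using cokernel_arrowD(5)[OF cok[of 0]] by simp
    finally have sF: "s \<bullet> F 0 = ident (I' 0)"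
      using s(1-3) by - (rule mono_arrowD[OF mono[of 0]], auto simp: cmp_sel)
    show ?thesis
    proof (rule relative_injectiveI)
      fix X Y j h assume *: "X \<in> Ob B" "Y \<in> Ob B" "J X Y j" "h \<in> Mor B X (I' 0)"
      define H where "H = arrow_of X h (I' 0)"
      have [simp]: "arr H" "src H = X" "tgt H = I' 0" "mor H = h"
        using * by (simp_all add: H_def arr_arrow_of arrow_of_sel)
      obtain g where g: "arr g" "src g = Y" "tgt g = Q 1" "g \<bullet> arrow_of X j Y = F 0 \<bullet> H"
        by (rule relative_injectiveE[OF injQ[of 1] *(1-3) J[OF *(3)], of "F 0 \<bullet> H"]) (auto simp: cmp_sel)
      have "(s \<bullet> g) \<bullet> arrow_of X j Y = H"
        using g cmp_tail[OF sF, of H] by simp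
      moreover have "mor ((s \<bullet> g) \<bullet> arrow_of X j Y) = mor (s \<bullet> g) \<cdot> j"
        using g s J[OF *(3)] * by (subst cmp_sel(3)) (auto simp: arr_arrow_of arrow_of_sel cmp_sel)
      moreover have "mor (s \<bullet> g) \<in> Mor B Y (I' 0)"
        using mor_in[of "s \<bullet> g"] g s by (simp add: cmp_sel)
      ultimately show "\<exists>g\<in>Mor B Y (I' 0). g \<cdot> j = h"
        by (metis \<open>mor H = h\<close>)
    qed (use J in auto)
  qed
  moreover have "cocycles B V Q d 2 = coboundaries B V Q d 2"
    if inj: "relative_injective B J (I' 0)" and V: "V \<in> Ob B" for V
  proof -
    \<comment> \<open>The argument is reversed: relative injectivity of \<open>I' 0\<close> splits
      \<open>F 0\<close>, and the idempotent complementary to \<open>F 0 \<bullet> s\<close> factors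
      through \<open>P 1\<close> as a section \<open>t\<close>. A cocycle factors through
      \<open>F 1\<close>, so \<open>t\<close> lifts it along \<open>D 1\<close>.\<close>
    obtain s where s: "arr s" "src s = Q 1" "tgt s = I' 0" "s \<bullet> F 0 = ident (I' 0)"
      by (rule relative_injectiveE[OF inj _ _ can'(2)[of 0] J[OF can'(2)[of 0]], of "ident (I' 0)"]) (auto simp: F_def)
    have "(ident (Q 1) \<^bold>+ \<^bold>- (F 0 \<bullet> s)) \<bullet> F 0 = zero_arrow (I' 0) (Q 1)"
      using s by (simp add: cmp_add_left neg_cmp add_neg)
    then obtain t where t: "arr t" "src t = I' 1" "tgt t = Q 1" "t \<bullet> P 1 = ident (Q 1) \<^bold>+ \<^bold>- (F 0 \<bullet> s)"
      using cok[of 0] s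
      by (elim cokernel_factor[of _ _ "ident (Q 1) \<^bold>+ \<^bold>- (F 0 \<bullet> s)"]) (auto simp: cmp_sel add_sel)
    have PF: "P 1 \<bullet> F 0 = zero_arrow (I' 0) (I' 1)"
      using cokernel_arrowD(5)[OF cok[of 0]] by simp
    have "(P 1 \<bullet> t) \<bullet> P 1 = P 1 \<^bold>+ \<^bold>- (P 1 \<bullet> F 0 \<bullet> s)"
      using t by (simp add: cmp_add_right cmp_neg)
    also have "P 1 \<bullet> F 0 \<bullet> s = zero_arrow (Q 1) (I' 1)"
      using cmp_tail[OF PF, of s] s by simp
    finally have Pt: "P 1 \<bullet> t = ident (I' 1)"
      using t(1-3) by - (rule epi_arrowD[OF epi[of 1]], auto simp: cmp_sel)
    show ?thesis
    proof (intro equalityI subsetI)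
      fix f assume "f \<in> cocycles B V Q d 2"
      then have f: "f \<in> Mor B V (Q 2)" "d 2 \<cdot> f = zero_mor B V (Q 3)"
        by (auto simp: cocycles_def)
      define \<phi> where "\<phi> = arrow_of V f (Q 2)"
      have [simp]: "arr \<phi>" "src \<phi> = V" "tgt \<phi> = Q 2" "mor \<phi> = f"
        using f V by (simp_all add: \<phi>_def arr_arrow_of arrow_of_sel)
      have "D 2 \<bullet> \<phi> = zero_arrow V (Q 3)"
        using f V by (intro arrow_eqI) (simp_all add: cmp_sel)
      then obtain \<psi> where \<psi>: "arr \<psi>" "src \<psi> = V" "tgt \<psi> = I' 1" "F 1 \<bullet> \<psi> = \<phi>"
        using ker[of 1] by (elim kernel_factor[of _ _ \<phi>]) (auto simp: numeral_eq_Suc)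
      have "D 1 \<bullet> t \<bullet> \<psi> = \<phi>"
        using cmp_tail[OF Pt, of \<psi>] \<psi> by (simp add: D_eq)
      from mor_cmp_eq[OF this] have "f = d 1 \<cdot> mor (t \<bullet> \<psi>)"
        using \<psi>(1-3) t by (simp add: cmp_sel)
      moreover have "mor (t \<bullet> \<psi>) \<in> Mor B V (Q 1)"
        using \<psi> t mor_in[of "t \<bullet> \<psi>"] by (simp add: cmp_sel)
      ultimately show "f \<in> coboundaries B V Q d 2"
        by (auto simp: numeral_2_eq_2)
    next
      fix f assume "f \<in> coboundaries B V Q d 2"
      then obtain f0 where f0: "f0 \<in> Mor B V (Q 1)" "f = d 1 \<cdot> f0"
        by (auto simp: numeral_2_eq_2)
      define \<psi> where "\<psi> = arrow_of V f0 (Q 1)"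
      have \<psi> [simp]: "arr \<psi>" "src \<psi> = V" "tgt \<psi> = Q 1" "mor \<psi> = f0"
        using f0 V by (simp_all add: \<psi>_def arr_arrow_of arrow_of_sel)
      have DF: "D 2 \<bullet> F 1 = zero_arrow (I' 1) (Q 3)"
        using kernel_arrowD(5)[OF ker[of 1]] by (simp add: numeral_eq_Suc)
      have "D 2 \<bullet> D 1 \<bullet> \<psi> = zero_arrow V (Q 3)"
        unfolding D_eq[of 1] cmp_assoc using cmp_tail[OF DF] by (simp add: cmp_sel)
      moreover have "mor (D 1 \<bullet> \<psi>) = f"
        using f0 by (simp add: cmp_sel)
      ultimately show "f \<in> cocycles B V Q d 2"
        using mor_in[of "D 1 \<bullet> \<psi>"] V mor_cmp_eq[of "D 2" "D 1 \<bullet> \<psi>"]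
        by (simp add: cocycles_def cmp_sel numeral_eq_Suc)
    qed
  qed
  ultimately show ?thesis by blast
qed

text \<open>Cocycles are the kernel and coboundaries the image of homomorphisms between hom groups,
  and \<open>dd\<close> puts one inside the other. The quotient is thus a genuine factor group,
  which is trivial iff there is only one coset.\<close>

lemma trivial_hom_cohomology_iff:
  assumes V: "V \<in> Ob B" and Q: "\<And>n. Q n \<in> Ob B" and d: "\<And>n. d n \<in> Mor B (Q n) (Q (Suc n))"
    and dd: "\<And>n. d (Suc n) \<cdot> d n = zero_mor B (Q n) (Q (Suc (Suc n)))"
  shows "trivial_group (hom_cohomology B V Q d n) \<longleftrightarrow> cocycles B V Q d n = coboundaries B V Q d n"
proof -
  let ?G = "(hom_group B V (Q n))\<lparr>carrier := cocycles B V Q d n\<rparr>"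
  let ?H = "coboundaries B V Q d n"
  interpret G: comm_group "hom_group B V (Q n)"
    by (rule hom_comm_group[OF V Q])
  interpret G': comm_group "hom_group B V (Q (Suc n))"
    by (rule hom_comm_group[OF V Q])
  have "group_hom (hom_group B V (Q n)) (hom_group B V (Q (Suc n))) (comp B (d n))"
    using V Q d by unfold_locales (auto simp: hom_def hom_group_simps comp_in comp_add_right[of V "Q n" "Q (Suc n)"] intro: comp_in)
  then have "subgroup (kernel (hom_group B V (Q n)) (hom_group B V (Q (Suc n))) (comp B (d n))) (hom_group B V (Q n))"
    by (rule group_hom.subgroup_kernel)
  then have Z: "subgroup (cocycles B V Q d n) (hom_group B V (Q n))"
    by (simp add: kernel_def cocycles_def hom_group_simps)
  have B: "subgroup ?H (hom_group B V (Q n)) \<and> ?H \<subseteq> cocycles B V Q d n"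
  proof (cases n)
    case 0
    have "d 0 \<cdot> zero_mor B V (Q 0) = zero_mor B V (Q (Suc 0))"
      using mor_cmp_eq[of "arrow_of (Q 0) (d 0) (Q (Suc 0))" "zero_arrow V (Q 0)"] V Q d
      by (simp add: arr_arrow_of arrow_of_sel)
    then show ?thesis
      using G.triv_subgroup 0 V Q by (auto simp: hom_group_simps cocycles_def zero_mor_in)
  next
    case (Suc m)
    interpret Gm: comm_group "hom_group B V (Q m)"
      by (rule hom_comm_group[OF V Q])
    have "group_hom (hom_group B V (Q m)) (hom_group B V (Q n)) (comp B (d m))"
      using V Q d Suc by unfold_locales (auto simp: hom_def hom_group_simps comp_add_right[of V "Q m" "Q (Suc m)"] intro: comp_in)
    then have "subgroup (comp B (d m) ` carrier (hom_group B V (Q m))) (hom_group B V (Q n))"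
      by (rule group_hom.img_is_subgroup)
    moreover have "d n \<cdot> (d m \<cdot> f) = zero_mor B V (Q (Suc n))" if f: "f \<in> Mor B V (Q m)" for f
    proof -
      have "d n \<cdot> (d m \<cdot> f) = (d n \<cdot> d m) \<cdot> f"
        using V Q d Suc f by (intro comp_assoc[symmetric, of V "Q m" "Q n" "Q (Suc n)"]) auto
      also have "\<dots> = zero_mor B V (Q (Suc n))"
        using mor_cmp_eq[of "zero_arrow (Q m) (Q (Suc n))" "arrow_of V f (Q m)"] V Q f dd[of m] Suc
        by (simp add: arr_arrow_of arrow_of_sel)
      finally show ?thesis .
    qed
    moreover have "d m \<cdot> f \<in> Mor B V (Q n)" if "f \<in> Mor B V (Q m)" for f
      using V Q d Suc that comp_in[of V "Q m" "Q n"] by auto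
    ultimately show ?thesis
      using Suc by (auto simp: hom_group_simps cocycles_def)
  qed
  interpret Z: comm_group ?G
    by (intro comm_group.intro comm_monoid.intro Group.comm_monoid_axioms.intro group.is_monoid G.subgroup_imp_group[OF Z]) (use subgroup.subset[OF Z] G.m_comm in auto)
  have HZ: "subgroup ?H ?G"
    using B Z by (auto intro: G.subgroup_incl)
  then have N: "?H \<lhd> ?G"
    by (rule Z.subgroup_imp_normal)
  then have grp: "group (?G Mod ?H)"
    by (rule normal.factorgroup_is_group)
  have "trivial_group (?G Mod ?H) \<longleftrightarrow> rcosets\<^bsub>?G\<^esub> ?H = {?H}"
    using grp by (simp add: trivial_group_def FactGroup_def)
  also have "\<dots> \<longleftrightarrow> carrier ?G = ?H"
  proof
    assume *: "rcosets\<^bsub>?G\<^esub> ?H = {?H}"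
    have "\<Union>(rcosets\<^bsub>?G\<^esub> ?H) = carrier ?G"
      by (rule Z.rcosets_part_G[OF HZ])
    with * show "carrier ?G = ?H" by simp
  next
    assume *: "carrier ?G = ?H"
    have "?H #>\<^bsub>?G\<^esub> x = ?H" if "x \<in> carrier ?G" for x
      using that * Z.coset_join2[OF that HZ] by simp
    then show "rcosets\<^bsub>?G\<^esub> ?H = {?H}"
      using Z.one_closed by (auto simp: RCOSETS_def)
  qed
  finally show ?thesis
    by (auto simp: hom_cohomology_def)
qed
end

section \<open>Existence of resolutions, and the vanishing of Ext\<close>

context preadditive_category
begin

text \<open>Because \<open>j\<close> can be cancelled on the left, \<open>p\<close> and
  \<open>j \<bullet> p\<close> kill the same arrows.\<close>

lemma kernel_arrow_mono_cmp:
  assumes "kernel_arrow p k" "mono_arrow j" "src j = tgt p"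
  shows "kernel_arrow (j \<bullet> p) k"
proof -
  note kk = kernel_arrowD[OF assms(1)]
  have j: "arr j" using assms(2) by (simp add: mono_arrow_def)
  have *: "p \<bullet> h = zero_arrow (src h) (tgt p)"
    if "arr h" "tgt h = src p" "j \<bullet> p \<bullet> h = zero_arrow (src h) (tgt j)" for h
    using that kk j assms(3) arr_Ob[of h] arr_Ob[of p]
    by - (rule mono_arrowD[OF assms(2)], auto simp: cmp_sel)
  show ?thesis
    unfolding kernel_arrow_def
  proof (intro conjI allI impI; (elim conjE)?)
    fix h assume "arr h" "tgt h = src (j \<bullet> p)" "(j \<bullet> p) \<bullet> h = zero_arrow (src h) (tgt (j \<bullet> p))"
    then have "arr h" "tgt h = src p" "p \<bullet> h = zero_arrow (src h) (tgt p)"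
      using * kk j assms(3) by (auto simp: cmp_sel)
    then show "\<exists>u. arr u \<and> src u = src h \<and> tgt u = src k \<and> k \<bullet> u = h"
      using assms(1) by (elim kernel_factor) auto
  qed (use assms kk j arr_Ob[of k] in \<open>auto simp: cmp_sel\<close>)
qed

text \<open>The short exact sequences
  \<open>K n \<rightarrow> qf (K n) \<rightarrow> K (Suc n)\<close> are spliced, where
  \<open>K n\<close> is the n-fold iterated cokernel starting from \<open>N\<close>. They display
  each differential directly as its canonical factorization.\<close>

lemma relative_injective_resolution_exists:
  assumes N: "N \<in> Ob B" and Z: "Z \<in> Ob B" "idm B Z = zero_mor B Z Z"
    and J: "\<And>X Y j. J X Y j \<Longrightarrow> j \<in> Mor B X Y"
    and enough: "\<And>X. X \<in> Ob B \<Longrightarrow> \<exists>Q e L p. relative_injective B J Q \<and> J X Q e \<and>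
      is_cokernel B X Q e L p \<and> is_kernel B Q L p X e"
  obtains Q e d where "relative_injective_resolution B J N Q e d"
proof -
  obtain qf ef lf pf where f: "\<And>X. X \<in> Ob B \<Longrightarrow> relative_injective B J (qf X)"
    "\<And>X. X \<in> Ob B \<Longrightarrow> J X (qf X) (ef X)"
    "\<And>X. X \<in> Ob B \<Longrightarrow> is_cokernel B X (qf X) (ef X) (lf X) (pf X)"
    "\<And>X. X \<in> Ob B \<Longrightarrow> is_kernel B (qf X) (lf X) (pf X) X (ef X)"
    using enough by metis
  define K where "K n = (lf ^^ n) N" for n
  have KS: "K (Suc n) = lf (K n)" for n by (simp add: K_def)
  have K [simp]: "K n \<in> Ob B" for n
    by (induction n) (use N f(3) in \<open>auto simp: K_def is_cokernel_def\<close>)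
  have q [simp]: "qf (K n) \<in> Ob B" for n
    using f(1)[of "K n"] by (simp add: relative_injective_def)
  have m: "ef (K n) \<in> Mor B (K n) (qf (K n))" "pf (K n) \<in> Mor B (qf (K n)) (K (Suc n))" for n
    using f(3)[of "K n"] by (auto simp: is_cokernel_def KS)
  define d where "d n = ef (K (Suc n)) \<cdot> pf (K n)" for n
  define E P where "E n = arrow_of (K n) (ef (K n)) (qf (K n))"
    and "P n = arrow_of (qf (K n)) (pf (K n)) (K (Suc n))" for n
  have [simp]: "arr (E n)" "src (E n) = K n" "tgt (E n) = qf (K n)"
    "arr (P n)" "src (P n) = qf (K n)" "tgt (P n) = K (Suc n)" for n
    using m[of n] by (simp_all add: E_def P_def arr_arrow_of arrow_of_sel)
  have dm: "d n \<in> Mor B (qf (K n)) (qf (K (Suc n)))" for n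
    using m comp_in[of "qf (K n)" "K (Suc n)"] by (simp add: d_def)
  have D: "arrow_of (qf (K n)) (d n) (qf (K (Suc n))) = E (Suc n) \<bullet> P n" for n
    using m by (simp add: E_def P_def cmp_arrow_of d_def)
  have ck: "cokernel_arrow (E n) (P n)" "kernel_arrow (P n) (E n)" for n
    using f(3)[of "K n"] f(4)[of "K n"] m[of n] K[of "Suc n", unfolded KS]
    by (auto simp: is_cokernel_iff is_kernel_iff E_def P_def KS)
  have ckD: "cokernel_arrow (E (Suc n) \<bullet> P n) (P (Suc n))" "kernel_arrow (E (Suc n) \<bullet> P n) (E n)" for n
    using cokernel_arrowD(2)[OF ck(1)[of n]] kernel_arrowD(2)[OF ck(2)[of "Suc n"]]
      cokernel_arrow_epi_cmp[OF ck(1)[of "Suc n"], of "P n"] kernel_arrow_mono_cmp[OF ck(2)[of n], of "E (Suc n)"]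
    by auto
  have mono: "is_mono B (K n) (qf (K n)) (ef (K n))" for n
    using kernel_arrowD(2)[OF ck(2)[of n]] m by (simp add: is_mono_iff E_def)
  \<comment> \<open>The first map is monic: its kernel starts at the zero object \<open>Z\<close>,
    and the identity is a cokernel of that kernel, hence the coimage.\<close>
  have can0: "canonical_factorization B (K 0) (qf (K 0)) (ef (K 0)) (K 0) (idm B (K 0)) (ef (K 0))"
  proof -
    have "ef (K 0) = ef (K 0) \<cdot> idm B (K 0)"
      using idm_right[OF K q m(1)[of 0]] by simp
    moreover have zZ: "h = zero_arrow (src h) Z" if "arr h" "tgt h = Z" for h
    proof -
      have "ident Z = zero_arrow Z Z"
        using Z by (simp add: ident_def zero_arrow_def)
      then have "ident Z \<bullet> h = zero_arrow Z Z \<bullet> h" by simp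
      then show ?thesis using that Z by simp
    qed
    moreover have Zz: "h = zero_arrow Z (tgt h)" if "arr h" "src h = Z" for h
    proof -
      have "ident Z = zero_arrow Z Z"
        using Z by (simp add: ident_def zero_arrow_def)
      then have "h \<bullet> ident Z = h \<bullet> zero_arrow Z Z" by simp
      then show ?thesis using that Z by simp
    qed
    have "kernel_arrow (E 0) (zero_arrow Z (K 0))"
      unfolding kernel_arrow_def
    proof (intro conjI allI impI; (elim conjE)?)
      show "mono_arrow (zero_arrow Z (K 0))"
        using Z zZ by (auto simp: mono_arrow_def) metis
      fix h assume h: "arr h" "tgt h = src (E 0)" "E 0 \<bullet> h = zero_arrow (src h) (tgt (E 0))"
      then have "h = zero_arrow (src h) (K 0)"
        using arr_Ob[of h] by - (rule mono_arrowD[OF kernel_arrowD(2)[OF ck(2)[of 0]]], auto)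
      then show "\<exists>u. arr u \<and> src u = src h \<and> tgt u = src (zero_arrow Z (K 0)) \<and> zero_arrow Z (K 0) \<bullet> u = h"
        using h Z arr_Ob[of h] by (intro exI[of _ "zero_arrow (src h) Z"]) auto
    qed (use Z in auto)
    then have "is_kernel B (K 0) (qf (K 0)) (ef (K 0)) Z (zero_mor B Z (K 0))"
      using Z m[of 0] by (simp add: is_kernel_iff E_def zero_arrow_def zero_mor_in)
    moreover have "cokernel_arrow (zero_arrow Z (K 0)) (ident (K 0))"
      using Z split_epi_arrow[of "ident (K 0)" "ident (K 0)"]
      by (auto simp: cokernel_arrow_def)
    then have "is_cokernel B Z (K 0) (zero_mor B Z (K 0)) (K 0) (idm B (K 0))"
      using Z by (simp add: is_cokernel_iff ident_def zero_arrow_def zero_mor_in idm_in)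
    ultimately show ?thesis
      using f(3)[of "K 0"] f(4)[of "K 0"] unfolding canonical_factorization_def by auto
  qed
  have kD: "is_kernel B (qf (K n)) (qf (K (Suc n))) (d n) (K n) (ef (K n))" for n
    using ckD(2)[of n] dm[of n] m[of n] by (simp add: is_kernel_iff D E_def)
  have cD: "is_cokernel B (qf (K n)) (qf (K (Suc n))) (d n) (K (Suc (Suc n))) (pf (K (Suc n)))" for n
    using ckD(1)[of n] dm[of n] m[of "Suc n"] by (simp add: is_cokernel_iff D P_def)
  have can: "canonical_factorization B (qf (K n)) (qf (K (Suc n))) (d n) (K (Suc n)) (pf (K n)) (ef (K (Suc n)))" for n
    using kD[of n] cD[of n] f(3)[OF K, of n] f(4)[OF K, of "Suc n"]
    unfolding canonical_factorization_def d_def KS[symmetric] by blast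
  have "relative_injective_resolution B J N (\<lambda>n. qf (K n)) (ef N) d"
    unfolding relative_injective_resolution_def image_in_def exact_at_def
  proof (intro conjI allI)
    have K0: "K 0 = N" by (simp add: K_def)
    show "N \<in> Ob B" "ef N \<in> Mor B N (qf (K 0))" "is_mono B N (qf (K 0)) (ef N)"
      using N m(1)[of 0] mono[of 0] by (simp_all add: K0)
    show "\<exists>I p j. canonical_factorization B N (qf (K 0)) (ef N) I p j \<and> is_kernel B (qf (K 0)) (qf (K 1)) (d 0) I j"
      using can0 kD[of 0] by (auto simp: K0)
    show "\<exists>I p j. canonical_factorization B N (qf (K 0)) (ef N) I p j \<and> J I (qf (K 0)) j"
      using can0 f(2)[OF K, of 0] by (auto simp: K0)
    fix n
    show "\<exists>I p j. canonical_factorization B (qf (K n)) (qf (K (Suc n))) (d n) I p j \<and>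
        is_kernel B (qf (K (Suc n))) (qf (K (Suc (Suc n)))) (d (Suc n)) I j"
      using can[of n] kD[of "Suc n"] by blast
    show "\<exists>I p j. canonical_factorization B (qf (K n)) (qf (K (Suc n))) (d n) I p j \<and> J I (qf (K (Suc n))) j"
      using can[of n] f(2)[OF K, of "Suc n"] by blast
  qed (use f(1)[OF K] dm in auto)
  then show ?thesis using that by blast
qed

lemma resolution_differential_zero:
  assumes "relative_injective_resolution B J N Q e d"
  shows "d (Suc n) \<cdot> d n = zero_mor B (Q n) (Q (Suc (Suc n)))"
proof -
  have Q: "Q n \<in> Ob B" for n
    using assms by (auto simp: relative_injective_resolution_def relative_injective_def)
  obtain I p j where c: "canonical_factorization B (Q n) (Q (Suc n)) (d n) I p j"
    "is_kernel B (Q (Suc n)) (Q (Suc (Suc n))) (d (Suc n)) I j"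
    using assms unfolding relative_injective_resolution_def exact_at_def by blast
  note cc = canonical_factorizationD[OF Q Q c(1)]
  have "d (Suc n) \<in> Mor B (Q (Suc n)) (Q (Suc (Suc n)))" "d (Suc n) \<cdot> j = zero_mor B I (Q (Suc (Suc n)))"
    using c(2) by (auto simp: is_kernel_def)
  moreover have "d n = j \<cdot> p"
    using c(1) by (simp add: canonical_factorization_def)
  moreover have "zero_mor B I (Q (Suc (Suc n))) \<cdot> p = zero_mor B (Q n) (Q (Suc (Suc n)))"
    using mor_cmp_eq[of "zero_arrow I (Q (Suc (Suc n)))" "arrow_of (Q n) p I"] cc(1,3) Q
    by (simp add: arr_arrow_of arrow_of_sel)
  ultimately show ?thesis
    using comp_assoc[of "Q n" I "Q (Suc n)" "Q (Suc (Suc n))" p j "d (Suc n)"] cc Q by simp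
qed

text \<open>\<open>Ext\<close> is built from a resolution selected by \<open>SOME\<close>. Existence
  makes the selected triple a resolution, and the vanishing criterion holds for every
  resolution.\<close>

lemma trivial_Ext2_iff:
  assumes N: "N \<in> Ob B" and Z: "Z \<in> Ob B" "idm B Z = zero_mor B Z Z"
    and J: "\<And>X Y j. J X Y j \<Longrightarrow> j \<in> Mor B X Y"
    and enough: "\<And>X. X \<in> Ob B \<Longrightarrow> \<exists>Q e L p. relative_injective B J Q \<and> J X Q e \<and>
      is_cokernel B X Q e L p \<and> is_kernel B Q L p X e"
    and Q': "relative_injective B J Q'" "J N Q' e'" "is_cokernel B N Q' e' L c"
  shows "(\<forall>V\<in>Ob B. trivial_group (Ext B J 2 V N)) \<longleftrightarrow> relative_injective B J L"
proof -
  obtain Q e d where Qed: "(SOME (Q, e, d). relative_injective_resolution B J N Q e d) = (Q, e, d)"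
    by (metis prod_cases3)
  obtain Q0 e0 d0 where "relative_injective_resolution B J N Q0 e0 d0"
    using relative_injective_resolution_exists[where J = J, OF N Z J enough] by blast
  then have "case (SOME (Q, e, d). relative_injective_resolution B J N Q e d) of
      (Q, e, d) \<Rightarrow> relative_injective_resolution B J N Q e d"
    by (intro someI[of "\<lambda>(Q, e, d). relative_injective_resolution B J N Q e d" "(Q0, e0, d0)"]) simp
  then have res: "relative_injective_resolution B J N Q e d"
    by (simp add: Qed)
  have "trivial_group (Ext B J 2 V N) \<longleftrightarrow> cocycles B V Q d 2 = coboundaries B V Q d 2" if "V \<in> Ob B" for V
    unfolding Ext_def Qed
    using trivial_hom_cohomology_iff[of V Q d 2] that res resolution_differential_zero[OF res]
    by (auto simp: relative_injective_resolution_def relative_injective_def)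
  then show ?thesis
    using Ext2_vanishing_iff[where J = J, OF J res Q'] by simp
qed

end

section \<open>Tensor products of arrows\<close>

context monoidal_category
begin

notation cmp (infixr "\<bullet>" 75)

definition tensor (infixl "\<boxtimes>" 80) where
  "a \<boxtimes> b = (if arr a \<and> arr b then Some (src a \<otimes>\<^sub>o src b, mor a \<otimes>\<^sub>m mor b, tgt a \<otimes>\<^sub>o tgt b) else None)"

definition inverse_arrow where
  "inverse_arrow X Y f = arrow_of Y (SOME g. g \<in> Mor M Y X \<and> g \<cdot> f = idm M X \<and> f \<cdot> g = idm M Y) X"

abbreviation unit ("\<I>") where "\<I> \<equiv> unit_ob M"

definition al where "al X Y Z = arrow_of ((X \<otimes>\<^sub>o Y) \<otimes>\<^sub>o Z) (assoc M X Y Z) (X \<otimes>\<^sub>o (Y \<otimes>\<^sub>o Z))"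
definition al' where "al' X Y Z = inverse_arrow ((X \<otimes>\<^sub>o Y) \<otimes>\<^sub>o Z) (X \<otimes>\<^sub>o (Y \<otimes>\<^sub>o Z)) (assoc M X Y Z)"
definition lu where "lu X = arrow_of (\<I> \<otimes>\<^sub>o X) (lunit M X) X"
definition lu' where "lu' X = inverse_arrow (\<I> \<otimes>\<^sub>o X) X (lunit M X)"
definition ru where "ru X = arrow_of (X \<otimes>\<^sub>o \<I>) (runit M X) X"
definition ru' where "ru' X = inverse_arrow (X \<otimes>\<^sub>o \<I>) X (runit M X)"

declare unit_in [simp] tens_ob_in [simp]

lemma arr_tensor [simp]: "arr (a \<boxtimes> b) \<longleftrightarrow> arr a \<and> arr b"
  by (auto simp: tensor_def arr_def src_def tgt_def mor_def intro: tens_mor_in)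

lemma tensor_sel [simp]:
  assumes "arr a" "arr b"
  shows "src (a \<boxtimes> b) = src a \<otimes>\<^sub>o src b" "tgt (a \<boxtimes> b) = tgt a \<otimes>\<^sub>o tgt b" "mor (a \<boxtimes> b) = mor a \<otimes>\<^sub>m mor b"
  using assms by (simp_all add: tensor_def src_def tgt_def mor_def)

lemma ident_tensor [simp]: "X \<in> Ob M \<Longrightarrow> Y \<in> Ob M \<Longrightarrow> ident X \<boxtimes> ident Y = ident (X \<otimes>\<^sub>o Y)"
  by (intro arrow_eqI) (simp_all add: tens_idm)

lemma interchange:
  assumes "arr a" "arr b" "arr a'" "arr b'" "tgt a = src a'" "tgt b = src b'"
  shows "(a' \<boxtimes> b') \<bullet> (a \<boxtimes> b) = (a' \<bullet> a) \<boxtimes> (b' \<bullet> b)"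
proof (intro arrow_eqI)
  have "(mor a' \<cdot> mor a) \<otimes>\<^sub>m (mor b' \<cdot> mor b) = (mor a' \<otimes>\<^sub>m mor b') \<cdot> (mor a \<otimes>\<^sub>m mor b)"
    using assms mor_in[of a] mor_in[of b] mor_in[of a'] mor_in[of b'] arr_Ob[of a] arr_Ob[of b] arr_Ob[of a'] arr_Ob[of b']
    by (intro tens_comp[of "src a" "tgt a" "tgt a'" "src b" "tgt b" "tgt b'"]) auto
  then show "mor ((a' \<boxtimes> b') \<bullet> (a \<boxtimes> b)) = mor ((a' \<bullet> a) \<boxtimes> (b' \<bullet> b))"
    using assms by (simp add: cmp_sel)
qed (use assms in \<open>auto simp: cmp_sel\<close>)

lemma interchange_tail:
  assumes "arr a" "arr b" "arr a'" "arr b'" "tgt a = src a'" "tgt b = src b'"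
  shows "(a' \<boxtimes> b') \<bullet> (a \<boxtimes> b) \<bullet> x = ((a' \<bullet> a) \<boxtimes> (b' \<bullet> b)) \<bullet> x"
  by (metis interchange[OF assms] cmp_assoc)

lemma inverse_arrow:
  assumes "is_iso M X Y f" "X \<in> Ob M" "Y \<in> Ob M"
  shows "arr (inverse_arrow X Y f)" "src (inverse_arrow X Y f) = Y" "tgt (inverse_arrow X Y f) = X"
    and "inverse_arrow X Y f \<bullet> arrow_of X f Y = ident X" "arrow_of X f Y \<bullet> inverse_arrow X Y f = ident Y"
proof -
  define g where "g = (SOME g. g \<in> Mor M Y X \<and> g \<cdot> f = idm M X \<and> f \<cdot> g = idm M Y)"
  have f: "f \<in> Mor M X Y" using assms(1) by (simp add: is_iso_def)
  have "\<exists>g. g \<in> Mor M Y X \<and> g \<cdot> f = idm M X \<and> f \<cdot> g = idm M Y"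
    using assms(1) by (auto simp: is_iso_def)
  then have g: "g \<in> Mor M Y X" "g \<cdot> f = idm M X" "f \<cdot> g = idm M Y"
    unfolding g_def by (metis (mono_tags, lifting) someI_ex)+
  show "arr (inverse_arrow X Y f)" "src (inverse_arrow X Y f) = Y" "tgt (inverse_arrow X Y f) = X"
    and "inverse_arrow X Y f \<bullet> arrow_of X f Y = ident X" "arrow_of X f Y \<bullet> inverse_arrow X Y f = ident Y"
    using f g assms(2,3)
    by (simp_all add: inverse_arrow_def g_def[symmetric] arr_arrow_of arrow_of_sel cmp_arrow_of ident_def)
qed

lemma al_typing [simp]:
  assumes "X \<in> Ob M" "Y \<in> Ob M" "Z \<in> Ob M"
  shows "arr (al X Y Z)" "src (al X Y Z) = (X \<otimes>\<^sub>o Y) \<otimes>\<^sub>o Z" "tgt (al X Y Z) = X \<otimes>\<^sub>o (Y \<otimes>\<^sub>o Z)"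
    "mor (al X Y Z) = assoc M X Y Z"
    "arr (al' X Y Z)" "tgt (al' X Y Z) = (X \<otimes>\<^sub>o Y) \<otimes>\<^sub>o Z" "src (al' X Y Z) = X \<otimes>\<^sub>o (Y \<otimes>\<^sub>o Z)"
    "al X Y Z \<bullet> al' X Y Z = ident (X \<otimes>\<^sub>o (Y \<otimes>\<^sub>o Z))"
    "al' X Y Z \<bullet> al X Y Z = ident ((X \<otimes>\<^sub>o Y) \<otimes>\<^sub>o Z)"
  using assms assoc_iso[OF assms] inverse_arrow[OF assoc_iso[OF assms]]
  by (simp_all add: al_def al'_def is_iso_def arr_arrow_of arrow_of_sel)

lemma lu_typing [simp]:
  assumes "X \<in> Ob M"
  shows "arr (lu X)" "src (lu X) = \<I> \<otimes>\<^sub>o X" "tgt (lu X) = X" "mor (lu X) = lunit M X"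
    "arr (lu' X)" "tgt (lu' X) = \<I> \<otimes>\<^sub>o X" "src (lu' X) = X"
    "lu X \<bullet> lu' X = ident X" "lu' X \<bullet> lu X = ident (\<I> \<otimes>\<^sub>o X)"
  using assms lunit_iso[OF assms] inverse_arrow[OF lunit_iso[OF assms]]
  by (simp_all add: lu_def lu'_def is_iso_def arr_arrow_of arrow_of_sel)

lemma ru_typing [simp]:
  assumes "X \<in> Ob M"
  shows "arr (ru X)" "src (ru X) = X \<otimes>\<^sub>o \<I>" "tgt (ru X) = X" "mor (ru X) = runit M X"
    "arr (ru' X)" "tgt (ru' X) = X \<otimes>\<^sub>o \<I>" "src (ru' X) = X"
    "ru X \<bullet> ru' X = ident X" "ru' X \<bullet> ru X = ident (X \<otimes>\<^sub>o \<I>)"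
  using assms runit_iso[OF assms] inverse_arrow[OF runit_iso[OF assms]]
  by (simp_all add: ru_def ru'_def is_iso_def arr_arrow_of arrow_of_sel)

lemma iso_tail [simp]:
  assumes "arr x"
  shows "X \<in> Ob M \<Longrightarrow> Y \<in> Ob M \<Longrightarrow> Z \<in> Ob M \<Longrightarrow> tgt x = X \<otimes>\<^sub>o (Y \<otimes>\<^sub>o Z) \<Longrightarrow> al X Y Z \<bullet> al' X Y Z \<bullet> x = x"
    "X \<in> Ob M \<Longrightarrow> Y \<in> Ob M \<Longrightarrow> Z \<in> Ob M \<Longrightarrow> tgt x = (X \<otimes>\<^sub>o Y) \<otimes>\<^sub>o Z \<Longrightarrow> al' X Y Z \<bullet> al X Y Z \<bullet> x = x"
    "X \<in> Ob M \<Longrightarrow> tgt x = X \<Longrightarrow> lu X \<bullet> lu' X \<bullet> x = x"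
    "X \<in> Ob M \<Longrightarrow> tgt x = \<I> \<otimes>\<^sub>o X \<Longrightarrow> lu' X \<bullet> lu X \<bullet> x = x"
    "X \<in> Ob M \<Longrightarrow> tgt x = X \<Longrightarrow> ru X \<bullet> ru' X \<bullet> x = x"
    "X \<in> Ob M \<Longrightarrow> tgt x = X \<otimes>\<^sub>o \<I> \<Longrightarrow> ru' X \<bullet> ru X \<bullet> x = x"
  using assms by (simp_all flip: cmp_assoc)

lemma al_natural:
  assumes "arr f" "arr g" "arr h"
  shows "al (tgt f) (tgt g) (tgt h) \<bullet> ((f \<boxtimes> g) \<boxtimes> h) = (f \<boxtimes> (g \<boxtimes> h)) \<bullet> al (src f) (src g) (src h)"
  using assms mor_in[of f] mor_in[of g] mor_in[of h] arr_Ob[of f] arr_Ob[of g] arr_Ob[of h]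
  by (intro arrow_eqI) (auto simp: cmp_sel intro: assoc_natural)

lemma lu_natural:
  assumes "arr f" shows "lu (tgt f) \<bullet> (ident \<I> \<boxtimes> f) = f \<bullet> lu (src f)"
  using assms mor_in[of f] arr_Ob[of f] by (intro arrow_eqI) (auto simp: cmp_sel intro: lunit_natural)

lemma ru_natural:
  assumes "arr f" shows "ru (tgt f) \<bullet> (f \<boxtimes> ident \<I>) = f \<bullet> ru (src f)"
  using assms mor_in[of f] arr_Ob[of f] by (intro arrow_eqI) (auto simp: cmp_sel intro: runit_natural)

lemma al'_natural:
  assumes "arr f" "arr g" "arr h"
  shows "al' (tgt f) (tgt g) (tgt h) \<bullet> (f \<boxtimes> (g \<boxtimes> h)) = ((f \<boxtimes> g) \<boxtimes> h) \<bullet> al' (src f) (src g) (src h)"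
proof -
  note [simp] = arr_Ob[OF assms(1)] arr_Ob[OF assms(2)] arr_Ob[OF assms(3)] assms
  have "al' (tgt f) (tgt g) (tgt h) \<bullet> (f \<boxtimes> (g \<boxtimes> h)) =
    al' (tgt f) (tgt g) (tgt h) \<bullet> ((f \<boxtimes> (g \<boxtimes> h)) \<bullet> al (src f) (src g) (src h)) \<bullet> al' (src f) (src g) (src h)"
    by simp
  also have "\<dots> = ((f \<boxtimes> g) \<boxtimes> h) \<bullet> al' (src f) (src g) (src h)"
    unfolding al_natural[OF assms, symmetric] by (simp add: cmp_sel)
  finally show ?thesis .
qed

lemma arrow_pentagon:
  assumes "W \<in> Ob M" "X \<in> Ob M" "Y \<in> Ob M" "Z \<in> Ob M"
  shows "al W X (Y \<otimes>\<^sub>o Z) \<bullet> al (W \<otimes>\<^sub>o X) Y Z =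
    (ident W \<boxtimes> al X Y Z) \<bullet> al W (X \<otimes>\<^sub>o Y) Z \<bullet> (al W X Y \<boxtimes> ident Z)"
proof (intro arrow_eqI)
  let ?W = "W \<otimes>\<^sub>o X \<otimes>\<^sub>o Y \<otimes>\<^sub>o Z"
  have "(idm M W \<otimes>\<^sub>m assoc M X Y Z) \<cdot> assoc M W (X \<otimes>\<^sub>o Y) Z \<cdot> (assoc M W X Y \<otimes>\<^sub>m idm M Z)
     = (idm M W \<otimes>\<^sub>m assoc M X Y Z) \<cdot> (assoc M W (X \<otimes>\<^sub>o Y) Z \<cdot> (assoc M W X Y \<otimes>\<^sub>m idm M Z))"
    using assms mor_in[of "ident W \<boxtimes> al X Y Z"] mor_in[of "al W (X \<otimes>\<^sub>o Y) Z"] mor_in[of "al W X Y \<boxtimes> ident Z"]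
    by (intro comp_assoc[of ?W "W \<otimes>\<^sub>o (X \<otimes>\<^sub>o Y) \<otimes>\<^sub>o Z" "W \<otimes>\<^sub>o (X \<otimes>\<^sub>o Y \<otimes>\<^sub>o Z)" "W \<otimes>\<^sub>o (X \<otimes>\<^sub>o (Y \<otimes>\<^sub>o Z))"])
      simp_all
  then show "mor (al W X (Y \<otimes>\<^sub>o Z) \<bullet> al (W \<otimes>\<^sub>o X) Y Z) =
    mor ((ident W \<boxtimes> al X Y Z) \<bullet> al W (X \<otimes>\<^sub>o Y) Z \<bullet> (al W X Y \<boxtimes> ident Z))"
    using assms pentagon[OF assms] by (simp add: cmp_sel)
qed (use assms in \<open>auto simp: cmp_sel\<close>)

lemma arrow_triangle:
  assumes "X \<in> Ob M" "Y \<in> Ob M"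
  shows "(ident X \<boxtimes> lu Y) \<bullet> al X \<I> Y = ru X \<boxtimes> ident Y"
  using assms triangle[OF assms] by (intro arrow_eqI) (simp_all add: cmp_sel)

text \<open>Naturality of \<open>lu\<close> conjugates \<open>ident \<I> \<boxtimes> f\<close> into
  \<open>f\<close>, so tensoring with the unit is faithful.\<close>

lemma unit_tensor_cancel:
  assumes "ident \<I> \<boxtimes> f = ident \<I> \<boxtimes> g" "arr f" "arr g" "src f = src g" "tgt f = tgt g"
  shows "f = g"
proof -
  have "(f \<bullet> lu (src f)) \<bullet> lu' (src f) = (g \<bullet> lu (src f)) \<bullet> lu' (src f)"
    using assms lu_natural[of f] lu_natural[of g] by metis
  then show ?thesis using assms arr_Ob[of f] by simp
qed

lemma tensor_unit_cancel:
  assumes "f \<boxtimes> ident \<I> = g \<boxtimes> ident \<I>" "arr f" "arr g" "src f = src g" "tgt f = tgt g"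
  shows "f = g"
proof -
  have "(f \<bullet> ru (src f)) \<bullet> ru' (src f) = (g \<bullet> ru (src f)) \<bullet> ru' (src f)"
    using assms ru_natural[of f] ru_natural[of g] by metis
  then show ?thesis using assms arr_Ob[of f] by simp
qed

text \<open>Kelly's two consequences of the pentagon and the triangle.\<close>

lemma lu_tensor:
  assumes X [simp]: "X \<in> Ob M" and Y [simp]: "Y \<in> Ob M"
  shows "lu (X \<otimes>\<^sub>o Y) \<bullet> al \<I> X Y = lu X \<boxtimes> ident Y"
proof (rule unit_tensor_cancel)
  \<comment> \<open>Composition with \<open>?c\<close> completes one side of a pentagon, after which
    the triangle and naturality apply. Its inverse \<open>?c'\<close> removes it at the end.\<close>
  let ?c = "al \<I> (\<I> \<otimes>\<^sub>o X) Y \<bullet> (al \<I> \<I> X \<boxtimes> ident Y)"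
  let ?c' = "(al' \<I> \<I> X \<boxtimes> ident Y) \<bullet> al' \<I> (\<I> \<otimes>\<^sub>o X) Y"
  have "(ident \<I> \<boxtimes> (lu (X \<otimes>\<^sub>o Y) \<bullet> al \<I> X Y)) \<bullet> ?c
      = (ident \<I> \<boxtimes> lu (X \<otimes>\<^sub>o Y)) \<bullet> ((ident \<I> \<boxtimes> al \<I> X Y) \<bullet> ?c)"
    by (simp add: interchange_tail)
  also have "\<dots> = ((ident \<I> \<boxtimes> lu (X \<otimes>\<^sub>o Y)) \<bullet> al \<I> \<I> (X \<otimes>\<^sub>o Y)) \<bullet> al (\<I> \<otimes>\<^sub>o \<I>) X Y"
    by (simp add: arrow_pentagon)
  also have "\<dots> = (ru \<I> \<boxtimes> (ident X \<boxtimes> ident Y)) \<bullet> al (\<I> \<otimes>\<^sub>o \<I>) X Y"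
    by (simp add: arrow_triangle)
  also have "\<dots> = al \<I> X Y \<bullet> ((ru \<I> \<boxtimes> ident X) \<boxtimes> ident Y)"
    using al_natural[of "ru \<I>" "ident X" "ident Y"] by simp
  also have "\<dots> = (al \<I> X Y \<bullet> ((ident \<I> \<boxtimes> lu X) \<boxtimes> ident Y)) \<bullet> (al \<I> \<I> X \<boxtimes> ident Y)"
    by (simp add: interchange arrow_triangle)
  also have "\<dots> = (ident \<I> \<boxtimes> (lu X \<boxtimes> ident Y)) \<bullet> ?c"
    using al_natural[of "ident \<I>" "lu X" "ident Y"] by simp
  finally have "((ident \<I> \<boxtimes> (lu (X \<otimes>\<^sub>o Y) \<bullet> al \<I> X Y)) \<bullet> ?c) \<bullet> ?c' = ((ident \<I> \<boxtimes> (lu X \<boxtimes> ident Y)) \<bullet> ?c) \<bullet> ?c'"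
    by simp
  then show "ident \<I> \<boxtimes> (lu (X \<otimes>\<^sub>o Y) \<bullet> al \<I> X Y) = ident \<I> \<boxtimes> (lu X \<boxtimes> ident Y)"
    by (simp add: interchange_tail cmp_sel)
qed (simp_all add: cmp_sel)

lemma ru_tensor:
  assumes X [simp]: "X \<in> Ob M" and Y [simp]: "Y \<in> Ob M"
  shows "(ident X \<boxtimes> ru Y) \<bullet> al X Y \<I> = ru (X \<otimes>\<^sub>o Y)"
proof (rule tensor_unit_cancel)
  have "al X Y \<I> \<bullet> (((ident X \<boxtimes> ru Y) \<bullet> al X Y \<I>) \<boxtimes> ident \<I>)
     = (al X Y \<I> \<bullet> ((ident X \<boxtimes> ru Y) \<boxtimes> ident \<I>)) \<bullet> (al X Y \<I> \<boxtimes> ident \<I>)"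
    by (simp add: interchange)
  also have "\<dots> = (ident X \<boxtimes> (ru Y \<boxtimes> ident \<I>)) \<bullet> al X (Y \<otimes>\<^sub>o \<I>) \<I> \<bullet> (al X Y \<I> \<boxtimes> ident \<I>)"
    using al_natural[of "ident X" "ru Y" "ident \<I>"] by simp
  also have "\<dots> = (ident X \<boxtimes> (ident Y \<boxtimes> lu \<I>)) \<bullet> (ident X \<boxtimes> al Y \<I> \<I>) \<bullet> al X (Y \<otimes>\<^sub>o \<I>) \<I> \<bullet> (al X Y \<I> \<boxtimes> ident \<I>)"
    by (simp add: interchange_tail arrow_triangle del: ident_tensor)
  also have "\<dots> = ((ident X \<boxtimes> (ident Y \<boxtimes> lu \<I>)) \<bullet> al X Y (\<I> \<otimes>\<^sub>o \<I>)) \<bullet> al (X \<otimes>\<^sub>o Y) \<I> \<I>"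
    by (simp add: arrow_pentagon del: ident_tensor)
  also have "\<dots> = al X Y \<I> \<bullet> (ident (X \<otimes>\<^sub>o Y) \<boxtimes> lu \<I>) \<bullet> al (X \<otimes>\<^sub>o Y) \<I> \<I>"
    using cmp_tail[OF al_natural[of "ident X" "ident Y" "lu \<I>"]] by simp
  also have "\<dots> = al X Y \<I> \<bullet> (ru (X \<otimes>\<^sub>o Y) \<boxtimes> ident \<I>)"
    by (simp add: arrow_triangle)
  finally have "al' X Y \<I> \<bullet> al X Y \<I> \<bullet> (((ident X \<boxtimes> ru Y) \<bullet> al X Y \<I>) \<boxtimes> ident \<I>)
     = al' X Y \<I> \<bullet> al X Y \<I> \<bullet> (ru (X \<otimes>\<^sub>o Y) \<boxtimes> ident \<I>)"
    by simp
  then show "((ident X \<boxtimes> ru Y) \<bullet> al X Y \<I>) \<boxtimes> ident \<I> = ru (X \<otimes>\<^sub>o Y) \<boxtimes> ident \<I>"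
    by (simp add: cmp_sel)
qed (simp_all add: cmp_sel)

text \<open>Coassociativity in its four guises (of a coalgebra, of its left and right coactions, and of
  the compatibility of the two) after composition with an arbitrary arrow on each tensor factor.\<close>

lemma convolution_assoc:
  assumes "al X Y Z \<bullet> (p \<boxtimes> ident Z) \<bullet> q = (ident X \<boxtimes> p') \<bullet> q'"
    and "arr a" "src a = X" "arr b" "src b = Y" "arr c" "src c = Z"
    and "arr p" "tgt p = X \<otimes>\<^sub>o Y" "arr p'" "tgt p' = Y \<otimes>\<^sub>o Z"
  shows "al (tgt a) (tgt b) (tgt c) \<bullet> (((a \<boxtimes> b) \<bullet> p) \<boxtimes> c) \<bullet> q = (a \<boxtimes> ((b \<boxtimes> c) \<bullet> p')) \<bullet> q'"
proof -
  have [simp]: "X \<in> Ob M" "Y \<in> Ob M" "Z \<in> Ob M"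
    using assms arr_Ob by blast+
  have "al (tgt a) (tgt b) (tgt c) \<bullet> (((a \<boxtimes> b) \<bullet> p) \<boxtimes> c) \<bullet> q =
     (al (tgt a) (tgt b) (tgt c) \<bullet> ((a \<boxtimes> b) \<boxtimes> c)) \<bullet> (p \<boxtimes> ident Z) \<bullet> q"
    using assms by (simp add: interchange_tail)
  also have "\<dots> = (a \<boxtimes> (b \<boxtimes> c)) \<bullet> al X Y Z \<bullet> (p \<boxtimes> ident Z) \<bullet> q"
    using assms al_natural[of a b c] by simp
  also have "\<dots> = (a \<boxtimes> ((b \<boxtimes> c) \<bullet> p')) \<bullet> q'"
    unfolding assms(1) using assms(2-) by (simp add: interchange_tail)
  finally show ?thesis .
qed

end

context abelian_monoidal_category
begin

notation cmp (infixr "\<bullet>" 75) and add_arrow (infixl "\<^bold>+" 65) and neg ("\<^bold>- _" [81] 80)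

lemma tensor_add_left:
  assumes "arr a" "arr b" "src a = src b" "tgt a = tgt b" "arr c"
  shows "(a \<^bold>+ b) \<boxtimes> c = a \<boxtimes> c \<^bold>+ b \<boxtimes> c"
proof (intro arrow_eqI)
  have "(mor a \<boxplus> mor b) \<otimes>\<^sub>m mor c = mor a \<otimes>\<^sub>m mor c \<boxplus> mor b \<otimes>\<^sub>m mor c"
    using assms mor_in[of a] mor_in[of b] mor_in[of c] arr_Ob[of a] arr_Ob[of c]
    by (intro tens_add_left[of "src b" "tgt b" "src c" "tgt c"]) auto
  then show "mor ((a \<^bold>+ b) \<boxtimes> c) = mor (a \<boxtimes> c \<^bold>+ b \<boxtimes> c)"
    using assms by (simp add: add_sel)
qed (use assms in \<open>auto simp: add_sel\<close>)

lemma tensor_add_right: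
  assumes "arr a" "arr b" "src a = src b" "tgt a = tgt b" "arr c"
  shows "c \<boxtimes> (a \<^bold>+ b) = c \<boxtimes> a \<^bold>+ c \<boxtimes> b"
proof (intro arrow_eqI)
  have "mor c \<otimes>\<^sub>m (mor a \<boxplus> mor b) = mor c \<otimes>\<^sub>m mor a \<boxplus> mor c \<otimes>\<^sub>m mor b"
    using assms mor_in[of a] mor_in[of b] mor_in[of c] arr_Ob[of a] arr_Ob[of c]
    by (intro tens_add_right[of "src c" "tgt c" "src b" "tgt b"]) auto
  then show "mor (c \<boxtimes> (a \<^bold>+ b)) = mor (c \<boxtimes> a \<^bold>+ c \<boxtimes> b)"
    using assms by (simp add: add_sel)
qed (use assms in \<open>auto simp: add_sel\<close>)

lemma zero_tensor [simp]:
  assumes "arr a" "X \<in> Ob M" "Y \<in> Ob M"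
  shows "zero_arrow X Y \<boxtimes> a = zero_arrow (X \<otimes>\<^sub>o src a) (Y \<otimes>\<^sub>o tgt a)"
  using assms zero_unique[of "zero_arrow X Y \<boxtimes> a"] tensor_add_left[of "zero_arrow X Y" "zero_arrow X Y" a]
  by simp

lemma tensor_zero [simp]:
  assumes "arr a" "X \<in> Ob M" "Y \<in> Ob M"
  shows "a \<boxtimes> zero_arrow X Y = zero_arrow (src a \<otimes>\<^sub>o X) (tgt a \<otimes>\<^sub>o Y)"
  using assms zero_unique[of "a \<boxtimes> zero_arrow X Y"] tensor_add_right[of "zero_arrow X Y" "zero_arrow X Y" a]
  by simp

lemma neg_tensor:
  assumes "arr a" "arr b" shows "(\<^bold>- a) \<boxtimes> b = \<^bold>- (a \<boxtimes> b)"
  using assms arr_Ob[of a] arr_Ob[of b] tensor_add_left[of a "\<^bold>- a" b]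
  by (intro neg_unique[of _ _ "src a \<otimes>\<^sub>o src b" "tgt a \<otimes>\<^sub>o tgt b"]) (simp_all add: add_neg)

lemma tensor_neg:
  assumes "arr a" "arr b" shows "a \<boxtimes> (\<^bold>- b) = \<^bold>- (a \<boxtimes> b)"
  using assms arr_Ob[of a] arr_Ob[of b] tensor_add_right[of b "\<^bold>- b" a]
  by (intro neg_unique[of _ _ "src a \<otimes>\<^sub>o src b" "tgt a \<otimes>\<^sub>o tgt b"]) (simp_all add: add_neg)

end

section \<open>Coalgebras and bicomodules in terms of arrows\<close>

context monoidal_category
begin

definition comul where "comul D = arrow_of (cobj D) (comult D) (cobj D \<otimes>\<^sub>o cobj D)"
definition coun where "coun D = arrow_of (cobj D) (counit D) \<I>"

lemma comul_typing:
  assumes "cobj D \<in> Ob M" "comult D \<in> Mor M (cobj D) (cobj D \<otimes>\<^sub>o cobj D)"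
  shows "arr (comul D)" "src (comul D) = cobj D" "tgt (comul D) = cobj D \<otimes>\<^sub>o cobj D" "mor (comul D) = comult D"
  using assms by (simp_all add: comul_def arr_arrow_of arrow_of_sel)

lemma coun_typing:
  assumes "cobj D \<in> Ob M" "counit D \<in> Mor M (cobj D) \<I>"
  shows "arr (coun D)" "src (coun D) = cobj D" "tgt (coun D) = \<I>" "mor (coun D) = counit D"
  using assms by (simp_all add: coun_def arr_arrow_of arrow_of_sel)

lemma coalgebra_iff:
  "coalgebra M D \<longleftrightarrow> cobj D \<in> Ob M \<and> comult D \<in> Mor M (cobj D) (cobj D \<otimes>\<^sub>o cobj D) \<and> counit D \<in> Mor M (cobj D) \<I> \<and>
     al (cobj D) (cobj D) (cobj D) \<bullet> (comul D \<boxtimes> ident (cobj D)) \<bullet> comul D = (ident (cobj D) \<boxtimes> comul D) \<bullet> comul D \<and>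
     lu (cobj D) \<bullet> (coun D \<boxtimes> ident (cobj D)) \<bullet> comul D = ident (cobj D) \<and>
     ru (cobj D) \<bullet> (ident (cobj D) \<boxtimes> coun D) \<bullet> comul D = ident (cobj D)" (is "_ \<longleftrightarrow> ?t1 \<and> ?t2 \<and> ?t3 \<and> ?r")
proof (cases "?t1 \<and> ?t2 \<and> ?t3")
  case True
  then have t: "?t1" "?t2" "?t3" by auto
  show ?thesis
    using t by (simp add: coalgebra_def Let_def arrow_eq_iff comul_typing[OF t(1,2)] coun_typing[OF t(1,3)] cmp_sel)
next
  case False
  then show ?thesis by (auto simp: coalgebra_def Let_def)
qed

lemma coalgebra_hom_iff:
  assumes "coalgebra M D" "coalgebra M E"
  shows "f \<in> coalgebra_hom M D E \<longleftrightarrow> f \<in> Mor M (cobj D) (cobj E) \<and>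
    (arrow_of (cobj D) f (cobj E) \<boxtimes> arrow_of (cobj D) f (cobj E)) \<bullet> comul D = comul E \<bullet> arrow_of (cobj D) f (cobj E) \<and>
    coun E \<bullet> arrow_of (cobj D) f (cobj E) = coun D"
proof (cases "f \<in> Mor M (cobj D) (cobj E)")
  case True
  have t: "cobj D \<in> Ob M" "comult D \<in> Mor M (cobj D) (cobj D \<otimes>\<^sub>o cobj D)" "counit D \<in> Mor M (cobj D) \<I>"
    "cobj E \<in> Ob M" "comult E \<in> Mor M (cobj E) (cobj E \<otimes>\<^sub>o cobj E)" "counit E \<in> Mor M (cobj E) \<I>"
    using assms by (auto simp: coalgebra_iff)
  show ?thesis
    using True t by (simp add: coalgebra_hom_def arrow_eq_iff comul_typing[OF t(1,2)] coun_typing[OF t(1,3)]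
      comul_typing[OF t(4,5)] coun_typing[OF t(4,6)] cmp_sel arr_arrow_of arrow_of_sel)
qed (auto simp: coalgebra_hom_def)

end

section \<open>Comodules and bicomodules over a fixed coalgebra\<close>

locale coalgebra_in = abelian_monoidal_category M for M (structure) + fixes C
  assumes coalgebra: "coalgebra M C"
begin

notation cmp (infixr "\<bullet>" 75) and add_arrow (infixl "\<^bold>+" 65) and neg ("\<^bold>- _" [81] 80)
  and tensor (infixl "\<boxtimes>" 80)

abbreviation carrier_obj ("\<C>") where "\<C> \<equiv> cobj C"
abbreviation comult_arrow ("\<Delta>") where "\<Delta> \<equiv> comul C"
abbreviation counit_arrow ("\<epsilon>") where "\<epsilon> \<equiv> coun C"

lemma coalg [simp]:
  "\<C> \<in> Ob M" "arr \<Delta>" "src \<Delta> = \<C>" "tgt \<Delta> = \<C> \<otimes>\<^sub>o \<C>" "arr \<epsilon>" "src \<epsilon> = \<C>" "tgt \<epsilon> = \<I>"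
  "mor \<Delta> = comult C" "mor \<epsilon> = counit C"
  and coassoc: "al \<C> \<C> \<C> \<bullet> (\<Delta> \<boxtimes> ident \<C>) \<bullet> \<Delta> = (ident \<C> \<boxtimes> \<Delta>) \<bullet> \<Delta>"
  and counit_left: "lu \<C> \<bullet> (\<epsilon> \<boxtimes> ident \<C>) \<bullet> \<Delta> = ident \<C>"
  and counit_right: "ru \<C> \<bullet> (ident \<C> \<boxtimes> \<epsilon>) \<bullet> \<Delta> = ident \<C>"
  using coalgebra comul_typing[of C] coun_typing[of C] by (auto simp: coalgebra_iff)

text \<open>The underlying object is read off as the source of the coaction, so a bicomodule can be
  handled as a bare pair of arrows.\<close>

definition left_coaction where
  "left_coaction l \<longleftrightarrow> arr l \<and> tgt l = \<C> \<otimes>\<^sub>o src l \<and>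
     al \<C> \<C> (src l) \<bullet> (\<Delta> \<boxtimes> ident (src l)) \<bullet> l = (ident \<C> \<boxtimes> l) \<bullet> l \<and>
     lu (src l) \<bullet> (\<epsilon> \<boxtimes> ident (src l)) \<bullet> l = ident (src l)"

definition right_coaction where
  "right_coaction r \<longleftrightarrow> arr r \<and> tgt r = src r \<otimes>\<^sub>o \<C> \<and>
     al (src r) \<C> \<C> \<bullet> (r \<boxtimes> ident \<C>) \<bullet> r = (ident (src r) \<boxtimes> \<Delta>) \<bullet> r \<and>
     ru (src r) \<bullet> (ident (src r) \<boxtimes> \<epsilon>) \<bullet> r = ident (src r)"

definition bicoaction where
  "bicoaction l r \<longleftrightarrow> left_coaction l \<and> right_coaction r \<and> src r = src l \<and>
     al \<C> (src l) \<C> \<bullet> (l \<boxtimes> ident \<C>) \<bullet> r = (ident \<C> \<boxtimes> r) \<bullet> l"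

definition left_colinear where
  "left_colinear f l l' \<longleftrightarrow> arr f \<and> src f = src l \<and> tgt f = src l' \<and> (ident \<C> \<boxtimes> f) \<bullet> l = l' \<bullet> f"

definition right_colinear where
  "right_colinear f r r' \<longleftrightarrow> arr f \<and> src f = src r \<and> tgt f = src r' \<and> (f \<boxtimes> ident \<C>) \<bullet> r = r' \<bullet> f"

definition lact where "lact V = arrow_of (bobj V) (lcoact V) (\<C> \<otimes>\<^sub>o bobj V)"
definition ract where "ract V = arrow_of (bobj V) (rcoact V) (bobj V \<otimes>\<^sub>o \<C>)"
definition bicomod_of where "bicomod_of l r = \<lparr>bobj = src l, lcoact = mor l, rcoact = mor r\<rparr>"

abbreviation bicom where "bicom \<equiv> bicomodule_cat M C"

lemma lact_typing:
  assumes "bobj V \<in> Ob M" "lcoact V \<in> Mor M (bobj V) (\<C> \<otimes>\<^sub>o bobj V)"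
  shows "arr (lact V)" "src (lact V) = bobj V" "tgt (lact V) = \<C> \<otimes>\<^sub>o bobj V" "mor (lact V) = lcoact V"
  using assms by (simp_all add: lact_def arr_arrow_of arrow_of_sel)

lemma ract_typing:
  assumes "bobj V \<in> Ob M" "rcoact V \<in> Mor M (bobj V) (bobj V \<otimes>\<^sub>o \<C>)"
  shows "arr (ract V)" "src (ract V) = bobj V" "tgt (ract V) = bobj V \<otimes>\<^sub>o \<C>" "mor (ract V) = rcoact V"
  using assms by (simp_all add: ract_def arr_arrow_of arrow_of_sel)

lemma bicomodule_iff:
  "bicomodule M C V \<longleftrightarrow> bobj V \<in> Ob M \<and> lcoact V \<in> Mor M (bobj V) (\<C> \<otimes>\<^sub>o bobj V) \<and>
     rcoact V \<in> Mor M (bobj V) (bobj V \<otimes>\<^sub>o \<C>) \<and> bicoaction (lact V) (ract V)" (is "_ \<longleftrightarrow> ?t1 \<and> ?t2 \<and> ?t3 \<and> ?r")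
proof (cases "?t1 \<and> ?t2 \<and> ?t3")
  case True
  then have t: "?t1" "?t2" "?t3" by auto
  show ?thesis
    using t by (auto simp add: bicomodule_def bicoaction_def left_coaction_def right_coaction_def Let_def
      arrow_eq_iff lact_typing[OF t(1,2)] ract_typing[OF t(1,3)] cmp_sel)
next
  case False
  then show ?thesis by (auto simp: bicomodule_def Let_def)
qed

lemma Ob_bicom [simp]: "V \<in> Ob bicom \<longleftrightarrow> bicomodule M C V"
  by (simp add: bicomodule_cat_def)

lemma bicom_simps [simp]: "comp bicom = comp M" "add_mor bicom = add_mor M" "idm bicom V = idm M (bobj V)"
  "zero_mor bicom V W = zero_mor M (bobj V) (bobj W)"
  by (simp_all add: bicomodule_cat_def)

lemma bicomodule_act [simp]:
  assumes "bicomodule M C V"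
  shows "bobj V \<in> Ob M" "arr (lact V)" "src (lact V) = bobj V" "tgt (lact V) = \<C> \<otimes>\<^sub>o bobj V" "mor (lact V) = lcoact V"
    "arr (ract V)" "src (ract V) = bobj V" "tgt (ract V) = bobj V \<otimes>\<^sub>o \<C>" "mor (ract V) = rcoact V"
    "bicoaction (lact V) (ract V)"
  using assms lact_typing[of V] ract_typing[of V] by (auto simp: bicomodule_iff)

lemma Mor_bicom_iff:
  assumes "bicomodule M C V" "bicomodule M C W"
  shows "f \<in> Mor bicom V W \<longleftrightarrow> f \<in> Mor M (bobj V) (bobj W) \<and>
    left_colinear (arrow_of (bobj V) f (bobj W)) (lact V) (lact W) \<and>
    right_colinear (arrow_of (bobj V) f (bobj W)) (ract V) (ract W)"
proof (cases "f \<in> Mor M (bobj V) (bobj W)")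
  case True
  then show ?thesis
    using assms by (simp add: bicomodule_cat_def left_colinear_def right_colinear_def arrow_eq_iff arr_arrow_of arrow_of_sel cmp_sel)
qed (simp add: bicomodule_cat_def)

lemma mor_in_bicom:
  assumes "bicomodule M C V" "bicomodule M C W" "left_colinear f (lact V) (lact W)" "right_colinear f (ract V) (ract W)"
  shows "mor f \<in> Mor bicom V W"
proof -
  have f: "arr f" "src f = bobj V" "tgt f = bobj W"
    using assms by (auto simp: left_colinear_def)
  then have "arrow_of (bobj V) (mor f) (bobj W) = f"
    using arrow_of_collapse by metis
  then show ?thesis
    using assms f mor_in[of f] by (simp add: Mor_bicom_iff)
qed

lemma bicomod_of:
  assumes "bicoaction l r"
  shows "bicomodule M C (bicomod_of l r)" "lact (bicomod_of l r) = l" "ract (bicomod_of l r) = r" "bobj (bicomod_of l r) = src l"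
proof -
  have a: "arr l" "arr r" "tgt l = \<C> \<otimes>\<^sub>o src l" "tgt r = src l \<otimes>\<^sub>o \<C>" "src r = src l"
    using assms by (auto simp: bicoaction_def left_coaction_def right_coaction_def)
  then show "lact (bicomod_of l r) = l" "ract (bicomod_of l r) = r" "bobj (bicomod_of l r) = src l"
    using arrow_of_collapse[of l] arrow_of_collapse[of r] by (simp_all add: lact_def ract_def bicomod_of_def)
  then show "bicomodule M C (bicomod_of l r)"
    using assms a mor_in[of l] mor_in[of r] arr_Ob[of l] by (simp add: bicomodule_iff) (simp add: bicomod_of_def)
qed

lemma left_coactionD:
  assumes "left_coaction l"
  shows "arr l" "tgt l = \<C> \<otimes>\<^sub>o src l" "src l \<in> Ob M"
    "al \<C> \<C> (src l) \<bullet> (\<Delta> \<boxtimes> ident (src l)) \<bullet> l = (ident \<C> \<boxtimes> l) \<bullet> l"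
    "lu (src l) \<bullet> (\<epsilon> \<boxtimes> ident (src l)) \<bullet> l = ident (src l)"
  using assms arr_Ob[of l] by (auto simp: left_coaction_def)

lemma right_coactionD:
  assumes "right_coaction r"
  shows "arr r" "tgt r = src r \<otimes>\<^sub>o \<C>" "src r \<in> Ob M"
    "al (src r) \<C> \<C> \<bullet> (r \<boxtimes> ident \<C>) \<bullet> r = (ident (src r) \<boxtimes> \<Delta>) \<bullet> r"
    "ru (src r) \<bullet> (ident (src r) \<boxtimes> \<epsilon>) \<bullet> r = ident (src r)"
  using assms arr_Ob[of r] by (auto simp: right_coaction_def)

lemma bicoactionD:
  assumes "bicoaction l r"
  shows "left_coaction l" "right_coaction r" "src r = src l"
    "al \<C> (src l) \<C> \<bullet> (l \<boxtimes> ident \<C>) \<bullet> r = (ident \<C> \<boxtimes> r) \<bullet> l"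
  using assms by (auto simp: bicoaction_def)

lemma left_colinear_cmp:
  assumes "left_colinear f l l'" "left_colinear g l' l''"
  shows "left_colinear (g \<bullet> f) l l''"
proof -
  have t: "arr f" "arr g" "tgt f = src g"
    using assms by (simp_all add: left_colinear_def)
  have "(ident \<C> \<boxtimes> (g \<bullet> f)) \<bullet> l = (ident \<C> \<boxtimes> g) \<bullet> (ident \<C> \<boxtimes> f) \<bullet> l"
    using t by (simp add: interchange_tail)
  also have "\<dots> = ((ident \<C> \<boxtimes> g) \<bullet> l') \<bullet> f"
    using assms(1) by (simp add: left_colinear_def)
  also have "\<dots> = l'' \<bullet> g \<bullet> f"
    using assms(2) by (simp add: left_colinear_def)
  finally show ?thesis using assms by (simp add: left_colinear_def cmp_sel)
qed

lemma right_colinear_cmp: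
  assumes "right_colinear f r r'" "right_colinear g r' r''"
  shows "right_colinear (g \<bullet> f) r r''"
proof -
  have t: "arr f" "arr g" "tgt f = src g"
    using assms by (simp_all add: right_colinear_def)
  have "((g \<bullet> f) \<boxtimes> ident \<C>) \<bullet> r = (g \<boxtimes> ident \<C>) \<bullet> (f \<boxtimes> ident \<C>) \<bullet> r"
    using t by (simp add: interchange_tail)
  also have "\<dots> = ((g \<boxtimes> ident \<C>) \<bullet> r') \<bullet> f"
    using assms(1) by (simp add: right_colinear_def)
  also have "\<dots> = r'' \<bullet> g \<bullet> f"
    using assms(2) by (simp add: right_colinear_def)
  finally show ?thesis using assms by (simp add: right_colinear_def cmp_sel)
qed

lemma ident_colinear:
  "left_coaction l \<Longrightarrow> left_colinear (ident (src l)) l l"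
  "right_coaction r \<Longrightarrow> right_colinear (ident (src r)) r r"
  by (simp_all add: left_colinear_def right_colinear_def left_coactionD right_coactionD)

lemma zero_colinear:
  "left_coaction l \<Longrightarrow> left_coaction l' \<Longrightarrow> left_colinear (zero_arrow (src l) (src l')) l l'"
  "right_coaction r \<Longrightarrow> right_coaction r' \<Longrightarrow> right_colinear (zero_arrow (src r) (src r')) r r'"
  by (simp_all add: left_colinear_def right_colinear_def left_coactionD right_coactionD)

lemma add_colinear:
  "left_coaction l \<Longrightarrow> left_coaction l' \<Longrightarrow> left_colinear f l l' \<Longrightarrow> left_colinear g l l' \<Longrightarrow> left_colinear (f \<^bold>+ g) l l'"
  "right_coaction r \<Longrightarrow> right_coaction r' \<Longrightarrow> right_colinear f r r' \<Longrightarrow> right_colinear g r r' \<Longrightarrow> right_colinear (f \<^bold>+ g) r r'"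
  by (simp_all add: left_colinear_def right_colinear_def add_sel tensor_add_left tensor_add_right cmp_add_left cmp_add_right)

lemma neg_colinear:
  "left_coaction l \<Longrightarrow> left_coaction l' \<Longrightarrow> left_colinear f l l' \<Longrightarrow> left_colinear (\<^bold>- f) l l'"
  "right_coaction r \<Longrightarrow> right_coaction r' \<Longrightarrow> right_colinear f r r' \<Longrightarrow> right_colinear (\<^bold>- f) r r'"
  by (simp_all add: left_colinear_def right_colinear_def tensor_neg neg_tensor neg_cmp cmp_neg)

lemma Mor_bicomD: "f \<in> Mor bicom V W \<Longrightarrow> f \<in> Mor M (bobj V) (bobj W)"
  by (simp add: bicomodule_cat_def)

text \<open>Additivity of the tensor product in each variable makes bicolinear arrows closed under
  sums and negatives. Each hom set is therefore a subgroup of a hom group of \<open>M\<close>, and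
  the other axioms are inherited.\<close>

lemma preadditive_bicom: "preadditive_category bicom"
proof (intro preadditive_category.intro category.intro preadditive_category_axioms.intro)
  fix V assume "V \<in> Ob bicom"
  then have V: "bicomodule M C V" by simp
  have "mor (ident (bobj V)) \<in> Mor bicom V V"
    using V ident_colinear(1)[of "lact V"] ident_colinear(2)[of "ract V"] bicoactionD[OF bicomodule_act(10)[OF V]]
    by (intro mor_in_bicom) auto
  then show "idm bicom V \<in> Mor bicom V V" using V by simp
next
  fix U V W f g assume "U \<in> Ob bicom" "V \<in> Ob bicom" "W \<in> Ob bicom" and fg: "f \<in> Mor bicom U V" "g \<in> Mor bicom V W"
  then have b: "bicomodule M C U" "bicomodule M C V" "bicomodule M C W" by auto
  let ?f = "arrow_of (bobj U) f (bobj V)" and ?g = "arrow_of (bobj V) g (bobj W)"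
  have t: "f \<in> Mor M (bobj U) (bobj V)" "g \<in> Mor M (bobj V) (bobj W)"
    using fg by (auto dest: Mor_bicomD)
  have "mor (?g \<bullet> ?f) \<in> Mor bicom U W"
    using fg b by (intro mor_in_bicom left_colinear_cmp[of _ _ "lact V"] right_colinear_cmp[of _ _ "ract V"]) (auto simp: Mor_bicom_iff)
  then show "comp bicom g f \<in> Mor bicom U W"
    using b t by (simp add: cmp_sel arr_arrow_of arrow_of_sel)
next
  fix V W assume "V \<in> Ob bicom" "W \<in> Ob bicom"
  then have b: "bicomodule M C V" "bicomodule M C W" by auto
  note bb = bicoactionD[OF bicomodule_act(10)[OF b(1)]] bicoactionD[OF bicomodule_act(10)[OF b(2)]]
  interpret H: comm_group "hom_group M (bobj V) (bobj W)"
    using b by (intro hom_comm_group) auto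
  have S: "subgroup (Mor bicom V W) (hom_group M (bobj V) (bobj W))"
  proof (rule H.subgroupI)
    show "Mor bicom V W \<subseteq> carrier (hom_group M (bobj V) (bobj W))"
      by (auto simp: hom_group_simps dest: Mor_bicomD)
    have "mor (zero_arrow (bobj V) (bobj W)) \<in> Mor bicom V W"
      using b bb zero_colinear(1)[of "lact V" "lact W"] zero_colinear(2)[of "ract V" "ract W"] by (intro mor_in_bicom) auto
    then show "Mor bicom V W \<noteq> {}" by auto
    fix f assume f: "f \<in> Mor bicom V W"
    define F where "F = arrow_of (bobj V) f (bobj W)"
    have F: "arr F" "src F = bobj V" "tgt F = bobj W" "mor F = f" "left_colinear F (lact V) (lact W)" "right_colinear F (ract V) (ract W)"
      using f b by (simp_all add: F_def Mor_bicom_iff arr_arrow_of arrow_of_sel)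
    have "mor (\<^bold>- F) \<in> Mor bicom V W"
      using b bb F neg_colinear by (intro mor_in_bicom) auto
    then show "inv\<^bsub>hom_group M (bobj V) (bobj W)\<^esub> f \<in> Mor bicom V W"
      using F by (simp add: mor_neg)
    fix g assume g: "g \<in> Mor bicom V W"
    define G where "G = arrow_of (bobj V) g (bobj W)"
    have G: "arr G" "src G = bobj V" "tgt G = bobj W" "mor G = g" "left_colinear G (lact V) (lact W)" "right_colinear G (ract V) (ract W)"
      using g b by (simp_all add: G_def Mor_bicom_iff arr_arrow_of arrow_of_sel)
    have "mor (F \<^bold>+ G) \<in> Mor bicom V W"
      using b bb F G add_colinear by (intro mor_in_bicom) auto
    then show "f \<otimes>\<^bsub>hom_group M (bobj V) (bobj W)\<^esub> g \<in> Mor bicom V W"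
      using F G by (simp add: add_sel hom_group_simps)
  qed
  have "hom_group bicom V W = (hom_group M (bobj V) (bobj W))\<lparr>carrier := Mor bicom V W\<rparr>"
    by (simp add: hom_group_def)
  moreover have "comm_group ((hom_group M (bobj V) (bobj W))\<lparr>carrier := Mor bicom V W\<rparr>)"
    by (intro comm_group.intro comm_monoid.intro Group.comm_monoid_axioms.intro group.is_monoid H.subgroup_imp_group[OF S])
      (use subgroup.subset[OF S] H.m_comm in auto)
  ultimately show "comm_group (hom_group bicom V W)" by simp
qed (simp_all, (blast intro: idm_left idm_right comp_assoc comp_add_left comp_add_right bicomodule_act(1) dest: Mor_bicomD)+)

end

text \<open>The idempotent complementary to \<open>F \<bullet> R\<close> kills \<open>F\<close> and
  so factors through the cokernel \<open>P\<close>; the factor is the section.\<close>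

lemma (in preadditive_category) split_cokernel_section:
  assumes "cokernel_arrow F P" "arr R" "src R = tgt F" "R \<bullet> F = ident (src F)"
  obtains T where "arr T" "src T = tgt P" "tgt T = src P" "P \<bullet> T = ident (tgt P)"
    "T \<bullet> P = ident (src P) \<^bold>+ \<^bold>- (F \<bullet> R)"
proof -
  note c = cokernel_arrowD[OF assms(1)]
  have tR: "tgt R = src F"
    using assms c arr_Ob[of F] by (metis cmp_sel(2) ident_sel(2))
  have ob: "tgt P \<in> Ob B" "tgt F \<in> Ob B" "src F \<in> Ob B" using c arr_Ob by auto
  let ?h = "ident (src P) \<^bold>+ \<^bold>- (F \<bullet> R)"
  have h: "arr ?h" "src ?h = tgt F" "tgt ?h = tgt F"
    using c assms tR ob by (auto simp: cmp_sel add_sel)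
  have "?h \<bullet> F = zero_arrow (src F) (tgt F)"
    using c assms ob by (simp add: cmp_add_left neg_cmp add_neg)
  then obtain T where T: "arr T" "src T = tgt P" "tgt T = tgt F" "T \<bullet> P = ?h"
    using assms(1) h by (elim cokernel_factor[of _ _ ?h]) auto
  have "P \<bullet> F \<bullet> R = zero_arrow (tgt F) (tgt P)"
    using cmp_tail[OF c(5), of R] assms tR ob by simp
  then have "(P \<bullet> T) \<bullet> P = ident (tgt P) \<bullet> P"
    using T c ob by (simp add: cmp_add_right cmp_neg)
  then have "P \<bullet> T = ident (tgt P)"
    using T(1-3) c ob by - (rule epi_arrowD[OF c(2)], auto simp: cmp_sel)
  then show ?thesis using that T c by simp
qed

context monoidal_category
begin

lemma al_eq_iff:
  assumes "arr a" "X \<in> Ob M" "Y \<in> Ob M" "Z \<in> Ob M" "tgt a = (X \<otimes>\<^sub>o Y) \<otimes>\<^sub>o Z"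
  shows "al X Y Z \<bullet> a = b \<longleftrightarrow> arr b \<and> tgt b = X \<otimes>\<^sub>o (Y \<otimes>\<^sub>o Z) \<and> a = al' X Y Z \<bullet> b"
  using assms by (auto simp: cmp_sel)

text \<open>The pentagon with some sides inverted, in the shapes met when
  \<open>tensor_right\<close> is iterated and when it is compared with
  \<open>cofree\<close>.\<close>

lemma al'_pentagon:
  assumes "W \<in> Ob M" "X \<in> Ob M" "Y \<in> Ob M" "Z \<in> Ob M"
  shows "al (W \<otimes>\<^sub>o X) Y Z \<bullet> (al' W X Y \<boxtimes> ident Z) \<bullet> al' W (X \<otimes>\<^sub>o Y) Z \<bullet> (ident W \<boxtimes> al' X Y Z) = al' W X (Y \<otimes>\<^sub>o Z)"
    and "al W (X \<otimes>\<^sub>o Y) Z \<bullet> (al W X Y \<boxtimes> ident Z) \<bullet> al' (W \<otimes>\<^sub>o X) Y Z = (ident W \<boxtimes> al' X Y Z) \<bullet> al W X (Y \<otimes>\<^sub>o Z)"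
proof -
  note [simp] = assms
  let ?q = "(al' W X Y \<boxtimes> ident Z) \<bullet> al' W (X \<otimes>\<^sub>o Y) Z \<bullet> (ident W \<boxtimes> al' X Y Z)"
  have "al W X (Y \<otimes>\<^sub>o Z) \<bullet> al (W \<otimes>\<^sub>o X) Y Z \<bullet> ?q = (al W X (Y \<otimes>\<^sub>o Z) \<bullet> al (W \<otimes>\<^sub>o X) Y Z) \<bullet> ?q"
    by simp
  also have "\<dots> = ident (W \<otimes>\<^sub>o (X \<otimes>\<^sub>o (Y \<otimes>\<^sub>o Z)))"
    unfolding arrow_pentagon[OF assms] by (simp add: interchange interchange_tail cmp_sel)
  finally have "al' W X (Y \<otimes>\<^sub>o Z) \<bullet> al W X (Y \<otimes>\<^sub>o Z) \<bullet> al (W \<otimes>\<^sub>o X) Y Z \<bullet> ?q = al' W X (Y \<otimes>\<^sub>o Z)"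
    by simp
  then show "al (W \<otimes>\<^sub>o X) Y Z \<bullet> ?q = al' W X (Y \<otimes>\<^sub>o Z)"
    by (simp add: cmp_sel)
  have "(ident W \<boxtimes> al' X Y Z) \<bullet> al W X (Y \<otimes>\<^sub>o Z) =
    (ident W \<boxtimes> al' X Y Z) \<bullet> (al W X (Y \<otimes>\<^sub>o Z) \<bullet> al (W \<otimes>\<^sub>o X) Y Z) \<bullet> al' (W \<otimes>\<^sub>o X) Y Z"
    by simp
  also have "\<dots> = al W (X \<otimes>\<^sub>o Y) Z \<bullet> (al W X Y \<boxtimes> ident Z) \<bullet> al' (W \<otimes>\<^sub>o X) Y Z"
    unfolding arrow_pentagon[OF assms] by (simp add: interchange_tail cmp_sel)
  finally show "al W (X \<otimes>\<^sub>o Y) Z \<bullet> (al W X Y \<boxtimes> ident Z) \<bullet> al' (W \<otimes>\<^sub>o X) Y Z =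
    (ident W \<boxtimes> al' X Y Z) \<bullet> al W X (Y \<otimes>\<^sub>o Z)" ..
qed

lemma unit_al':
  assumes "X \<in> Ob M" "Y \<in> Ob M"
  shows "(lu X \<boxtimes> ident Y) \<bullet> al' \<I> X Y = lu (X \<otimes>\<^sub>o Y)"
    and "(ru X \<boxtimes> ident Y) \<bullet> al' X \<I> Y = ident X \<boxtimes> lu Y"
    and "ru (X \<otimes>\<^sub>o Y) \<bullet> al' X Y \<I> = ident X \<boxtimes> ru Y"
  using assms by (simp_all flip: lu_tensor arrow_triangle ru_tensor)

lemma al_natural':
  assumes "arr f" "arr g" "arr h" "tgt f = X" "tgt g = Y" "tgt h = Z"
  shows "al X Y Z \<bullet> ((f \<boxtimes> g) \<boxtimes> h) = (f \<boxtimes> (g \<boxtimes> h)) \<bullet> al (src f) (src g) (src h)"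
    and "al X Y Z \<bullet> ((f \<boxtimes> g) \<boxtimes> h) \<bullet> x = (f \<boxtimes> (g \<boxtimes> h)) \<bullet> al (src f) (src g) (src h) \<bullet> x"
    and "al' X Y Z \<bullet> (f \<boxtimes> (g \<boxtimes> h)) = ((f \<boxtimes> g) \<boxtimes> h) \<bullet> al' (src f) (src g) (src h)"
    and "al' X Y Z \<bullet> (f \<boxtimes> (g \<boxtimes> h)) \<bullet> x = ((f \<boxtimes> g) \<boxtimes> h) \<bullet> al' (src f) (src g) (src h) \<bullet> x"
  using al_natural[OF assms(1-3)] al'_natural[OF assms(1-3)] cmp_tail[OF al_natural[OF assms(1-3)], of x]
    cmp_tail[OF al'_natural[OF assms(1-3)], of x] assms by simp_all

end

section \<open>Quotient bicomodules and cofree bicomodules\<close>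

context coalgebra_in
begin

text \<open>The axioms equate arrows out of \<open>src l'\<close>, so they can be tested on the
  epimorphism \<open>P\<close>, where colinearity replaces \<open>l'\<close> by \<open>l\<close>.
  What is cancelled is \<open>P\<close> itself and no tensor multiple of it.\<close>

lemma left_coaction_quotient:
  assumes l: "left_coaction l" and P: "epi_arrow P" and c: "left_colinear P l l'" and l': "arr l'" "tgt l' = \<C> \<otimes>\<^sub>o src l'"
  shows "left_coaction l'"
proof -
  let ?L = "src l'"
  note ll = left_coactionD[OF l]
  have [simp]: "arr P" "src P = src l" "tgt P = ?L" and cP: "l' \<bullet> P = (ident \<C> \<boxtimes> P) \<bullet> l"
    using c by (simp_all add: left_colinear_def)
  note [simp] = ll(1-3) l'
  have [simp]: "?L \<in> Ob M" using arr_Ob[of l'] by simp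
  have "(al \<C> \<C> ?L \<bullet> (\<Delta> \<boxtimes> ident ?L) \<bullet> l') \<bullet> P = al \<C> \<C> ?L \<bullet> (\<Delta> \<boxtimes> P) \<bullet> l"
    by (simp add: cP interchange_tail)
  also have "\<dots> = al \<C> \<C> ?L \<bullet> ((ident \<C> \<boxtimes> ident \<C>) \<boxtimes> P) \<bullet> (\<Delta> \<boxtimes> ident (src l)) \<bullet> l"
    by (simp add: interchange_tail)
  also have "\<dots> = (ident \<C> \<boxtimes> (ident \<C> \<boxtimes> P)) \<bullet> al \<C> \<C> (src l) \<bullet> (\<Delta> \<boxtimes> ident (src l)) \<bullet> l"
    by (subst al_natural') simp_all
  also have "\<dots> = (ident \<C> \<boxtimes> ((ident \<C> \<boxtimes> P) \<bullet> l)) \<bullet> l"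
    unfolding ll(4) by (simp add: interchange_tail)
  also have "\<dots> = ((ident \<C> \<boxtimes> l') \<bullet> l') \<bullet> P"
    by (simp add: cP interchange_tail)
  finally have 1: "al \<C> \<C> ?L \<bullet> (\<Delta> \<boxtimes> ident ?L) \<bullet> l' = (ident \<C> \<boxtimes> l') \<bullet> l'"
    by - (rule epi_arrowD[OF P], auto simp: cmp_sel)
  have "(lu ?L \<bullet> (\<epsilon> \<boxtimes> ident ?L) \<bullet> l') \<bullet> P = lu ?L \<bullet> (ident \<I> \<boxtimes> P) \<bullet> (\<epsilon> \<boxtimes> ident (src l)) \<bullet> l"
    by (simp add: cP interchange_tail)
  also have "\<dots> = P \<bullet> lu (src l) \<bullet> (\<epsilon> \<boxtimes> ident (src l)) \<bullet> l"
    using cmp_tail[OF lu_natural[of P]] by simp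
  also have "\<dots> = ident ?L \<bullet> P"
    unfolding ll(5) by simp
  finally have "lu ?L \<bullet> (\<epsilon> \<boxtimes> ident ?L) \<bullet> l' = ident ?L"
    by - (rule epi_arrowD[OF P], auto simp: cmp_sel)
  with 1 show ?thesis by (simp add: left_coaction_def)
qed

lemma right_coaction_quotient:
  assumes r: "right_coaction r" and P: "epi_arrow P" and c: "right_colinear P r r'" and r': "arr r'" "tgt r' = src r' \<otimes>\<^sub>o \<C>"
  shows "right_coaction r'"
proof -
  let ?L = "src r'"
  note rr = right_coactionD[OF r]
  have [simp]: "arr P" "src P = src r" "tgt P = ?L" and cP: "r' \<bullet> P = (P \<boxtimes> ident \<C>) \<bullet> r"
    using c by (simp_all add: right_colinear_def)
  note [simp] = rr(1-3) r'
  have [simp]: "?L \<in> Ob M" using arr_Ob[of r'] by simp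
  have "(al ?L \<C> \<C> \<bullet> (r' \<boxtimes> ident \<C>) \<bullet> r') \<bullet> P = al ?L \<C> \<C> \<bullet> ((P \<boxtimes> ident \<C>) \<boxtimes> ident \<C>) \<bullet> (r \<boxtimes> ident \<C>) \<bullet> r"
    by (simp add: cP interchange_tail)
  also have "\<dots> = (P \<boxtimes> (ident \<C> \<boxtimes> ident \<C>)) \<bullet> al (src r) \<C> \<C> \<bullet> (r \<boxtimes> ident \<C>) \<bullet> r"
    by (subst al_natural') simp_all
  also have "\<dots> = ((ident ?L \<boxtimes> \<Delta>) \<bullet> r') \<bullet> P"
    unfolding rr(4) by (simp add: cP interchange_tail)
  finally have 1: "al ?L \<C> \<C> \<bullet> (r' \<boxtimes> ident \<C>) \<bullet> r' = (ident ?L \<boxtimes> \<Delta>) \<bullet> r'"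
    by - (rule epi_arrowD[OF P], auto simp: cmp_sel)
  have "(ru ?L \<bullet> (ident ?L \<boxtimes> \<epsilon>) \<bullet> r') \<bullet> P = ru ?L \<bullet> (P \<boxtimes> ident \<I>) \<bullet> (ident (src r) \<boxtimes> \<epsilon>) \<bullet> r"
    by (simp add: cP interchange_tail)
  also have "\<dots> = P \<bullet> ru (src r) \<bullet> (ident (src r) \<boxtimes> \<epsilon>) \<bullet> r"
    using cmp_tail[OF ru_natural[of P]] by simp
  also have "\<dots> = ident ?L \<bullet> P"
    unfolding rr(5) by simp
  finally have "ru ?L \<bullet> (ident ?L \<boxtimes> \<epsilon>) \<bullet> r' = ident ?L"
    by - (rule epi_arrowD[OF P], auto simp: cmp_sel)
  with 1 show ?thesis by (simp add: right_coaction_def)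
qed

lemma bicoaction_quotient:
  assumes b: "bicoaction l r" and P: "epi_arrow P" and c: "left_colinear P l l'" "right_colinear P r r'"
    and t: "arr l'" "tgt l' = \<C> \<otimes>\<^sub>o src l'" "arr r'" "tgt r' = src r' \<otimes>\<^sub>o \<C>"
  shows "bicoaction l' r'"
proof -
  let ?L = "src l'"
  note bb = bicoactionD[OF b]
  note ll = left_coactionD[OF bb(1)] note rr = right_coactionD[OF bb(2)]
  have [simp]: "arr P" "src P = src l" "tgt P = ?L" and lP: "l' \<bullet> P = (ident \<C> \<boxtimes> P) \<bullet> l"
    using c by (simp_all add: left_colinear_def)
  have [simp]: "src r' = ?L" and rP: "r' \<bullet> P = (P \<boxtimes> ident \<C>) \<bullet> r"
    using c by (simp_all add: right_colinear_def)
  note [simp] = ll(1-3) rr(1-3) t bb(3)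
  have [simp]: "?L \<in> Ob M" using arr_Ob[of l'] by simp
  have "(al \<C> ?L \<C> \<bullet> (l' \<boxtimes> ident \<C>) \<bullet> r') \<bullet> P = al \<C> ?L \<C> \<bullet> ((ident \<C> \<boxtimes> P) \<boxtimes> ident \<C>) \<bullet> (l \<boxtimes> ident \<C>) \<bullet> r"
    by (simp add: lP rP interchange_tail)
  also have "\<dots> = (ident \<C> \<boxtimes> (P \<boxtimes> ident \<C>)) \<bullet> al \<C> (src l) \<C> \<bullet> (l \<boxtimes> ident \<C>) \<bullet> r"
    by (subst al_natural') simp_all
  also have "\<dots> = ((ident \<C> \<boxtimes> r') \<bullet> l') \<bullet> P"
    unfolding bb(4) by (simp add: lP rP interchange_tail)
  finally have "al \<C> ?L \<C> \<bullet> (l' \<boxtimes> ident \<C>) \<bullet> r' = (ident \<C> \<boxtimes> r') \<bullet> l'"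
    by - (rule epi_arrowD[OF P], auto simp: cmp_sel)
  then show ?thesis
    using left_coaction_quotient[OF bb(1) P c(1)] right_coaction_quotient[OF bb(2) P c(2)] t
    by (simp add: bicoaction_def)
qed

text \<open>\<open>cofree X\<close> is the coaction of the cofree left comodule
  \<open>\<C> \<otimes> X\<close>, and \<open>tensor_right X r\<close> lets \<open>\<C>\<close>
  coact on the second factor of \<open>X \<otimes> Y\<close>. For a right comodule \<open>Y\<close>
  the two together give the bicomodule \<open>\<C> \<otimes> Y\<close>.\<close>

definition cofree where "cofree X = al \<C> \<C> X \<bullet> (\<Delta> \<boxtimes> ident X)"
definition tensor_right where "tensor_right X r = al' X (src r) \<C> \<bullet> (ident X \<boxtimes> r)"

lemma cofree_typing [simp]:
  assumes "X \<in> Ob M"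
  shows "arr (cofree X)" "src (cofree X) = \<C> \<otimes>\<^sub>o X" "tgt (cofree X) = \<C> \<otimes>\<^sub>o (\<C> \<otimes>\<^sub>o X)"
  using assms by (simp_all add: cofree_def cmp_sel)

lemma tensor_right_typing:
  assumes "X \<in> Ob M" "right_coaction r"
  shows "arr (tensor_right X r)" "src (tensor_right X r) = X \<otimes>\<^sub>o src r" "tgt (tensor_right X r) = (X \<otimes>\<^sub>o src r) \<otimes>\<^sub>o \<C>"
  using assms right_coactionD[OF assms(2)] by (simp_all add: tensor_right_def cmp_sel)

text \<open>Coassociativity of \<open>C\<close> is tensored with \<open>X\<close> and rebracketed by
  the pentagon; the counit law rests on \<open>lu_tensor\<close>.\<close>

lemma left_coaction_cofree:
  assumes [simp]: "X \<in> Ob M"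
  shows "left_coaction (cofree X)"
proof -
  have "al \<C> \<C> (\<C> \<otimes>\<^sub>o X) \<bullet> (\<Delta> \<boxtimes> ident (\<C> \<otimes>\<^sub>o X)) \<bullet> cofree X
     = al \<C> \<C> (\<C> \<otimes>\<^sub>o X) \<bullet> (\<Delta> \<boxtimes> (ident \<C> \<boxtimes> ident X)) \<bullet> al \<C> \<C> X \<bullet> (\<Delta> \<boxtimes> ident X)"
    by (simp add: cofree_def)
  also have "\<dots> = al \<C> \<C> (\<C> \<otimes>\<^sub>o X) \<bullet> al (\<C> \<otimes>\<^sub>o \<C>) \<C> X \<bullet> ((\<Delta> \<boxtimes> ident \<C>) \<boxtimes> ident X) \<bullet> (\<Delta> \<boxtimes> ident X)"
    by (subst al_natural'(2)) simp_all
  also have "\<dots> = (al \<C> \<C> (\<C> \<otimes>\<^sub>o X) \<bullet> al (\<C> \<otimes>\<^sub>o \<C>) \<C> X) \<bullet> (((\<Delta> \<boxtimes> ident \<C>) \<bullet> \<Delta>) \<boxtimes> ident X)"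
    by (simp add: interchange)
  also have "\<dots> = (ident \<C> \<boxtimes> al \<C> \<C> X) \<bullet> al \<C> (\<C> \<otimes>\<^sub>o \<C>) X \<bullet> ((al \<C> \<C> \<C> \<bullet> (\<Delta> \<boxtimes> ident \<C>) \<bullet> \<Delta>) \<boxtimes> ident X)"
    by (simp add: arrow_pentagon interchange cmp_sel)
  also have "\<dots> = (ident \<C> \<boxtimes> al \<C> \<C> X) \<bullet> al \<C> (\<C> \<otimes>\<^sub>o \<C>) X \<bullet> ((ident \<C> \<boxtimes> \<Delta>) \<boxtimes> ident X) \<bullet> (\<Delta> \<boxtimes> ident X)"
    unfolding coassoc by (simp add: interchange)
  also have "\<dots> = (ident \<C> \<boxtimes> al \<C> \<C> X) \<bullet> (ident \<C> \<boxtimes> (\<Delta> \<boxtimes> ident X)) \<bullet> al \<C> \<C> X \<bullet> (\<Delta> \<boxtimes> ident X)"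
    by (subst al_natural'(2)) simp_all
  also have "\<dots> = (ident \<C> \<boxtimes> cofree X) \<bullet> cofree X"
    by (simp add: cofree_def interchange_tail)
  finally have 1: "al \<C> \<C> (\<C> \<otimes>\<^sub>o X) \<bullet> (\<Delta> \<boxtimes> ident (\<C> \<otimes>\<^sub>o X)) \<bullet> cofree X = (ident \<C> \<boxtimes> cofree X) \<bullet> cofree X" .
  have "lu (\<C> \<otimes>\<^sub>o X) \<bullet> (\<epsilon> \<boxtimes> ident (\<C> \<otimes>\<^sub>o X)) \<bullet> cofree X
     = lu (\<C> \<otimes>\<^sub>o X) \<bullet> (\<epsilon> \<boxtimes> (ident \<C> \<boxtimes> ident X)) \<bullet> al \<C> \<C> X \<bullet> (\<Delta> \<boxtimes> ident X)"
    by (simp add: cofree_def)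
  also have "\<dots> = lu (\<C> \<otimes>\<^sub>o X) \<bullet> al \<I> \<C> X \<bullet> ((\<epsilon> \<boxtimes> ident \<C>) \<boxtimes> ident X) \<bullet> (\<Delta> \<boxtimes> ident X)"
    by (subst al_natural'(2)) simp_all
  also have "\<dots> = (lu (\<C> \<otimes>\<^sub>o X) \<bullet> al \<I> \<C> X) \<bullet> (((\<epsilon> \<boxtimes> ident \<C>) \<bullet> \<Delta>) \<boxtimes> ident X)"
    by (simp add: interchange)
  also have "\<dots> = ident (\<C> \<otimes>\<^sub>o X)"
    by (simp add: lu_tensor interchange counit_left cmp_sel)
  finally show ?thesis using 1 by (simp add: left_coaction_def)
qed

lemma right_coaction_tensor_right:
  assumes X [simp]: "X \<in> Ob M" and r: "right_coaction r"
  shows "right_coaction (tensor_right X r)"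
proof -
  let ?Y = "src r"
  note rr = right_coactionD[OF r] note [simp] = rr(1-3)
  let ?t = "tensor_right X r"
  have rr4: "(r \<boxtimes> ident \<C>) \<bullet> r = al' ?Y \<C> \<C> \<bullet> (ident ?Y \<boxtimes> \<Delta>) \<bullet> r"
    using rr(4) by (simp add: al_eq_iff cmp_sel)
  have "al (X \<otimes>\<^sub>o ?Y) \<C> \<C> \<bullet> (?t \<boxtimes> ident \<C>) \<bullet> ?t =
     al (X \<otimes>\<^sub>o ?Y) \<C> \<C> \<bullet> (al' X ?Y \<C> \<boxtimes> ident \<C>) \<bullet> ((ident X \<boxtimes> r) \<boxtimes> ident \<C>) \<bullet> al' X ?Y \<C> \<bullet> (ident X \<boxtimes> r)"
    by (simp add: tensor_right_def interchange_tail)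
  also have "\<dots> = al (X \<otimes>\<^sub>o ?Y) \<C> \<C> \<bullet> (al' X ?Y \<C> \<boxtimes> ident \<C>) \<bullet> al' X (?Y \<otimes>\<^sub>o \<C>) \<C> \<bullet> (ident X \<boxtimes> (r \<boxtimes> ident \<C>)) \<bullet> (ident X \<boxtimes> r)"
    by (subst al_natural'(4)) simp_all
  also have "\<dots> = al (X \<otimes>\<^sub>o ?Y) \<C> \<C> \<bullet> (al' X ?Y \<C> \<boxtimes> ident \<C>) \<bullet> al' X (?Y \<otimes>\<^sub>o \<C>) \<C> \<bullet> (ident X \<boxtimes> ((r \<boxtimes> ident \<C>) \<bullet> r))"
    by (simp add: interchange)
  also have "\<dots> = (al (X \<otimes>\<^sub>o ?Y) \<C> \<C> \<bullet> (al' X ?Y \<C> \<boxtimes> ident \<C>) \<bullet> al' X (?Y \<otimes>\<^sub>o \<C>) \<C> \<bullet> (ident X \<boxtimes> al' ?Y \<C> \<C>)) \<bullet>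
      (ident X \<boxtimes> (ident ?Y \<boxtimes> \<Delta>)) \<bullet> (ident X \<boxtimes> r)"
    unfolding rr4 by (simp add: interchange interchange_tail cmp_sel)
  also have "\<dots> = al' X ?Y (\<C> \<otimes>\<^sub>o \<C>) \<bullet> (ident X \<boxtimes> (ident ?Y \<boxtimes> \<Delta>)) \<bullet> (ident X \<boxtimes> r)"
    by (subst al'_pentagon) simp_all
  also have "\<dots> = ((ident X \<boxtimes> ident ?Y) \<boxtimes> \<Delta>) \<bullet> al' X ?Y \<C> \<bullet> (ident X \<boxtimes> r)"
    by (subst al_natural'(4)) simp_all
  finally have 1: "al (X \<otimes>\<^sub>o ?Y) \<C> \<C> \<bullet> (?t \<boxtimes> ident \<C>) \<bullet> ?t = (ident (X \<otimes>\<^sub>o ?Y) \<boxtimes> \<Delta>) \<bullet> ?t"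
    by (simp add: tensor_right_def)
  have "ru (X \<otimes>\<^sub>o ?Y) \<bullet> (ident (X \<otimes>\<^sub>o ?Y) \<boxtimes> \<epsilon>) \<bullet> ?t = ru (X \<otimes>\<^sub>o ?Y) \<bullet> ((ident X \<boxtimes> ident ?Y) \<boxtimes> \<epsilon>) \<bullet> al' X ?Y \<C> \<bullet> (ident X \<boxtimes> r)"
    by (simp add: tensor_right_def)
  also have "\<dots> = ru (X \<otimes>\<^sub>o ?Y) \<bullet> al' X ?Y \<I> \<bullet> (ident X \<boxtimes> (ident ?Y \<boxtimes> \<epsilon>)) \<bullet> (ident X \<boxtimes> r)"
    by (subst al_natural'(4)) simp_all
  also have "\<dots> = (ident X \<boxtimes> ru ?Y) \<bullet> (ident X \<boxtimes> (ident ?Y \<boxtimes> \<epsilon>)) \<bullet> (ident X \<boxtimes> r)"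
    using cmp_tail[OF unit_al'(3)[of X ?Y]] by simp
  also have "\<dots> = ident (X \<otimes>\<^sub>o ?Y)"
    by (simp add: interchange interchange_tail rr(5) cmp_sel)
  finally show ?thesis
    using 1 tensor_right_typing[OF X r] by (simp add: right_coaction_def)
qed

text \<open>The two coactions act on different tensor factors and therefore commute up to
  rebracketing.\<close>

lemma bicoaction_cofree:
  assumes r: "right_coaction r"
  shows "bicoaction (cofree (src r)) (tensor_right \<C> r)"
proof -
  let ?Y = "src r"
  note rr = right_coactionD[OF r] note [simp] = rr(1-3)
  have "al \<C> (\<C> \<otimes>\<^sub>o ?Y) \<C> \<bullet> (cofree ?Y \<boxtimes> ident \<C>) \<bullet> tensor_right \<C> r
    = al \<C> (\<C> \<otimes>\<^sub>o ?Y) \<C> \<bullet> (al \<C> \<C> ?Y \<boxtimes> ident \<C>) \<bullet> ((\<Delta> \<boxtimes> ident ?Y) \<boxtimes> ident \<C>) \<bullet> al' \<C> ?Y \<C> \<bullet> (ident \<C> \<boxtimes> r)"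
    by (simp add: cofree_def tensor_right_def interchange_tail)
  also have "\<dots> = al \<C> (\<C> \<otimes>\<^sub>o ?Y) \<C> \<bullet> (al \<C> \<C> ?Y \<boxtimes> ident \<C>) \<bullet> al' (\<C> \<otimes>\<^sub>o \<C>) ?Y \<C> \<bullet> (\<Delta> \<boxtimes> (ident ?Y \<boxtimes> ident \<C>)) \<bullet> (ident \<C> \<boxtimes> r)"
    by (subst al_natural'(4)) simp_all
  also have "\<dots> = (al \<C> (\<C> \<otimes>\<^sub>o ?Y) \<C> \<bullet> (al \<C> \<C> ?Y \<boxtimes> ident \<C>) \<bullet> al' (\<C> \<otimes>\<^sub>o \<C>) ?Y \<C>) \<bullet> (\<Delta> \<boxtimes> r)"
    by (simp add: interchange)
  also have "\<dots> = (ident \<C> \<boxtimes> al' \<C> ?Y \<C>) \<bullet> al \<C> \<C> (?Y \<otimes>\<^sub>o \<C>) \<bullet> ((ident \<C> \<boxtimes> ident \<C>) \<boxtimes> r) \<bullet> (\<Delta> \<boxtimes> ident ?Y)"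
    by (simp add: al'_pentagon(2) interchange)
  also have "\<dots> = (ident \<C> \<boxtimes> al' \<C> ?Y \<C>) \<bullet> (ident \<C> \<boxtimes> (ident \<C> \<boxtimes> r)) \<bullet> al \<C> \<C> ?Y \<bullet> (\<Delta> \<boxtimes> ident ?Y)"
    by (subst al_natural'(2)) simp_all
  also have "\<dots> = (ident \<C> \<boxtimes> tensor_right \<C> r) \<bullet> cofree ?Y"
    by (simp add: cofree_def tensor_right_def interchange_tail)
  finally show ?thesis
    using left_coaction_cofree[of ?Y] right_coaction_tensor_right[of \<C> r] r tensor_right_typing[of \<C> r]
    by (simp add: bicoaction_def)
qed

text \<open>Coassociativity of \<open>l\<close> is its left colinearity, and its compatibility with
  \<open>r\<close> is its right colinearity. So every bicomodule maps into a cofree one by its own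
  coaction.\<close>

lemma coaction_colinear:
  assumes "bicoaction l r"
  shows "left_colinear l l (cofree (src l))" "right_colinear l r (tensor_right \<C> r)"
  using bicoactionD[OF assms] left_coactionD[of l] right_coactionD[of r]
  by (auto simp: left_colinear_def right_colinear_def cofree_def tensor_right_def cmp_sel al_eq_iff)

lemma cofree_colinear:
  assumes [simp]: "arr f"
  shows "left_colinear (ident \<C> \<boxtimes> f) (cofree (src f)) (cofree (tgt f))"
proof -
  note [simp] = arr_Ob[OF assms]
  have "cofree (tgt f) \<bullet> (ident \<C> \<boxtimes> f) = al \<C> \<C> (tgt f) \<bullet> ((ident \<C> \<boxtimes> ident \<C>) \<boxtimes> f) \<bullet> (\<Delta> \<boxtimes> ident (src f))"
    by (simp add: cofree_def interchange)
  also have "\<dots> = (ident \<C> \<boxtimes> (ident \<C> \<boxtimes> f)) \<bullet> cofree (src f)"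
    by (subst al_natural'(2)) (simp_all add: cofree_def)
  finally show ?thesis by (simp add: left_colinear_def)
qed

lemma tensor_right_colinear:
  assumes X [simp]: "X \<in> Ob M" and c: "right_colinear f r r'" and r: "right_coaction r" "right_coaction r'"
  shows "right_colinear (ident X \<boxtimes> f) (tensor_right X r) (tensor_right X r')"
proof -
  note rr = right_coactionD[OF r(1)] right_coactionD[OF r(2)] note [simp] = rr(1-3,6-8)
  have [simp]: "arr f" "src f = src r" "tgt f = src r'" and cc: "r' \<bullet> f = (f \<boxtimes> ident \<C>) \<bullet> r"
    using c by (simp_all add: right_colinear_def)
  have "tensor_right X r' \<bullet> (ident X \<boxtimes> f) = al' X (src r') \<C> \<bullet> (ident X \<boxtimes> (f \<boxtimes> ident \<C>)) \<bullet> (ident X \<boxtimes> r)"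
    by (simp add: tensor_right_def interchange cc)
  also have "\<dots> = ((ident X \<boxtimes> f) \<boxtimes> ident \<C>) \<bullet> tensor_right X r"
    by (subst al_natural'(4)) (simp_all add: tensor_right_def)
  finally show ?thesis
    using r by (simp add: right_colinear_def tensor_right_typing)
qed

end

section \<open>Relative injectives among bicomodules\<close>

context coalgebra_in
begin

lemma left_colinear_epi:
  assumes "left_colinear P l l'" "left_colinear (U \<bullet> P) l l''" "epi_arrow P" "arr U" "src U = src l'"
    and "left_coaction l" "left_coaction l'" "left_coaction l''"
  shows "left_colinear U l' l''"
proof -
  note t = left_coactionD(1,2,3)[OF assms(6)] left_coactionD(1,2,3)[OF assms(7)] left_coactionD(1,2,3)[OF assms(8)]
  have [simp]: "arr P" "src P = src l" "tgt P = src l'" and P: "l' \<bullet> P = (ident \<C> \<boxtimes> P) \<bullet> l"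
    using assms(1) by (simp_all add: left_colinear_def)
  have [simp]: "tgt U = src l''" and U: "l'' \<bullet> U \<bullet> P = (ident \<C> \<boxtimes> (U \<bullet> P)) \<bullet> l"
    using assms(2,4,5) by (simp_all add: left_colinear_def cmp_sel)
  have "((ident \<C> \<boxtimes> U) \<bullet> l') \<bullet> P = (l'' \<bullet> U) \<bullet> P"
    using t assms(4,5) by (simp add: P U interchange_tail)
  then have "(ident \<C> \<boxtimes> U) \<bullet> l' = l'' \<bullet> U"
    using t assms(4,5) by - (rule epi_arrowD[OF assms(3)], auto simp: cmp_sel)
  then show ?thesis using assms(4,5) by (simp add: left_colinear_def)
qed

lemma right_colinear_epi:
  assumes "right_colinear P r r'" "right_colinear (U \<bullet> P) r r''" "epi_arrow P" "arr U" "src U = src r'"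
    and "right_coaction r" "right_coaction r'" "right_coaction r''"
  shows "right_colinear U r' r''"
proof -
  note t = right_coactionD(1,2,3)[OF assms(6)] right_coactionD(1,2,3)[OF assms(7)] right_coactionD(1,2,3)[OF assms(8)]
  have [simp]: "arr P" "src P = src r" "tgt P = src r'" and P: "r' \<bullet> P = (P \<boxtimes> ident \<C>) \<bullet> r"
    using assms(1) by (simp_all add: right_colinear_def)
  have [simp]: "tgt U = src r''" and U: "r'' \<bullet> U \<bullet> P = ((U \<bullet> P) \<boxtimes> ident \<C>) \<bullet> r"
    using assms(2,4,5) by (simp_all add: right_colinear_def cmp_sel)
  have "((U \<boxtimes> ident \<C>) \<bullet> r') \<bullet> P = (r'' \<bullet> U) \<bullet> P"
    using t assms(4,5) by (simp add: P U interchange_tail)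
  then have "(U \<boxtimes> ident \<C>) \<bullet> r' = r'' \<bullet> U"
    using t assms(4,5) by - (rule epi_arrowD[OF assms(3)], auto simp: cmp_sel)
  then show ?thesis using assms(4,5) by (simp add: right_colinear_def)
qed

text \<open>A monomorphism may cease to be monic after tensoring with \<open>\<C>\<close>; the
  retraction \<open>R\<close> is what allows \<open>ident \<C> \<boxtimes> F\<close> to be
  cancelled.\<close>

lemma left_colinear_split_mono:
  assumes "left_colinear F l l'" "left_colinear (F \<bullet> U) l'' l'" "arr R" "src R = tgt F" "R \<bullet> F = ident (src F)"
    and "arr U" "tgt U = src l" and "left_coaction l" "left_coaction l'" "left_coaction l''"
  shows "left_colinear U l'' l"
proof -
  note [simp] = left_coactionD(1,2,3)[OF assms(8)] left_coactionD(1,2,3)[OF assms(9)] left_coactionD(1,2,3)[OF assms(10)] assms(3-7)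
  have [simp]: "arr F" "src F = src l" "tgt F = src l'" and F: "l' \<bullet> F = (ident \<C> \<boxtimes> F) \<bullet> l"
    using assms(1) by (simp_all add: left_colinear_def)
  have [simp]: "src U = src l''" and U: "l' \<bullet> F \<bullet> U = (ident \<C> \<boxtimes> (F \<bullet> U)) \<bullet> l''"
    using assms(2) by (simp_all add: left_colinear_def cmp_sel)
  have [simp]: "tgt R = src l" using assms(5) by (metis assms(3,4) cmp_sel(2) \<open>arr F\<close> \<open>src F = src l\<close> \<open>src l \<in> Ob M\<close> ident_sel(2))
  have RFU: "R \<bullet> F \<bullet> U = U"
    using cmp_tail[OF assms(5), of U] by simp
  have "(ident \<C> \<boxtimes> (F \<bullet> U)) \<bullet> l'' = (ident \<C> \<boxtimes> F) \<bullet> l \<bullet> U"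
    using cmp_tail[OF F, of U] U by simp
  then have "(ident \<C> \<boxtimes> R) \<bullet> (ident \<C> \<boxtimes> (F \<bullet> U)) \<bullet> l'' = (ident \<C> \<boxtimes> R) \<bullet> (ident \<C> \<boxtimes> F) \<bullet> l \<bullet> U"
    by simp
  then have "(ident \<C> \<boxtimes> U) \<bullet> l'' = l \<bullet> U"
    by (simp add: interchange_tail RFU cmp_sel)
  then show ?thesis by (simp add: left_colinear_def)
qed

lemma right_colinear_split_mono:
  assumes "right_colinear F r r'" "right_colinear (F \<bullet> U) r'' r'" "arr R" "src R = tgt F" "R \<bullet> F = ident (src F)"
    and "arr U" "tgt U = src r" and "right_coaction r" "right_coaction r'" "right_coaction r''"
  shows "right_colinear U r'' r"
proof -
  note [simp] = right_coactionD(1,2,3)[OF assms(8)] right_coactionD(1,2,3)[OF assms(9)] right_coactionD(1,2,3)[OF assms(10)] assms(3-7)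
  have [simp]: "arr F" "src F = src r" "tgt F = src r'" and F: "r' \<bullet> F = (F \<boxtimes> ident \<C>) \<bullet> r"
    using assms(1) by (simp_all add: right_colinear_def)
  have [simp]: "src U = src r''" and U: "r' \<bullet> F \<bullet> U = ((F \<bullet> U) \<boxtimes> ident \<C>) \<bullet> r''"
    using assms(2) by (simp_all add: right_colinear_def cmp_sel)
  have [simp]: "tgt R = src r" using assms(5) by (metis assms(3,4) cmp_sel(2) \<open>arr F\<close> \<open>src F = src r\<close> \<open>src r \<in> Ob M\<close> ident_sel(2))
  have RFU: "R \<bullet> F \<bullet> U = U"
    using cmp_tail[OF assms(5), of U] by simp
  have "((F \<bullet> U) \<boxtimes> ident \<C>) \<bullet> r'' = (F \<boxtimes> ident \<C>) \<bullet> r \<bullet> U"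
    using cmp_tail[OF F, of U] U by simp
  then have "(R \<boxtimes> ident \<C>) \<bullet> ((F \<bullet> U) \<boxtimes> ident \<C>) \<bullet> r'' = (R \<boxtimes> ident \<C>) \<bullet> (F \<boxtimes> ident \<C>) \<bullet> r \<bullet> U"
    by simp
  then have "(U \<boxtimes> ident \<C>) \<bullet> r'' = r \<bullet> U"
    by (simp add: interchange_tail RFU cmp_sel)
  then show ?thesis by (simp add: right_colinear_def)
qed

lemma Mor_bicomE:
  assumes "f \<in> Mor bicom V W" "bicomodule M C V" "bicomodule M C W"
  obtains F where "F = arrow_of (bobj V) f (bobj W)" "arr F" "src F = bobj V" "tgt F = bobj W" "mor F = f"
    "left_colinear F (lact V) (lact W)" "right_colinear F (ract V) (ract W)"
  using that[of "arrow_of (bobj V) f (bobj W)"] assms by (simp add: Mor_bicom_iff arr_arrow_of arrow_of_sel)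

lemma has_retraction_arrow:
  assumes "has_retraction M X Y f" "X \<in> Ob M" "Y \<in> Ob M"
  obtains R where "arr R" "src R = Y" "tgt R = X" "R \<bullet> arrow_of X f Y = ident X"
proof -
  obtain r where r: "f \<in> Mor M X Y" "r \<in> Mor M Y X" "r \<cdot> f = idm M X"
    using assms(1) by (auto simp: has_retraction_def)
  then show ?thesis
    using that[of "arrow_of Y r X"] assms(2,3)
    by (simp add: cmp_arrow_of arr_arrow_of arrow_of_sel) (simp add: ident_def)
qed

text \<open>The cokernel taken in \<open>M\<close> inherits coactions because the retraction of
  \<open>f\<close> splits it. The same splitting shows that \<open>f\<close> is the kernel of its
  cokernel among bicomodules.\<close>

lemma split_cokernel:
  assumes V: "bicomodule M C V" and W: "bicomodule M C W" and f: "f \<in> Mor bicom V W"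
    and ret: "has_retraction M (bobj V) (bobj W) f"
  obtains L \<pi> where "bicomodule M C L" "is_cokernel bicom V W f L \<pi>" "is_kernel bicom W L \<pi> V f"
    "\<pi> \<in> Mor bicom W L" "cokernel_arrow (arrow_of (bobj V) f (bobj W)) (arrow_of (bobj W) \<pi> (bobj L))"
proof -
  obtain F where F_def: "F = arrow_of (bobj V) f (bobj W)" and F [simp]: "arr F" "src F = bobj V" "tgt F = bobj W" "mor F = f"
    and Fc: "left_colinear F (lact V) (lact W)" "right_colinear F (ract V) (ract W)"
    using f V W by (rule Mor_bicomE)
  have [simp]: "bobj V \<in> Ob M" "bobj W \<in> Ob M" using V W by auto
  obtain R where R: "arr R" "src R = bobj W" "tgt R = bobj V" "R \<bullet> F = ident (bobj V)"
    unfolding F_def by (rule has_retraction_arrow[OF ret]) auto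
  note [simp] = R(1-3)
  have fM: "f \<in> Mor M (bobj V) (bobj W)" using f by (rule Mor_bicomD)
  obtain L0 c where "is_cokernel M (bobj V) (bobj W) f L0 c"
    using cokernel_ex[OF _ _ fM] by auto
  then have L0 [simp]: "L0 \<in> Ob M" and c: "c \<in> Mor M (bobj W) L0"
    and cok0: "cokernel_arrow F (arrow_of (bobj W) c L0)"
    by (auto simp: is_cokernel_iff F_def)
  define P where "P = arrow_of (bobj W) c L0"
  have P [simp]: "arr P" "src P = bobj W" "tgt P = L0" "mor P = c"
    using c by (simp_all add: P_def arr_arrow_of arrow_of_sel)
  have cok: "cokernel_arrow F P" using cok0 by (simp add: P_def)
  note PF = cokernel_arrowD[OF cok]
  obtain T where T [simp]: "arr T" "src T = L0" "tgt T = bobj W" and PT: "P \<bullet> T = ident L0"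
    and TP: "T \<bullet> P = ident (bobj W) \<^bold>+ \<^bold>- (F \<bullet> R)"
    by (rule split_cokernel_section[OF cok, of R]) (use R in auto)
  note bV = bicoactionD[OF bicomodule_act(10)[OF V]] and bW = bicoactionD[OF bicomodule_act(10)[OF W]]
  note [simp] = bicomodule_act(1-9)[OF V] bicomodule_act(1-9)[OF W]
  \<comment> \<open>The coactions of \<open>W\<close> are transported along the section
    \<open>T\<close>. As \<open>T \<bullet> P\<close> differs from the identity by
    \<open>F \<bullet> R\<close>, whose contribution is killed by \<open>P\<close>, the projection
    becomes colinear.\<close>
  define l r where "l = (ident \<C> \<boxtimes> P) \<bullet> lact W \<bullet> T" and "r = (P \<boxtimes> ident \<C>) \<bullet> ract W \<bullet> T"
  have [simp]: "arr l" "src l = L0" "tgt l = \<C> \<otimes>\<^sub>o L0" "arr r" "src r = L0" "tgt r = L0 \<otimes>\<^sub>o \<C>"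
    by (simp_all add: l_def r_def cmp_sel)
  have "(ident \<C> \<boxtimes> P) \<bullet> lact W \<bullet> F \<bullet> R = (ident \<C> \<boxtimes> P) \<bullet> (ident \<C> \<boxtimes> F) \<bullet> lact V \<bullet> R"
    using cmp_tail[of "lact W" F "(ident \<C> \<boxtimes> F) \<bullet> lact V" R] Fc(1) by (simp add: left_colinear_def)
  also have "\<dots> = zero_arrow (bobj W) (\<C> \<otimes>\<^sub>o L0)"
    using PF(5) by (simp add: interchange_tail cmp_sel)
  finally have "l \<bullet> P = (ident \<C> \<boxtimes> P) \<bullet> lact W"
    by (simp add: l_def TP cmp_add_right cmp_neg cmp_sel)
  then have Pl: "left_colinear P (lact W) l"
    by (simp add: left_colinear_def)
  have "(P \<boxtimes> ident \<C>) \<bullet> ract W \<bullet> F \<bullet> R = (P \<boxtimes> ident \<C>) \<bullet> (F \<boxtimes> ident \<C>) \<bullet> ract V \<bullet> R"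
    using cmp_tail[of "ract W" F "(F \<boxtimes> ident \<C>) \<bullet> ract V" R] Fc(2) by (simp add: right_colinear_def)
  also have "\<dots> = zero_arrow (bobj W) (L0 \<otimes>\<^sub>o \<C>)"
    using PF(5) by (simp add: interchange_tail cmp_sel)
  finally have "r \<bullet> P = (P \<boxtimes> ident \<C>) \<bullet> ract W"
    by (simp add: r_def TP cmp_add_right cmp_neg cmp_sel)
  then have Pr: "right_colinear P (ract W) r"
    by (simp add: right_colinear_def)
  have b: "bicoaction l r"
    by (rule bicoaction_quotient[OF bicomodule_act(10)[OF W] PF(2) Pl Pr]) simp_all
  define L where "L = bicomod_of l r"
  note L = bicomod_of[OF b, folded L_def] note bL = bicoactionD[OF b]
  have [simp]: "bobj L = L0" by (simp add: L)
  have pi: "c \<in> Mor bicom W L"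
    using mor_in_bicom[OF W L(1), of P] Pl Pr L by simp
  have z: "c \<cdot> f = zero_mor M (bobj V) L0"
    using mor_cmp_eq[OF PF(5)] by simp
  have ck: "is_cokernel bicom V W f L c"
    unfolding is_cokernel_def bicom_simps Ob_bicom
  proof (intro conjI ballI impI)
    fix Z h assume Z: "Z \<in> Ob bicom" "h \<in> Mor bicom W Z" and hf: "h \<cdot> f = zero_mor M (bobj V) (bobj Z)"
    then have Z': "bicomodule M C Z" by simp
    note [simp] = bicomodule_act(1-9)[OF Z'] and bZ = bicoactionD[OF bicomodule_act(10)[OF Z']]
    obtain H where "H = arrow_of (bobj W) h (bobj Z)" and H [simp]: "arr H" "src H = bobj W" "tgt H = bobj Z" "mor H = h"
      and Hc: "left_colinear H (lact W) (lact Z)" "right_colinear H (ract W) (ract Z)"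
      using Z(2) W Z' by (rule Mor_bicomE)
    have "H \<bullet> F = zero_arrow (bobj V) (bobj Z)"
      using hf by (intro arrow_eqI) (simp_all add: cmp_sel)
    then obtain U where U [simp]: "arr U" "src U = L0" "tgt U = bobj Z" and UP: "U \<bullet> P = H"
      using cok by (elim cokernel_factor[of _ _ H]) auto
    have "left_colinear U l (lact Z)" "right_colinear U r (ract Z)"
      using left_colinear_epi[OF Pl _ PF(2), of U "lact Z"] right_colinear_epi[OF Pr _ PF(2), of U "ract Z"]
        Hc UP bL bW bZ by auto
    then have "mor U \<in> Mor bicom L Z"
      using mor_in_bicom[OF L(1) Z', of U] L by simp
    moreover have Uc: "mor U \<cdot> c = h"
      using mor_cmp_eq[OF UP] by simp
    moreover have "u = mor U" if u: "u \<in> Mor bicom L Z" "u \<cdot> c = h" for u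
    proof -
      have "u \<in> Mor M L0 (bobj Z)" using Mor_bicomD[OF u(1)] by simp
      then have "arrow_of L0 u (bobj Z) = U"
        using u(2) Uc by - (rule epi_arrowD[OF PF(2)], auto simp: arr_arrow_of arrow_of_sel cmp_sel intro!: arrow_eqI)
      then show ?thesis using \<open>u \<in> Mor M L0 (bobj Z)\<close> by (metis L0 arrow_of_sel(2) bicomodule_act(1) Z')
    qed
    ultimately show "\<exists>!u. u \<in> Mor bicom L Z \<and> u \<cdot> c = h" by blast
  qed (use f pi z L in auto)
  have kr: "is_kernel bicom W L c V f"
    unfolding is_kernel_def bicom_simps Ob_bicom
  proof (intro conjI ballI impI)
    fix Z h assume Z: "Z \<in> Ob bicom" "h \<in> Mor bicom Z W" and hf: "c \<cdot> h = zero_mor M (bobj Z) (bobj L)"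
    then have Z': "bicomodule M C Z" by simp
    note [simp] = bicomodule_act(1-9)[OF Z'] and bZ = bicoactionD[OF bicomodule_act(10)[OF Z']]
    obtain H where "H = arrow_of (bobj Z) h (bobj W)" and H [simp]: "arr H" "src H = bobj Z" "tgt H = bobj W" "mor H = h"
      and Hc: "left_colinear H (lact Z) (lact W)" "right_colinear H (ract Z) (ract W)"
      using Z(2) Z' W by (rule Mor_bicomE)
    have "P \<bullet> H = zero_arrow (bobj Z) L0"
      using hf by (intro arrow_eqI) (simp_all add: cmp_sel)
    \<comment> \<open>Expanding \<open>T \<bullet> P\<close> turns this into
      \<open>H = F \<bullet> R \<bullet> H\<close>, so \<open>R \<bullet> H\<close> is the required
      factorization through \<open>F\<close>.\<close>
    then have "T \<bullet> P \<bullet> H = zero_arrow (bobj Z) (bobj W)"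
      by simp
    then have "H \<^bold>+ \<^bold>- (F \<bullet> R \<bullet> H) = zero_arrow (bobj Z) (bobj W)"
      using cmp_tail[OF TP, of H] by (simp add: cmp_add_left neg_cmp)
    then have FRH: "F \<bullet> R \<bullet> H = H"
      by - (rule add_right_cancel[of _ "\<^bold>- (F \<bullet> R \<bullet> H)"], auto simp: add_neg cmp_sel)
    have "left_colinear (R \<bullet> H) (lact Z) (lact V)" "right_colinear (R \<bullet> H) (ract Z) (ract V)"
      using left_colinear_split_mono[OF Fc(1), of "R \<bullet> H" "lact Z" R] right_colinear_split_mono[OF Fc(2), of "R \<bullet> H" "ract Z" R]
        Hc FRH R bV bW bZ by (auto simp: cmp_sel)
    then have "mor (R \<bullet> H) \<in> Mor bicom Z V"
      using mor_in_bicom[OF Z' V] by simp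
    moreover have "f \<cdot> mor (R \<bullet> H) = h"
      using mor_cmp_eq[OF FRH] by (simp add: cmp_sel)
    moreover have "u = mor (R \<bullet> H)" if u: "u \<in> Mor bicom Z V" "f \<cdot> u = h" for u
    proof -
      have uM: "u \<in> Mor M (bobj Z) (bobj V)" using Mor_bicomD[OF u(1)] .
      let ?u = "arrow_of (bobj Z) u (bobj V)"
      have "F \<bullet> ?u = H"
        using u(2) uM by (intro arrow_eqI) (auto simp: arr_arrow_of arrow_of_sel cmp_sel)
      then have "R \<bullet> H = ?u"
        using cmp_tail[OF R(4), of ?u] uM by (simp add: arr_arrow_of arrow_of_sel)
      then show ?thesis using uM by (simp add: arrow_of_sel)
    qed
    ultimately show "\<exists>!u. u \<in> Mor bicom Z V \<and> f \<cdot> u = h" by blast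
  qed (use f pi z V in auto)
  show ?thesis
    using that[OF L(1) ck kr pi] cok0 by (simp add: F_def)
qed

lemma split_monoI:
  assumes "bicomodule M C V" "bicomodule M C W" "f \<in> Mor bicom V W" "has_retraction M (bobj V) (bobj W) f"
  shows "split_mono M C V W f"
proof -
  have [simp]: "bobj V \<in> Ob M" "bobj W \<in> Ob M" using assms by auto
  have f: "f \<in> Mor M (bobj V) (bobj W)" using assms(3) by (rule Mor_bicomD)
  obtain R where R: "arr R" "src R = bobj W" "tgt R = bobj V" "R \<bullet> arrow_of (bobj V) f (bobj W) = ident (bobj V)"
    by (rule has_retraction_arrow[OF assms(4)]) auto
  then have "mono_arrow (arrow_of (bobj V) f (bobj W))"
    using f split_mono_arrow[of "arrow_of (bobj V) f (bobj W)" R] by (simp add: arr_arrow_of arrow_of_sel)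
  then have "is_mono M (bobj V) (bobj W) f"
    using f by (simp add: is_mono_iff)
  then have "is_mono bicom V W f"
    using assms(3) Mor_bicomD bicomodule_act(1) unfolding is_mono_def bicom_simps Ball_def Ob_bicom by blast
  then show ?thesis using assms(4) by (simp add: split_mono_def)
qed

lemma split_mono_Mor: "split_mono M C V W j \<Longrightarrow> j \<in> Mor bicom V W"
  by (simp add: split_mono_def is_mono_def)

text \<open>The counit of the cofree adjunction at \<open>X\<close> is
  \<open>lu X \<bullet> (\<epsilon> \<boxtimes> ident X)\<close>; this is its triangle identity on a
  cofree comodule.\<close>

lemma cofree_counit:
  assumes [simp]: "X \<in> Ob M"
  shows "(ident \<C> \<boxtimes> (lu X \<bullet> (\<epsilon> \<boxtimes> ident X))) \<bullet> cofree X = ident (\<C> \<otimes>\<^sub>o X)"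
proof -
  have "(ident \<C> \<boxtimes> (lu X \<bullet> (\<epsilon> \<boxtimes> ident X))) \<bullet> cofree X
    = (ident \<C> \<boxtimes> lu X) \<bullet> (ident \<C> \<boxtimes> (\<epsilon> \<boxtimes> ident X)) \<bullet> al \<C> \<C> X \<bullet> (\<Delta> \<boxtimes> ident X)"
    by (simp add: cofree_def interchange_tail)
  also have "\<dots> = (ident \<C> \<boxtimes> lu X) \<bullet> al \<C> \<I> X \<bullet> ((ident \<C> \<boxtimes> \<epsilon>) \<boxtimes> ident X) \<bullet> (\<Delta> \<boxtimes> ident X)"
    by (subst al_natural'(2)) simp_all
  also have "\<dots> = (ru \<C> \<bullet> (ident \<C> \<boxtimes> \<epsilon>) \<bullet> \<Delta>) \<boxtimes> ident X"
    using cmp_tail[OF arrow_triangle[of \<C> X]] by (simp add: interchange cmp_sel)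
  finally show ?thesis by (simp add: counit_right)
qed

lemma tensor_right_counit:
  assumes r: "right_coaction r"
  shows "right_colinear (lu (src r) \<bullet> (\<epsilon> \<boxtimes> ident (src r))) (tensor_right \<C> r) r"
proof -
  let ?Y = "src r"
  note [simp] = right_coactionD(1-3)[OF r]
  have "((lu ?Y \<bullet> (\<epsilon> \<boxtimes> ident ?Y)) \<boxtimes> ident \<C>) \<bullet> tensor_right \<C> r
    = (lu ?Y \<boxtimes> ident \<C>) \<bullet> ((\<epsilon> \<boxtimes> ident ?Y) \<boxtimes> ident \<C>) \<bullet> al' \<C> ?Y \<C> \<bullet> (ident \<C> \<boxtimes> r)"
    by (simp add: tensor_right_def interchange_tail)
  also have "\<dots> = (lu ?Y \<boxtimes> ident \<C>) \<bullet> al' \<I> ?Y \<C> \<bullet> (\<epsilon> \<boxtimes> (ident ?Y \<boxtimes> ident \<C>)) \<bullet> (ident \<C> \<boxtimes> r)"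
    by (subst al_natural'(4)) simp_all
  also have "\<dots> = lu (?Y \<otimes>\<^sub>o \<C>) \<bullet> (ident \<I> \<boxtimes> r) \<bullet> (\<epsilon> \<boxtimes> ident ?Y)"
    using cmp_tail[OF unit_al'(1)[of ?Y \<C>]] by (simp add: interchange)
  also have "\<dots> = r \<bullet> lu ?Y \<bullet> (\<epsilon> \<boxtimes> ident ?Y)"
    using cmp_tail[OF lu_natural[of r]] by simp
  finally show ?thesis
    using tensor_right_typing[OF _ r, of \<C>] by (simp add: right_colinear_def cmp_sel)
qed

text \<open>Bicolinear maps \<open>V \<rightarrow> C \<otimes> Y\<close> correspond to right colinear maps \<open>V \<rightarrow> Y\<close>.\<close>

lemma cofree_relative_injective:
  assumes r: "right_coaction r"
    and ext: "\<And>r1 r2 j \<rho> u. right_coaction r1 \<Longrightarrow> right_coaction r2 \<Longrightarrow> right_colinear j r1 r2 \<Longrightarrow> arr \<rho> \<Longrightarrow>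
       src \<rho> = tgt j \<Longrightarrow> tgt \<rho> = src j \<Longrightarrow> \<rho> \<bullet> j = ident (src j) \<Longrightarrow> right_colinear u r1 r \<Longrightarrow>
       \<exists>u'. right_colinear u' r2 r \<and> u' \<bullet> j = u"
  shows "relative_injective bicom (split_mono M C) (bicomod_of (cofree (src r)) (tensor_right \<C> r))"
proof (rule preadditive_category.relative_injectiveI[OF preadditive_bicom])
  let ?Y = "src r" let ?Q = "bicomod_of (cofree ?Y) (tensor_right \<C> r)"
  note [simp] = right_coactionD(1-3)[OF r]
  note Q = bicomod_of[OF bicoaction_cofree[OF r]]
  show "?Q \<in> Ob bicom" using Q by simp
  show "j \<in> Mor bicom X Y" if "split_mono M C X Y j" for X Y j
    using that by (rule split_mono_Mor)
  fix V W j h assume "V \<in> Ob bicom" "W \<in> Ob bicom" and sm: "split_mono M C V W j" and h: "h \<in> Mor bicom V ?Q"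
  then have V: "bicomodule M C V" and W: "bicomodule M C W" by auto
  note bV = bicoactionD[OF bicomodule_act(10)[OF V]] and bW = bicoactionD[OF bicomodule_act(10)[OF W]]
  note [simp] = bicomodule_act(1-9)[OF V] bicomodule_act(1-9)[OF W]
  obtain j' where j'_def: "j' = arrow_of (bobj V) j (bobj W)" and j' [simp]: "arr j'" "src j' = bobj V" "tgt j' = bobj W" "mor j' = j"
    and jc: "left_colinear j' (lact V) (lact W)" "right_colinear j' (ract V) (ract W)"
    using split_mono_Mor[OF sm] V W by (rule Mor_bicomE)
  obtain \<rho> where \<rho>: "arr \<rho>" "src \<rho> = bobj W" "tgt \<rho> = bobj V" "\<rho> \<bullet> j' = ident (bobj V)"
    unfolding j'_def by (rule has_retraction_arrow[of "bobj V" "bobj W" j]) (use sm in \<open>auto simp: split_mono_def\<close>)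
  obtain H where "H = arrow_of (bobj V) h (bobj ?Q)" and H [simp]: "arr H" "src H = bobj V" "tgt H = \<C> \<otimes>\<^sub>o ?Y" "mor H = h"
    and Hc: "left_colinear H (lact V) (cofree ?Y)" "right_colinear H (ract V) (tensor_right \<C> r)"
    using h V Q(1) by (rule Mor_bicomE) (simp add: Q)
  \<comment> \<open>Composing with the counit of the adjunction gives the right colinear map that
    corresponds to \<open>H\<close>. Once this is extended to \<open>u'\<close>, the map
    \<open>?g\<close> is the bicolinear map corresponding to \<open>u'\<close>.\<close>
  define u where "u = (lu ?Y \<bullet> (\<epsilon> \<boxtimes> ident ?Y)) \<bullet> H"
  have u [simp]: "arr u" "src u = bobj V" "tgt u = ?Y" by (simp_all add: u_def cmp_sel)
  have "right_colinear u (ract V) r"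
    unfolding u_def by (rule right_colinear_cmp[OF Hc(2) tensor_right_counit[OF r]])
  then obtain u' where u'c: "right_colinear u' (ract W) r" and u'j: "u' \<bullet> j' = u"
    using ext[OF bV(2) bW(2) jc(2), of \<rho> u] \<rho> by auto
  have u' [simp]: "arr u'" "src u' = bobj W" "tgt u' = ?Y"
    using u'c by (simp_all add: right_colinear_def)
  let ?g = "(ident \<C> \<boxtimes> u') \<bullet> lact W"
  have "left_colinear ?g (lact W) (cofree ?Y)" "right_colinear ?g (ract W) (tensor_right \<C> r)"
    using left_colinear_cmp[OF coaction_colinear(1)[OF bicomodule_act(10)[OF W]], of "ident \<C> \<boxtimes> u'"] cofree_colinear[of u']
      right_colinear_cmp[OF coaction_colinear(2)[OF bicomodule_act(10)[OF W]] tensor_right_colinear[OF _ u'c bW(2) r]] by auto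
  then have g: "mor ?g \<in> Mor bicom W ?Q"
    using mor_in_bicom[OF W Q(1)] Q by simp
  have jl: "lact W \<bullet> j' = (ident \<C> \<boxtimes> j') \<bullet> lact V"
    using jc(1) by (simp add: left_colinear_def)
  have "?g \<bullet> j' = (ident \<C> \<boxtimes> u) \<bullet> lact V"
    by (simp add: jl interchange_tail u'j)
  also have "\<dots> = (ident \<C> \<boxtimes> (lu ?Y \<bullet> (\<epsilon> \<boxtimes> ident ?Y))) \<bullet> (ident \<C> \<boxtimes> H) \<bullet> lact V"
    by (simp add: u_def interchange_tail cmp_sel)
  also have "\<dots> = ((ident \<C> \<boxtimes> (lu ?Y \<bullet> (\<epsilon> \<boxtimes> ident ?Y))) \<bullet> cofree ?Y) \<bullet> H"
    using Hc(1) by (simp add: left_colinear_def)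
  also have "\<dots> = H"
    unfolding cofree_counit[OF \<open>?Y \<in> Ob M\<close>] by simp
  finally have "mor ?g \<cdot> j = h"
    using mor_cmp_eq[of ?g j' H] by (simp add: cmp_sel)
  with g show "\<exists>g\<in>Mor bicom W ?Q. comp bicom g j = h" by auto
qed

lemma regular_bicoaction: "left_coaction \<Delta>" "right_coaction \<Delta>" "bicoaction \<Delta> \<Delta>"
  using coassoc counit_left counit_right by (simp_all add: left_coaction_def right_coaction_def bicoaction_def)

lemma regular_bicomodule:
  "bicomodule M C (regular_bicomodule C)" "lact (regular_bicomodule C) = \<Delta>" "ract (regular_bicomodule C) = \<Delta>"
  "bobj (regular_bicomodule C) = \<C>"
  using bicomod_of[OF regular_bicoaction(3)] by (simp_all add: bicomod_of_def regular_bicomodule_def)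

text \<open>A right colinear map \<open>u\<close> into \<open>\<C>\<close> is determined by the
  arrow \<open>\<epsilon> \<bullet> u\<close> to the unit. An arbitrary arrow extends by composition
  with \<open>\<rho>\<close>, which need not be colinear, and \<open>?u'\<close> is the colinear map
  belonging to the extension \<open>w\<close>.\<close>

lemma right_extension_comult:
  assumes r: "right_coaction r1" "right_coaction r2" and j: "right_colinear j r1 r2"
    and \<rho>: "arr \<rho>" "src \<rho> = tgt j" "tgt \<rho> = src j" "\<rho> \<bullet> j = ident (src j)" and u: "right_colinear u r1 \<Delta>"
  shows "\<exists>u'. right_colinear u' r2 \<Delta> \<and> u' \<bullet> j = u"
proof -
  note r1 = right_coactionD[OF r(1)] and r2 = right_coactionD[OF r(2)]
  note [simp] = r1(1-3) r2(1-3) \<rho>(1-3)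
  have [simp]: "arr j" "src j = src r1" "tgt j = src r2" and jc: "r2 \<bullet> j = (j \<boxtimes> ident \<C>) \<bullet> r1"
    using j by (simp_all add: right_colinear_def)
  have [simp]: "arr u" "src u = src r1" "tgt u = \<C>" and uc: "(u \<boxtimes> ident \<C>) \<bullet> r1 = \<Delta> \<bullet> u"
    using u by (simp_all add: right_colinear_def)
  define w where "w = \<epsilon> \<bullet> u \<bullet> \<rho>"
  have [simp]: "arr w" "src w = src r2" "tgt w = \<I>" by (simp_all add: w_def cmp_sel)
  let ?u' = "lu \<C> \<bullet> (w \<boxtimes> ident \<C>) \<bullet> r2"
  have "al \<I> \<C> \<C> \<bullet> (((w \<boxtimes> ident \<C>) \<bullet> r2) \<boxtimes> ident \<C>) \<bullet> r2 = (w \<boxtimes> \<Delta>) \<bullet> r2"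
    using convolution_assoc[OF r2(4), of w "ident \<C>" "ident \<C>"] by simp
  then have *: "(((w \<boxtimes> ident \<C>) \<bullet> r2) \<boxtimes> ident \<C>) \<bullet> r2 = al' \<I> \<C> \<C> \<bullet> (w \<boxtimes> \<Delta>) \<bullet> r2"
    by (simp add: al_eq_iff cmp_sel)
  have "(?u' \<boxtimes> ident \<C>) \<bullet> r2 = (lu \<C> \<boxtimes> ident \<C>) \<bullet> (((w \<boxtimes> ident \<C>) \<bullet> r2) \<boxtimes> ident \<C>) \<bullet> r2"
    by (simp add: interchange_tail cmp_sel)
  also have "\<dots> = lu (\<C> \<otimes>\<^sub>o \<C>) \<bullet> (ident \<I> \<boxtimes> \<Delta>) \<bullet> (w \<boxtimes> ident \<C>) \<bullet> r2"
    unfolding * using cmp_tail[OF unit_al'(1)[of \<C> \<C>]] by (simp add: interchange_tail)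
  also have "\<dots> = \<Delta> \<bullet> ?u'"
    using cmp_tail[OF lu_natural[of \<Delta>]] by simp
  finally have 1: "right_colinear ?u' r2 \<Delta>"
    by (simp add: right_colinear_def cmp_sel)
  have "?u' \<bullet> j = lu \<C> \<bullet> (\<epsilon> \<boxtimes> ident \<C>) \<bullet> (u \<boxtimes> ident \<C>) \<bullet> r1"
    using \<rho>(4) by (simp add: jc interchange_tail w_def cmp_sel)
  also have "\<dots> = (lu \<C> \<bullet> (\<epsilon> \<boxtimes> ident \<C>) \<bullet> \<Delta>) \<bullet> u"
    unfolding uc by simp
  also have "\<dots> = u"
    unfolding counit_left by simp
  finally show ?thesis using 1 by blast
qed

lemma right_colinear_convolution:
  assumes r: "right_coaction r" and [simp]: "arr w" "src w = src r"
  shows "right_colinear ((w \<boxtimes> ident \<C>) \<bullet> r) r (tensor_right (tgt w) \<Delta>)"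
proof -
  note rr = right_coactionD[OF r] note [simp] = rr(1-3) arr_Ob[OF \<open>arr w\<close>]
  let ?u = "(w \<boxtimes> ident \<C>) \<bullet> r"
  have "al (tgt w) \<C> \<C> \<bullet> (?u \<boxtimes> ident \<C>) \<bullet> r = (w \<boxtimes> \<Delta>) \<bullet> r"
    using convolution_assoc[OF rr(4), of w "ident \<C>" "ident \<C>"] by simp
  then have "(?u \<boxtimes> ident \<C>) \<bullet> r = al' (tgt w) \<C> \<C> \<bullet> (ident (tgt w) \<boxtimes> \<Delta>) \<bullet> ?u"
    by (simp add: al_eq_iff cmp_sel interchange_tail)
  then show ?thesis
    by (simp add: right_colinear_def tensor_right_def tensor_right_typing regular_bicoaction cmp_sel)
qed

text \<open>The same argument for the cofree right comodule \<open>X \<otimes> \<C>\<close>, whose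
  colinear maps correspond to arrows into \<open>X\<close>. It serves the embedding of an arbitrary
  bicomodule, and the preceding version serves \<open>\<C> \<otimes> \<C>\<close>.\<close>

lemma right_extension_tensor:
  assumes X [simp]: "X \<in> Ob M"
    and r: "right_coaction r1" "right_coaction r2" and j: "right_colinear j r1 r2"
    and \<rho>: "arr \<rho>" "src \<rho> = tgt j" "tgt \<rho> = src j" "\<rho> \<bullet> j = ident (src j)" and u: "right_colinear u r1 (tensor_right X \<Delta>)"
  shows "\<exists>u'. right_colinear u' r2 (tensor_right X \<Delta>) \<and> u' \<bullet> j = u"
proof -
  note r1 = right_coactionD[OF r(1)] and r2 = right_coactionD[OF r(2)]
  note [simp] = r1(1-3) r2(1-3) \<rho>(1-3) tensor_right_typing[OF X regular_bicoaction(2)]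
  have [simp]: "arr j" "src j = src r1" "tgt j = src r2" and jc: "r2 \<bullet> j = (j \<boxtimes> ident \<C>) \<bullet> r1"
    using j by (simp_all add: right_colinear_def)
  have [simp]: "arr u" "src u = src r1" "tgt u = X \<otimes>\<^sub>o \<C>" and uc: "(u \<boxtimes> ident \<C>) \<bullet> r1 = tensor_right X \<Delta> \<bullet> u"
    using u by (simp_all add: right_colinear_def)
  define w where "w = ru X \<bullet> (ident X \<boxtimes> \<epsilon>) \<bullet> u \<bullet> \<rho>"
  have [simp]: "arr w" "src w = src r2" "tgt w = X" by (simp_all add: w_def cmp_sel)
  let ?u' = "(w \<boxtimes> ident \<C>) \<bullet> r2"
  have 1: "right_colinear ?u' r2 (tensor_right X \<Delta>)"
    using right_colinear_convolution[OF r(2), of w] by simp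
  have "?u' \<bullet> j = (ru X \<boxtimes> ident \<C>) \<bullet> ((ident X \<boxtimes> \<epsilon>) \<boxtimes> ident \<C>) \<bullet> (u \<boxtimes> ident \<C>) \<bullet> r1"
    using \<rho>(4) by (simp add: jc interchange_tail w_def cmp_sel)
  also have "\<dots> = (ru X \<boxtimes> ident \<C>) \<bullet> ((ident X \<boxtimes> \<epsilon>) \<boxtimes> ident \<C>) \<bullet> al' X \<C> \<C> \<bullet> (ident X \<boxtimes> \<Delta>) \<bullet> u"
    unfolding uc by (simp add: tensor_right_def)
  also have "\<dots> = (ru X \<boxtimes> ident \<C>) \<bullet> al' X \<I> \<C> \<bullet> (ident X \<boxtimes> (\<epsilon> \<boxtimes> ident \<C>)) \<bullet> (ident X \<boxtimes> \<Delta>) \<bullet> u"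
    by (subst al_natural'(4)) simp_all
  also have "\<dots> = (ident X \<boxtimes> (lu \<C> \<bullet> (\<epsilon> \<boxtimes> ident \<C>) \<bullet> \<Delta>)) \<bullet> u"
    using cmp_tail[OF unit_al'(2)[of X \<C>]] by (simp add: interchange_tail cmp_sel)
  also have "\<dots> = u"
    unfolding counit_left by simp
  finally show ?thesis using 1 by blast
qed

text \<open>The two coactions embed \<open>V\<close> into
  \<open>\<C> \<otimes> (V \<otimes> \<C>)\<close>, and applying the counit at both ends retracts
  this embedding in \<open>M\<close>.\<close>

lemma enough_relative_injectives:
  assumes V: "bicomodule M C V"
  shows "\<exists>Q e L p. relative_injective bicom (split_mono M C) Q \<and> split_mono M C V Q e \<and>
      is_cokernel bicom V Q e L p \<and> is_kernel bicom Q L p V e"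
proof -
  let ?V = "bobj V"
  have b: "bicoaction (lact V) (ract V)" using V by simp
  note bV = bicoactionD[OF b] note lV = left_coactionD[OF bV(1)] and rV = right_coactionD[OF bV(2)]
  note [simp] = bicomodule_act(1-9)[OF V]
  let ?r = "tensor_right ?V \<Delta>"
  have r: "right_coaction ?r" by (simp add: right_coaction_tensor_right regular_bicoaction)
  have [simp]: "arr ?r" "src ?r = ?V \<otimes>\<^sub>o \<C>" "tgt ?r = (?V \<otimes>\<^sub>o \<C>) \<otimes>\<^sub>o \<C>"
    by (simp_all add: tensor_right_typing regular_bicoaction)
  define Q where "Q = bicomod_of (cofree (?V \<otimes>\<^sub>o \<C>)) (tensor_right \<C> ?r)"
  have bQ: "bicoaction (cofree (?V \<otimes>\<^sub>o \<C>)) (tensor_right \<C> ?r)"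
    using bicoaction_cofree[OF r] by simp
  note Q = bicomod_of[OF bQ, folded Q_def]
  have inj: "relative_injective bicom (split_mono M C) Q"
    using cofree_relative_injective[OF r right_extension_tensor] by (simp add: Q_def)
  let ?e = "(ident \<C> \<boxtimes> ract V) \<bullet> lact V"
  have rc: "right_colinear (ract V) (ract V) ?r"
    using rV by (simp add: right_colinear_def tensor_right_def al_eq_iff cmp_sel)
  have "left_colinear ?e (lact V) (lact Q)" "right_colinear ?e (ract V) (ract Q)"
    using left_colinear_cmp[OF coaction_colinear(1)[OF b], of "ident \<C> \<boxtimes> ract V"] cofree_colinear[of "ract V"]
      right_colinear_cmp[OF coaction_colinear(2)[OF b] tensor_right_colinear[OF _ rc bV(2) r]] by (auto simp: Q)
  then have e: "mor ?e \<in> Mor bicom V Q"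
    using mor_in_bicom[OF V Q(1)] by simp
  let ?R = "lu ?V \<bullet> (\<epsilon> \<boxtimes> (ru ?V \<bullet> (ident ?V \<boxtimes> \<epsilon>)))"
  have "?R \<bullet> ?e = lu ?V \<bullet> (\<epsilon> \<boxtimes> (ru ?V \<bullet> (ident ?V \<boxtimes> \<epsilon>) \<bullet> ract V)) \<bullet> lact V"
    by (simp add: interchange_tail cmp_sel)
  also have "\<dots> = ident ?V"
    using rV(5) lV(5) by simp
  finally have "has_retraction M ?V (bobj Q) (mor ?e)"
    using mor_in[of ?e] mor_in[of ?R] mor_cmp_eq[of ?R ?e "ident ?V"] unfolding has_retraction_def
    by (auto simp: Q cmp_sel)
  then show ?thesis
    using inj split_monoI[OF V Q(1) e] split_cokernel[OF V Q(1) e] by metis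
qed

lemma zero_bicomodule: "\<exists>Z\<in>Ob bicom. idm bicom Z = zero_mor bicom Z Z"
proof -
  obtain Z where Z [simp]: "Z \<in> Ob M" and "idm M Z = zero_mor M Z Z" using zero_object by blast
  then have iZ: "ident Z = zero_arrow Z Z" by (simp add: ident_def zero_arrow_def)
  have eq: "f = g" if "arr f" "arr g" "src f = Z" "src g = Z" "tgt f = tgt g" for f g
  proof -
    have "f \<bullet> ident Z = g \<bullet> ident Z"
      unfolding iZ using that by simp
    then show ?thesis using that by simp
  qed
  let ?l = "zero_arrow Z (\<C> \<otimes>\<^sub>o Z)" and ?r = "zero_arrow Z (Z \<otimes>\<^sub>o \<C>)"
  have "bicoaction ?l ?r"
    unfolding bicoaction_def left_coaction_def right_coaction_def
    by (intro conjI; (rule eq)?) (simp_all add: cmp_sel)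
  from bicomod_of[OF this] show ?thesis
    using \<open>idm M Z = zero_mor M Z Z\<close> by (intro bexI[of _ "bicomod_of ?l ?r"]) simp_all
qed

abbreviation square where "square \<equiv> bicomod_of (cofree \<C>) (tensor_right \<C> \<Delta>)"

lemma square:
  "bicoaction (cofree \<C>) (tensor_right \<C> \<Delta>)"
  "bicomodule M C square" "lact square = cofree \<C>" "ract square = tensor_right \<C> \<Delta>" "bobj square = \<C> \<otimes>\<^sub>o \<C>"
  "relative_injective bicom (split_mono M C) square"
  "comult C \<in> Mor bicom (regular_bicomodule C) square"
  "has_retraction M (bobj (regular_bicomodule C)) (bobj square) (comult C)"
proof -
  show b: "bicoaction (cofree \<C>) (tensor_right \<C> \<Delta>)"
    using bicoaction_cofree[OF regular_bicoaction(2)] by simp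
  note q = bicomod_of[OF b]
  show "bicomodule M C square" "lact square = cofree \<C>" "ract square = tensor_right \<C> \<Delta>" and o: "bobj square = \<C> \<otimes>\<^sub>o \<C>"
    using q by simp_all
  show "relative_injective bicom (split_mono M C) square"
    using cofree_relative_injective[OF regular_bicoaction(2) right_extension_comult] by simp
  have "mor \<Delta> \<in> Mor bicom (regular_bicomodule C) square"
    using coaction_colinear[OF regular_bicoaction(3)] q by (intro mor_in_bicom) (simp_all add: regular_bicomodule)
  then show "comult C \<in> Mor bicom (regular_bicomodule C) square" by simp
  let ?R = "lu \<C> \<bullet> (\<epsilon> \<boxtimes> ident \<C>)"
  have "?R \<bullet> \<Delta> = ident \<C>" using counit_left by simp
  then show "has_retraction M (bobj (regular_bicomodule C)) (bobj square) (comult C)"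
    using mor_in[of \<Delta>] mor_in[of ?R] mor_cmp_eq[of ?R \<Delta> "ident \<C>"] unfolding has_retraction_def o
    by (auto simp: regular_bicomodule cmp_sel)
qed

text \<open>Dimension shifting along \<open>\<Delta> : C \<rightarrow> C \<otimes> C\<close>, which
  has a relatively injective target and is retracted by the counit.\<close>

lemma Hochschild_vanishing_iff:
  assumes "is_cokernel bicom (regular_bicomodule C) square (comult C) J \<pi>"
  shows "(\<forall>V\<in>Ob bicom. trivial_group (Hochschild_cohomology M C 2 V)) \<longleftrightarrow> relative_injective bicom (split_mono M C) J"
proof -
  obtain Z where Z: "Z \<in> Ob bicom" "idm bicom Z = zero_mor bicom Z Z" using zero_bicomodule by blast
  show ?thesis
    unfolding Hochschild_cohomology_def
  proof (rule preadditive_category.trivial_Ext2_iff[OF preadditive_bicom _ Z _ _ square(6) _ assms])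
    show "split_mono M C (regular_bicomodule C) square (comult C)"
      using split_monoI[OF regular_bicomodule(1) square(2,7,8)] .
  qed (use regular_bicomodule enough_relative_injectives split_mono_Mor in auto)
qed

end

section \<open>Coderivations\<close>

context coalgebra_in
begin

definition coderivation where
  "coderivation z l r \<longleftrightarrow> arr z \<and> src z = src l \<and> tgt z = \<C> \<and>
     \<Delta> \<bullet> z = (ident \<C> \<boxtimes> z) \<bullet> l \<^bold>+ (z \<boxtimes> ident \<C>) \<bullet> r"

definition counit1 where "counit1 = lu \<C> \<bullet> (\<epsilon> \<boxtimes> ident \<C>)"
definition counit2 where "counit2 = ru \<C> \<bullet> (ident \<C> \<boxtimes> \<epsilon>)"

lemma counit_typing [simp]:
  "arr counit1" "src counit1 = \<C> \<otimes>\<^sub>o \<C>" "tgt counit1 = \<C>"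
  "arr counit2" "src counit2 = \<C> \<otimes>\<^sub>o \<C>" "tgt counit2 = \<C>"
  by (simp_all add: counit1_def counit2_def cmp_sel)

lemma counit_comult: "counit1 \<bullet> \<Delta> = ident \<C>" "counit2 \<bullet> \<Delta> = ident \<C>"
  using counit_left counit_right by (simp_all add: counit1_def counit2_def)

lemma counit1_al':
  "(counit1 \<boxtimes> ident \<C>) \<bullet> al' \<C> \<C> \<C> = lu (\<C> \<otimes>\<^sub>o \<C>) \<bullet> (\<epsilon> \<boxtimes> ident (\<C> \<otimes>\<^sub>o \<C>))"
proof -
  have "(counit1 \<boxtimes> ident \<C>) \<bullet> al' \<C> \<C> \<C> = (lu \<C> \<boxtimes> ident \<C>) \<bullet> ((\<epsilon> \<boxtimes> ident \<C>) \<boxtimes> ident \<C>) \<bullet> al' \<C> \<C> \<C>"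
    by (simp add: counit1_def interchange_tail)
  also have "\<dots> = (lu \<C> \<boxtimes> ident \<C>) \<bullet> al' \<I> \<C> \<C> \<bullet> (\<epsilon> \<boxtimes> (ident \<C> \<boxtimes> ident \<C>))"
    by (subst al_natural'(3)) simp_all
  finally show ?thesis
    using cmp_tail[OF unit_al'(1)[of \<C> \<C>]] by simp
qed

text \<open>On either side the counit is applied to the middle factor of
  \<open>\<C> \<otimes> (\<C> \<otimes> \<C>)\<close>; the triangle identifies the two ways of
  removing the resulting unit.\<close>

lemma counit2_al': "(counit2 \<boxtimes> ident \<C>) \<bullet> al' \<C> \<C> \<C> = ident \<C> \<boxtimes> counit1"
proof -
  have "(counit2 \<boxtimes> ident \<C>) \<bullet> al' \<C> \<C> \<C> = (ru \<C> \<boxtimes> ident \<C>) \<bullet> ((ident \<C> \<boxtimes> \<epsilon>) \<boxtimes> ident \<C>) \<bullet> al' \<C> \<C> \<C>"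
    by (simp add: counit2_def interchange_tail)
  also have "\<dots> = (ru \<C> \<boxtimes> ident \<C>) \<bullet> al' \<C> \<I> \<C> \<bullet> (ident \<C> \<boxtimes> (\<epsilon> \<boxtimes> ident \<C>))"
    by (subst al_natural'(3)) simp_all
  finally show ?thesis
    using cmp_tail[OF unit_al'(2)[of \<C> \<C>]] by (simp add: interchange counit1_def)
qed

lemma counit_cofree:
  "(ident \<C> \<boxtimes> counit1) \<bullet> cofree \<C> = ident (\<C> \<otimes>\<^sub>o \<C>)"
  "(ident \<C> \<boxtimes> counit2) \<bullet> cofree \<C> = \<Delta> \<bullet> counit2"
proof -
  show "(ident \<C> \<boxtimes> counit1) \<bullet> cofree \<C> = ident (\<C> \<otimes>\<^sub>o \<C>)"
    using cofree_counit[of \<C>] by (simp add: counit1_def)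
  have "(ident \<C> \<boxtimes> counit2) \<bullet> cofree \<C> = (ident \<C> \<boxtimes> ru \<C>) \<bullet> (ident \<C> \<boxtimes> (ident \<C> \<boxtimes> \<epsilon>)) \<bullet> al \<C> \<C> \<C> \<bullet> (\<Delta> \<boxtimes> ident \<C>)"
    by (simp add: counit2_def cofree_def interchange_tail)
  also have "\<dots> = (ident \<C> \<boxtimes> ru \<C>) \<bullet> al \<C> \<C> \<I> \<bullet> ((ident \<C> \<boxtimes> ident \<C>) \<boxtimes> \<epsilon>) \<bullet> (\<Delta> \<boxtimes> ident \<C>)"
    by (subst al_natural'(2)) simp_all
  also have "\<dots> = ru (\<C> \<otimes>\<^sub>o \<C>) \<bullet> (\<Delta> \<boxtimes> ident \<I>) \<bullet> (ident \<C> \<boxtimes> \<epsilon>)"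
    using cmp_tail[OF ru_tensor[of \<C> \<C>]] by (simp add: interchange)
  also have "\<dots> = \<Delta> \<bullet> counit2"
    using cmp_tail[OF ru_natural[of \<Delta>]] by (simp add: counit2_def)
  finally show "(ident \<C> \<boxtimes> counit2) \<bullet> cofree \<C> = \<Delta> \<bullet> counit2" .
qed

lemma counit_tensor_right:
  "(counit1 \<boxtimes> ident \<C>) \<bullet> tensor_right \<C> \<Delta> = \<Delta> \<bullet> counit1"
  "(counit2 \<boxtimes> ident \<C>) \<bullet> tensor_right \<C> \<Delta> = ident (\<C> \<otimes>\<^sub>o \<C>)"
proof -
  show "(counit1 \<boxtimes> ident \<C>) \<bullet> tensor_right \<C> \<Delta> = \<Delta> \<bullet> counit1"
    using tensor_right_counit[OF regular_bicoaction(2)] by (simp add: right_colinear_def counit1_def)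
  have "(counit2 \<boxtimes> ident \<C>) \<bullet> tensor_right \<C> \<Delta> = ((counit2 \<boxtimes> ident \<C>) \<bullet> al' \<C> \<C> \<C>) \<bullet> (ident \<C> \<boxtimes> \<Delta>)"
    by (simp add: tensor_right_def)
  also have "\<dots> = ident (\<C> \<otimes>\<^sub>o \<C>)"
    unfolding counit2_al' by (simp add: interchange counit_comult)
  finally show "(counit2 \<boxtimes> ident \<C>) \<bullet> tensor_right \<C> \<Delta> = ident (\<C> \<otimes>\<^sub>o \<C>)" .
qed

lemma counit_unit: "lu \<I> \<bullet> (\<epsilon> \<boxtimes> \<epsilon>) \<bullet> \<Delta> = \<epsilon>"
proof -
  have "lu \<I> \<bullet> (\<epsilon> \<boxtimes> \<epsilon>) \<bullet> \<Delta> = lu \<I> \<bullet> (ident \<I> \<boxtimes> \<epsilon>) \<bullet> (\<epsilon> \<boxtimes> ident \<C>) \<bullet> \<Delta>"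
    by (simp add: interchange_tail)
  also have "\<dots> = \<epsilon> \<bullet> counit1 \<bullet> \<Delta>"
    using cmp_tail[OF lu_natural[of \<epsilon>]] by (simp add: counit1_def)
  finally show ?thesis by (simp add: counit_comult)
qed

text \<open>No comparison of the two unitors of \<open>\<I>\<close> is needed: each summand is read off with its own.\<close>

lemma counit_coderivation:
  assumes "coderivation z l r" and b: "bicoaction l r"
  shows "\<epsilon> \<bullet> z = zero_arrow (src l) \<I>"
proof -
  note bb = bicoactionD[OF b] note ll = left_coactionD[OF bb(1)] and rr = right_coactionD[OF bb(2)]
  note [simp] = ll(1-3) rr(1-3) bb(3)
  have [simp]: "arr z" "src z = src l" "tgt z = \<C>"
    and z: "\<Delta> \<bullet> z = (ident \<C> \<boxtimes> z) \<bullet> l \<^bold>+ (z \<boxtimes> ident \<C>) \<bullet> r"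
    using assms(1) by (simp_all add: coderivation_def)
  let ?n = "\<epsilon> \<bullet> z"
  have n: "lu \<I> \<bullet> (\<epsilon> \<boxtimes> ?n) \<bullet> l = ?n"
  proof -
    have "lu \<I> \<bullet> (\<epsilon> \<boxtimes> ?n) \<bullet> l = lu \<I> \<bullet> (ident \<I> \<boxtimes> ?n) \<bullet> (\<epsilon> \<boxtimes> ident (src l)) \<bullet> l"
      by (simp add: interchange_tail cmp_sel)
    also have "\<dots> = ?n \<bullet> lu (src l) \<bullet> (\<epsilon> \<boxtimes> ident (src l)) \<bullet> l"
      using cmp_tail[OF lu_natural[of ?n]] by (simp add: cmp_sel)
    finally show ?thesis by (simp add: ll(5) cmp_sel)
  qed
  \<comment> \<open>Applying \<open>\<epsilon> \<boxtimes> \<epsilon>\<close> to the coderivation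
    identity yields in essence \<open>n = n + n\<close>, with the second summand still to be read
    off.\<close>
  have "(lu \<I> \<bullet> (\<epsilon> \<boxtimes> \<epsilon>) \<bullet> \<Delta>) \<bullet> z = ?n \<^bold>+ lu \<I> \<bullet> (?n \<boxtimes> \<epsilon>) \<bullet> r"
    using n by (simp add: z cmp_add_right interchange_tail)
  then have "?n = ?n \<^bold>+ lu \<I> \<bullet> (?n \<boxtimes> \<epsilon>) \<bullet> r"
    unfolding counit_unit by simp
  then have "lu \<I> \<bullet> (?n \<boxtimes> \<epsilon>) \<bullet> r = zero_arrow (src l) \<I>"
    by - (rule add_left_cancel[of ?n], auto simp: cmp_sel)
  then have "lu' \<I> \<bullet> lu \<I> \<bullet> (?n \<boxtimes> \<epsilon>) \<bullet> r = zero_arrow (src l) (\<I> \<otimes>\<^sub>o \<I>)"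
    by simp
  then have "ru \<I> \<bullet> (?n \<boxtimes> \<epsilon>) \<bullet> r = zero_arrow (src l) \<I>"
    by (simp add: cmp_sel)
  moreover have "ru \<I> \<bullet> (?n \<boxtimes> \<epsilon>) \<bullet> r = ru \<I> \<bullet> (?n \<boxtimes> ident \<I>) \<bullet> (ident (src l) \<boxtimes> \<epsilon>) \<bullet> r"
    by (simp add: interchange_tail cmp_sel)
  moreover have "\<dots> = ?n \<bullet> ru (src r) \<bullet> (ident (src r) \<boxtimes> \<epsilon>) \<bullet> r"
    using cmp_tail[OF ru_natural[of ?n]] by (simp add: cmp_sel)
  ultimately show ?thesis by (simp add: rr(5)[simplified] cmp_sel)
qed

end

text \<open>Bicomodule maps to \<open>J\<close> correspond to coderivations to \<open>C\<close>, with \<open>del : J \<rightarrow> C\<close> as the universal one.\<close>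

locale differentials = coalgebra_in M C for M (structure) and C +
  fixes J P
  assumes J: "bicomodule M C J" and P_cokernel: "cokernel_arrow (comul C) P"
    and P_left: "left_colinear P (cofree (cobj C)) (lact J)" and P_right: "right_colinear P (tensor_right (cobj C) (comul C)) (ract J)"
begin

notation cmp (infixr "\<bullet>" 75) and add_arrow (infixl "\<^bold>+" 65) and neg ("\<^bold>- _" [81] 80)
  and tensor (infixl "\<boxtimes>" 80)

abbreviation J_obj ("\<J>") where "\<J> \<equiv> bobj J"

lemma J_bicoaction: "bicoaction (lact J) (ract J)"
  "left_coaction (lact J)" "right_coaction (ract J)"
  using J bicoactionD[of "lact J" "ract J"] by auto

lemmas J_typing [simp] = bicomodule_act(1-9)[OF J]

lemma P_typing [simp]: "arr P" "src P = \<C> \<otimes>\<^sub>o \<C>" "tgt P = \<J>"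
  using P_left by (simp_all add: left_colinear_def)

lemma P_epi: "epi_arrow P" and P_comult: "P \<bullet> \<Delta> = zero_arrow \<C> \<J>"
  using cokernel_arrowD[OF P_cokernel] by simp_all

lemma P_coaction: "lact J \<bullet> P = (ident \<C> \<boxtimes> P) \<bullet> cofree \<C>" "ract J \<bullet> P = (P \<boxtimes> ident \<C>) \<bullet> tensor_right \<C> \<Delta>"
  using P_left P_right by (simp_all add: left_colinear_def right_colinear_def)

text \<open>The two counits \<open>counit1\<close> and \<open>counit2\<close> both retract
  \<open>\<Delta>\<close>, so their difference kills \<open>\<Delta>\<close> and descends to
  \<open>J\<close>.\<close>

definition del where
  "del = (SOME d. arr d \<and> src d = \<J> \<and> tgt d = \<C> \<and> d \<bullet> P = counit1 \<^bold>+ \<^bold>- counit2)"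

lemma del: "arr del" "src del = \<J>" "tgt del = \<C>" and del_P: "del \<bullet> P \<^bold>+ counit2 = counit1"
proof -
  have "(counit1 \<^bold>+ \<^bold>- counit2) \<bullet> \<Delta> = zero_arrow \<C> \<C>"
    by (simp add: cmp_add_left neg_cmp counit_comult add_neg)
  then have "\<exists>d. arr d \<and> src d = \<J> \<and> tgt d = \<C> \<and> d \<bullet> P = counit1 \<^bold>+ \<^bold>- counit2"
    using cokernel_factor[OF P_cokernel, of "counit1 \<^bold>+ \<^bold>- counit2"] by (auto simp: add_sel)
  then have "arr del \<and> src del = \<J> \<and> tgt del = \<C> \<and> del \<bullet> P = counit1 \<^bold>+ \<^bold>- counit2"
    unfolding del_def by (rule someI_ex)
  then show "arr del" "src del = \<J>" "tgt del = \<C>" "del \<bullet> P \<^bold>+ counit2 = counit1"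
    using add_commute[of "\<^bold>- counit2" counit2] by (simp_all add: add_assoc add_neg)
qed

lemmas del_typing [simp] = del

text \<open>Tested on the epimorphism \<open>P\<close>, the left coaction contributes
  \<open>1 - \<Delta> counit2\<close> and the right one \<open>\<Delta> counit1 - 1\<close>. They
  add up to \<open>\<Delta> (counit1 - counit2)\<close>.\<close>

lemma del_coderivation: "coderivation del (lact J) (ract J)"
proof -
  have tr [simp]: "arr (tensor_right \<C> \<Delta>)" "src (tensor_right \<C> \<Delta>) = \<C> \<otimes>\<^sub>o \<C>" "tgt (tensor_right \<C> \<Delta>) = (\<C> \<otimes>\<^sub>o \<C>) \<otimes>\<^sub>o \<C>"
    by (simp_all add: tensor_right_typing regular_bicoaction)
  let ?x = "(ident \<C> \<boxtimes> (del \<bullet> P)) \<bullet> cofree \<C>" and ?y = "((del \<bullet> P) \<boxtimes> ident \<C>) \<bullet> tensor_right \<C> \<Delta>"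
  have x: "?x \<^bold>+ \<Delta> \<bullet> counit2 = ident (\<C> \<otimes>\<^sub>o \<C>)"
    using counit_cofree by (simp add: tensor_add_right cmp_add_left cmp_sel flip: del_P)
  have y: "?y \<^bold>+ ident (\<C> \<otimes>\<^sub>o \<C>) = \<Delta> \<bullet> counit1"
    using counit_tensor_right by (simp add: tensor_add_left cmp_add_left cmp_sel flip: del_P)
  have "(\<Delta> \<bullet> del \<bullet> P) \<^bold>+ (\<Delta> \<bullet> counit2 \<^bold>+ ident (\<C> \<otimes>\<^sub>o \<C>)) = \<Delta> \<bullet> (del \<bullet> P \<^bold>+ counit2) \<^bold>+ ident (\<C> \<otimes>\<^sub>o \<C>)"
    by (simp add: cmp_add_right add_assoc)
  also have "\<dots> = (?y \<^bold>+ ident (\<C> \<otimes>\<^sub>o \<C>)) \<^bold>+ (?x \<^bold>+ \<Delta> \<bullet> counit2)"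
    unfolding del_P x y ..
  also have "\<dots> = (?x \<^bold>+ ?y) \<^bold>+ (\<Delta> \<bullet> counit2 \<^bold>+ ident (\<C> \<otimes>\<^sub>o \<C>))"
    by (simp only: add_ac)
  finally have "\<Delta> \<bullet> del \<bullet> P = ?x \<^bold>+ ?y"
    by (rule add_right_cancel) (simp add: cmp_sel add_sel)
  then have "(\<Delta> \<bullet> del) \<bullet> P = ((ident \<C> \<boxtimes> del) \<bullet> lact J \<^bold>+ (del \<boxtimes> ident \<C>) \<bullet> ract J) \<bullet> P"
    by (simp add: cmp_add_left P_coaction interchange_tail)
  then have "\<Delta> \<bullet> del = (ident \<C> \<boxtimes> del) \<bullet> lact J \<^bold>+ (del \<boxtimes> ident \<C>) \<bullet> ract J"
    by - (rule epi_arrowD[OF P_epi], auto simp: cmp_sel add_sel)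
  then show ?thesis by (simp add: coderivation_def)
qed

text \<open>On \<open>P\<close> the composite becomes \<open>P (1 - \<Delta> counit2)\<close>, which
  is \<open>P\<close> because \<open>P \<Delta> = 0\<close>. It follows that a bicomodule map
  \<open>u\<close> is recovered from the coderivation \<open>z = del \<bullet> u\<close> as
  \<open>P \<bullet> (ident \<C> \<boxtimes> z) \<bullet> l\<close>.\<close>

lemma del_universal: "P \<bullet> (ident \<C> \<boxtimes> del) \<bullet> lact J = ident \<J>"
proof -
  have "(ident \<C> \<boxtimes> (del \<bullet> P)) \<bullet> cofree \<C> \<^bold>+ \<Delta> \<bullet> counit2 = ident (\<C> \<otimes>\<^sub>o \<C>)"
    using counit_cofree by (simp add: tensor_add_right cmp_add_left cmp_sel flip: del_P)
  then have "P \<bullet> ((ident \<C> \<boxtimes> (del \<bullet> P)) \<bullet> cofree \<C> \<^bold>+ \<Delta> \<bullet> counit2) = P"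
    by simp
  then have "(P \<bullet> (ident \<C> \<boxtimes> del) \<bullet> lact J) \<bullet> P = ident \<J> \<bullet> P"
    using cmp_tail[OF P_comult, of counit2] by (simp add: cmp_add_right P_coaction interchange_tail cmp_sel)
  then show ?thesis
    by - (rule epi_arrowD[OF P_epi], auto simp: cmp_sel)
qed

text \<open>Left colinearity is built into the formula. For right colinearity,
  \<open>P \<Delta> z = 0\<close> rewrites the same arrow as the negative of
  \<open>P \<bullet> (z \<boxtimes> ident \<C>) \<bullet> r\<close>.\<close>

lemma coderivation_induced:
  assumes z: "coderivation z l r" and b: "bicoaction l r"
  shows "left_colinear (P \<bullet> (ident \<C> \<boxtimes> z) \<bullet> l) l (lact J)" "right_colinear (P \<bullet> (ident \<C> \<boxtimes> z) \<bullet> l) r (ract J)"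
proof -
  note bb = bicoactionD[OF b] note ll = left_coactionD[OF bb(1)] and rr = right_coactionD[OF bb(2)]
  note [simp] = ll(1-3) rr(1-3) bb(3)
  have [simp]: "arr z" "src z = src l" "tgt z = \<C>"
    and zz: "\<Delta> \<bullet> z = (ident \<C> \<boxtimes> z) \<bullet> l \<^bold>+ (z \<boxtimes> ident \<C>) \<bullet> r"
    using z by (simp_all add: coderivation_def)
  show "left_colinear (P \<bullet> (ident \<C> \<boxtimes> z) \<bullet> l) l (lact J)"
    using left_colinear_cmp[OF left_colinear_cmp[OF coaction_colinear(1)[OF b], of "ident \<C> \<boxtimes> z"] P_left]
      cofree_colinear[of z] by simp
  have y: "right_colinear (P \<bullet> (z \<boxtimes> ident \<C>) \<bullet> r) r (ract J)"
    using right_colinear_cmp[OF right_colinear_convolution[OF bb(2), of z] ] P_right by simp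
  have "P \<bullet> (z \<boxtimes> ident \<C>) \<bullet> r \<^bold>+ P \<bullet> (ident \<C> \<boxtimes> z) \<bullet> l = P \<bullet> \<Delta> \<bullet> z"
    by (simp add: zz cmp_add_right add_commute)
  also have "\<dots> = zero_arrow (src l) \<J>"
    using cmp_tail[OF P_comult, of z] by simp
  finally have "P \<bullet> (ident \<C> \<boxtimes> z) \<bullet> l = \<^bold>- (P \<bullet> (z \<boxtimes> ident \<C>) \<bullet> r)"
    by (rule neg_unique) simp_all
  then show "right_colinear (P \<bullet> (ident \<C> \<boxtimes> z) \<bullet> l) r (ract J)"
    using neg_colinear(2)[OF bb(2) J_bicoaction(3) y] by simp
qed

lemma coderivation_cmp:
  assumes u: "left_colinear u l (lact J)" "right_colinear u r (ract J)" and b: "bicoaction l r"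
  shows "coderivation (del \<bullet> u) l r"
proof -
  note bb = bicoactionD[OF b] note ll = left_coactionD[OF bb(1)] and rr = right_coactionD[OF bb(2)]
  note [simp] = ll(1-3) rr(1-3) bb(3)
  have [simp]: "arr u" "src u = src l" "tgt u = \<J>" and uc: "(ident \<C> \<boxtimes> u) \<bullet> l = lact J \<bullet> u" "(u \<boxtimes> ident \<C>) \<bullet> r = ract J \<bullet> u"
    using u by (simp_all add: left_colinear_def right_colinear_def)
  have "\<Delta> \<bullet> del = (ident \<C> \<boxtimes> del) \<bullet> lact J \<^bold>+ (del \<boxtimes> ident \<C>) \<bullet> ract J"
    using del_coderivation by (simp add: coderivation_def)
  from cmp_tail[OF this, of u]
  have "\<Delta> \<bullet> del \<bullet> u = (ident \<C> \<boxtimes> del) \<bullet> (ident \<C> \<boxtimes> u) \<bullet> l \<^bold>+ (del \<boxtimes> ident \<C>) \<bullet> (u \<boxtimes> ident \<C>) \<bullet> r"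
    unfolding uc by (simp add: cmp_add_left)
  then show ?thesis
    by (simp add: coderivation_def interchange_tail cmp_sel)
qed

lemma relative_injective_if_coderivations_extend:
  assumes ext: "\<And>V W j z. bicomodule M C V \<Longrightarrow> bicomodule M C W \<Longrightarrow> j \<in> Mor bicom V W \<Longrightarrow>
      has_retraction M (bobj V) (bobj W) j \<Longrightarrow> coderivation z (lact V) (ract V) \<Longrightarrow>
      \<exists>z'. coderivation z' (lact W) (ract W) \<and> z' \<bullet> arrow_of (bobj V) j (bobj W) = z"
  shows "relative_injective bicom (split_mono M C) J"
proof (rule preadditive_category.relative_injectiveI[OF preadditive_bicom])
  show "J \<in> Ob bicom" using J by simp
  show "j \<in> Mor bicom V W" if "split_mono M C V W j" for V W j
    using that by (rule split_mono_Mor)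
  fix V W j h assume "V \<in> Ob bicom" "W \<in> Ob bicom" and sm: "split_mono M C V W j" and h: "h \<in> Mor bicom V J"
  then have V: "bicomodule M C V" and W: "bicomodule M C W" by auto
  note [simp] = bicomodule_act(1-9)[OF V] bicomodule_act(1-9)[OF W]
  obtain j' where j'_def: "j' = arrow_of (bobj V) j (bobj W)" and j' [simp]: "arr j'" "src j' = bobj V" "tgt j' = bobj W" "mor j' = j"
    and jc: "left_colinear j' (lact V) (lact W)" "right_colinear j' (ract V) (ract W)"
    using split_mono_Mor[OF sm] V W by (rule Mor_bicomE)
  obtain u where "u = arrow_of (bobj V) h \<J>" and u [simp]: "arr u" "src u = bobj V" "tgt u = \<J>" "mor u = h"
    and uc: "left_colinear u (lact V) (lact J)" "right_colinear u (ract V) (ract J)"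
    using h V J by (rule Mor_bicomE)
  obtain z where z: "coderivation z (lact W) (ract W)" and zj: "z \<bullet> j' = del \<bullet> u"
    using ext[OF V W split_mono_Mor[OF sm] _ coderivation_cmp[OF uc bicomodule_act(10)[OF V]]] sm
    unfolding j'_def split_mono_def by blast
  have [simp]: "arr z" "src z = bobj W" "tgt z = \<C>"
    using z by (simp_all add: coderivation_def)
  have jl: "lact W \<bullet> j' = (ident \<C> \<boxtimes> j') \<bullet> lact V" and ul: "(ident \<C> \<boxtimes> u) \<bullet> lact V = lact J \<bullet> u"
    using jc(1) uc(1) by (simp_all add: left_colinear_def)
  \<comment> \<open>This is the bicomodule map corresponding to the extended coderivation
    \<open>z\<close>; by \<open>del_universal\<close> it restricts to \<open>u\<close>.\<close>
  let ?g = "P \<bullet> (ident \<C> \<boxtimes> z) \<bullet> lact W"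
  have g: "mor ?g \<in> Mor bicom W J"
    using coderivation_induced[OF z bicomodule_act(10)[OF W]] by (intro mor_in_bicom W J)
  have "?g \<bullet> j' = P \<bullet> (ident \<C> \<boxtimes> del) \<bullet> (ident \<C> \<boxtimes> u) \<bullet> lact V"
    by (simp add: jl interchange_tail zj)
  also have "\<dots> = (P \<bullet> (ident \<C> \<boxtimes> del) \<bullet> lact J) \<bullet> u"
    unfolding ul by simp
  also have "\<dots> = u"
    unfolding del_universal by simp
  finally have "mor ?g \<cdot> j = h"
    using mor_cmp_eq[of ?g j' u] by (simp add: cmp_sel)
  with g show "\<exists>g\<in>Mor bicom W J. comp bicom g j = h" by auto
qed

end

text \<open>As \<open>\<Delta>\<close> splits in \<open>M\<close>, one object is its cokernel both
  in \<open>M\<close> and among bicomodules: the former yields the factorizations of ordinary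
  arrows, the latter the dimension shift.\<close>

lemma (in coalgebra_in) differentials_exist:
  obtains J P where "differentials M C J P" "is_cokernel bicom (regular_bicomodule C) square (comult C) J (mor P)"
proof -
  obtain J \<pi> where J: "bicomodule M C J" "is_cokernel bicom (regular_bicomodule C) square (comult C) J \<pi>"
    "\<pi> \<in> Mor bicom square J" "cokernel_arrow \<Delta> (arrow_of (\<C> \<otimes>\<^sub>o \<C>) \<pi> (bobj J))"
    using split_cokernel[OF regular_bicomodule(1) square(2,7,8)]
    unfolding square(5) regular_bicomodule(4) comul_def[symmetric] by metis
  obtain P where P: "P = arrow_of (\<C> \<otimes>\<^sub>o \<C>) \<pi> (bobj J)" "mor P = \<pi>" "left_colinear P (cofree \<C>) (lact J)"
     "right_colinear P (tensor_right \<C> \<Delta>) (ract J)"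
    using J(3) square(2) J(1) by (rule Mor_bicomE) (simp add: square)
  have "differentials M C J P"
    using J(1,4) P by unfold_locales simp_all
  then show ?thesis
    using that J(2) P(2) by simp
qed

section \<open>Trivial extensions\<close>

text \<open>The coalgebra structure on the biproduct \<open>X\<close> of \<open>C\<close> and a bicomodule in which the bicomodule
  part of the comultiplication consists of the two coactions only.\<close>

locale trivial_extension = coalgebra_in M C for M (structure) and C +
  fixes l r X i1 i2 p1 p2
  assumes bico: "bicoaction l r"
    and i1 [simp]: "arr i1" "src i1 = cobj C" "tgt i1 = X"
    and i2 [simp]: "arr i2" "src i2 = src l" "tgt i2 = X"
    and p1 [simp]: "arr p1" "src p1 = X" "tgt p1 = cobj C"
    and p2 [simp]: "arr p2" "src p2 = X" "tgt p2 = src l"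
    and pi [simp]: "cmp p1 i1 = ident (cobj C)" "cmp p2 i2 = ident (src l)"
      "cmp p2 i1 = zero_arrow (cobj C) (src l)" "cmp p1 i2 = zero_arrow (src l) (cobj C)"
    and ip: "add_arrow (cmp i1 p1) (cmp i2 p2) = ident X"
begin

notation cmp (infixr "\<bullet>" 75) and add_arrow (infixl "\<^bold>+" 65) and neg ("\<^bold>- _" [81] 80)
  and tensor (infixl "\<boxtimes>" 80)

lemma l_r_typing [simp]: "arr l" "src l \<in> Ob M" "tgt l = \<C> \<otimes>\<^sub>o src l" "arr r" "src r = src l" "tgt r = src l \<otimes>\<^sub>o \<C>"
  using bicoactionD[OF bico] left_coactionD[of l] right_coactionD[of r] by auto

lemma X_Ob [simp]: "X \<in> Ob M"
  using arr_Ob(2)[OF i1(1)] by simp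

lemma pi_tail [simp]:
  "arr x \<Longrightarrow> tgt x = \<C> \<Longrightarrow> p1 \<bullet> i1 \<bullet> x = x"
  "arr x \<Longrightarrow> tgt x = src l \<Longrightarrow> p2 \<bullet> i2 \<bullet> x = x"
  "arr x \<Longrightarrow> tgt x = \<C> \<Longrightarrow> p2 \<bullet> i1 \<bullet> x = zero_arrow (src x) (src l)"
  "arr x \<Longrightarrow> tgt x = src l \<Longrightarrow> p1 \<bullet> i2 \<bullet> x = zero_arrow (src x) \<C>"
  using cmp_tail[OF pi(1), of x] cmp_tail[OF pi(2), of x] cmp_tail[OF pi(3), of x] cmp_tail[OF pi(4), of x]
  by simp_all

lemma joint_epi:
  assumes "arr f" "arr g" "src f = X" "src g = X" "f \<bullet> i1 = g \<bullet> i1" "f \<bullet> i2 = g \<bullet> i2"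
  shows "f = g"
proof -
  have "f \<bullet> (i1 \<bullet> p1 \<^bold>+ i2 \<bullet> p2) = g \<bullet> (i1 \<bullet> p1 \<^bold>+ i2 \<bullet> p2)"
    using cmp_tail[OF assms(5), of p1] cmp_tail[OF assms(6), of p2] by (simp add: cmp_add_right)
  then show ?thesis
    unfolding ip using assms by simp
qed

definition d where "d = (i1 \<boxtimes> i1) \<bullet> \<Delta> \<bullet> p1 \<^bold>+ ((i1 \<boxtimes> i2) \<bullet> l \<^bold>+ (i2 \<boxtimes> i1) \<bullet> r) \<bullet> p2"
definition e where "e = \<epsilon> \<bullet> p1"
definition ext where "ext = \<lparr>cobj = X, comult = mor d, counit = mor e\<rparr>"

lemma d_e_typing [simp]: "arr d" "src d = X" "tgt d = X \<otimes>\<^sub>o X" "arr e" "src e = X" "tgt e = \<I>"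
  by (simp_all add: d_def e_def cmp_sel add_sel)

lemma d_i: "d \<bullet> i1 = (i1 \<boxtimes> i1) \<bullet> \<Delta>" "d \<bullet> i2 = (i1 \<boxtimes> i2) \<bullet> l \<^bold>+ (i2 \<boxtimes> i1) \<bullet> r"
  by (simp_all add: d_def cmp_add_left cmp_sel add_sel)

lemma e_i: "e \<bullet> i1 = \<epsilon>" "e \<bullet> i2 = zero_arrow (src l) \<I>"
  by (simp_all add: e_def)

lemma ext_sel [simp]: "cobj ext = X" "comul ext = d" "coun ext = e"
  using arrow_of_collapse[of d] arrow_of_collapse[of e]
  by (simp_all add: ext_def comul_def coun_def)

text \<open>On the summand \<open>\<C>\<close> this is coassociativity of \<open>C\<close>. On the
  bicomodule summand three terms arise, matched by the left coaction law, the compatibility of the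
  coactions and the right coaction law.\<close>

lemma ext_coassoc: "al X X X \<bullet> (d \<boxtimes> ident X) \<bullet> d = (ident X \<boxtimes> d) \<bullet> d"
proof (rule joint_epi)
  note b = bicoactionD[OF bico]
  note ll = left_coactionD(4)[OF b(1)] and rr = right_coactionD(4)[OF b(2), simplified]
  show "(al X X X \<bullet> (d \<boxtimes> ident X) \<bullet> d) \<bullet> i1 = ((ident X \<boxtimes> d) \<bullet> d) \<bullet> i1"
    using convolution_assoc[OF coassoc, of i1 i1 i1] by (simp add: d_i interchange_tail)
  have "(al X X X \<bullet> (d \<boxtimes> ident X) \<bullet> d) \<bullet> i2 =
      al X X X \<bullet> (((i1 \<boxtimes> i1) \<bullet> \<Delta>) \<boxtimes> i2) \<bullet> l \<^bold>+
      (al X X X \<bullet> (((i1 \<boxtimes> i2) \<bullet> l) \<boxtimes> i1) \<bullet> r \<^bold>+ al X X X \<bullet> (((i2 \<boxtimes> i1) \<bullet> r) \<boxtimes> i1) \<bullet> r)"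
    by (simp add: d_i cmp_add_right cmp_add_left interchange_tail tensor_add_left cmp_sel)
  also have "\<dots> = (i1 \<boxtimes> ((i1 \<boxtimes> i2) \<bullet> l)) \<bullet> l \<^bold>+ ((i1 \<boxtimes> ((i2 \<boxtimes> i1) \<bullet> r)) \<bullet> l \<^bold>+ (i2 \<boxtimes> ((i1 \<boxtimes> i1) \<bullet> \<Delta>)) \<bullet> r)"
    using convolution_assoc[OF ll, of i1 i1 i2] convolution_assoc[OF b(4), of i1 i2 i1]
      convolution_assoc[OF rr, of i2 i1 i1] by simp
  also have "\<dots> = ((ident X \<boxtimes> d) \<bullet> d) \<bullet> i2"
    by (simp add: d_i cmp_add_right cmp_add_left interchange_tail tensor_add_right cmp_sel add_assoc)
  finally show "(al X X X \<bullet> (d \<boxtimes> ident X) \<bullet> d) \<bullet> i2 = ((ident X \<boxtimes> d) \<bullet> d) \<bullet> i2" .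
qed (simp_all add: cmp_sel)

lemma ext_counit: "lu X \<bullet> (e \<boxtimes> ident X) \<bullet> d = ident X" "ru X \<bullet> (ident X \<boxtimes> e) \<bullet> d = ident X"
proof -
  note b = bicoactionD[OF bico]
  note ll = left_coactionD(5)[OF b(1)] and rr = right_coactionD(5)[OF b(2), simplified]
  have L: "lu X \<bullet> (\<epsilon> \<boxtimes> f) \<bullet> h = f \<bullet> lu (src f) \<bullet> (\<epsilon> \<boxtimes> ident (src f)) \<bullet> h" if "arr f" "tgt f = X" for f h
  proof -
    have "(\<epsilon> \<boxtimes> f) \<bullet> h = (ident \<I> \<boxtimes> f) \<bullet> (\<epsilon> \<boxtimes> ident (src f)) \<bullet> h"
      using that arr_Ob[of f] by (simp add: interchange_tail)
    then show ?thesis using cmp_tail[OF lu_natural[of f]] that by simp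
  qed
  have R: "ru X \<bullet> (f \<boxtimes> \<epsilon>) \<bullet> h = f \<bullet> ru (src f) \<bullet> (ident (src f) \<boxtimes> \<epsilon>) \<bullet> h" if "arr f" "tgt f = X" for f h
  proof -
    have "(f \<boxtimes> \<epsilon>) \<bullet> h = (f \<boxtimes> ident \<I>) \<bullet> (ident (src f) \<boxtimes> \<epsilon>) \<bullet> h"
      using that arr_Ob[of f] by (simp add: interchange_tail)
    then show ?thesis using cmp_tail[OF ru_natural[of f]] that by simp
  qed
  show "lu X \<bullet> (e \<boxtimes> ident X) \<bullet> d = ident X"
    by (rule joint_epi) (simp_all add: d_i e_i cmp_add_right interchange_tail L counit_left ll cmp_sel)
  show "ru X \<bullet> (ident X \<boxtimes> e) \<bullet> d = ident X"
    by (rule joint_epi) (simp_all add: d_i e_i cmp_add_right interchange_tail R counit_right rr cmp_sel)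
qed

lemma ext_coalgebra: "coalgebra M ext"
  using ext_coassoc ext_counit mor_in[of d] mor_in[of e]
  by (simp add: coalgebra_iff) (simp add: ext_def)

text \<open>On the bicomodule summand, comultiplicativity of \<open>(1, z)\<close> is the
  coderivation identity and preservation of the counit is
  \<open>counit_coderivation\<close>.\<close>

lemma coderivation_hom:
  assumes z: "coderivation z l r"
  shows "mor (p1 \<^bold>+ z \<bullet> p2) \<in> coalgebra_hom M ext C"
proof -
  have [simp]: "arr z" "src z = src l" "tgt z = \<C>"
    and zz: "\<Delta> \<bullet> z = (ident \<C> \<boxtimes> z) \<bullet> l \<^bold>+ (z \<boxtimes> ident \<C>) \<bullet> r"
    using z by (simp_all add: coderivation_def)
  define F where "F = p1 \<^bold>+ z \<bullet> p2"
  have F [simp]: "arr F" "src F = X" "tgt F = \<C>" by (simp_all add: F_def cmp_sel add_sel)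
  have Fi: "F \<bullet> i1 = ident \<C>" "F \<bullet> i2 = z" by (simp_all add: F_def cmp_add_left cmp_sel)
  have "(F \<boxtimes> F) \<bullet> d = \<Delta> \<bullet> F"
    by (rule joint_epi) (simp_all add: d_i Fi zz cmp_add_right interchange_tail cmp_sel)
  moreover have "\<epsilon> \<bullet> F = e"
    by (rule joint_epi) (simp_all add: Fi e_i counit_coderivation[OF z bico] cmp_sel)
  ultimately show ?thesis
    using arrow_of_collapse[OF F(1)] mor_in[OF F(1)]
    by (simp add: coalgebra_hom_iff[OF ext_coalgebra coalgebra] flip: F_def)
qed

lemma hom_coderivation:
  assumes G: "arr G" "src G = X" "tgt G = \<C>" "(G \<boxtimes> G) \<bullet> d = \<Delta> \<bullet> G" and "G \<bullet> i1 = ident \<C>"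
  shows "coderivation (G \<bullet> i2) l r"
proof -
  have "\<Delta> \<bullet> G \<bullet> i2 = (G \<boxtimes> G) \<bullet> d \<bullet> i2"
    using cmp_tail[OF G(4)] by simp
  then show ?thesis
    using assms by (simp add: d_i cmp_add_right interchange_tail coderivation_def cmp_sel)
qed

end

context coalgebra_in
begin

lemma trivial_extension_exists:
  assumes b: "bicoaction l r"
  obtains X i1 i2 p1 p2 where "trivial_extension M C l r X i1 i2 p1 p2"
proof -
  have [simp]: "src l \<in> Ob M" using bicoactionD(1)[OF b] left_coactionD(3) by blast
  obtain X where "is_biproduct M \<C> (src l) X"
    using biproduct_ex[of \<C> "src l"] by auto
  then obtain i j p q where X: "X \<in> Ob M" and t: "i \<in> Mor M \<C> X" "j \<in> Mor M (src l) X" "p \<in> Mor M X \<C>" "q \<in> Mor M X (src l)"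
    and e: "p \<cdot> i = idm M \<C>" "q \<cdot> j = idm M (src l)" "q \<cdot> i = zero_mor M \<C> (src l)" "p \<cdot> j = zero_mor M (src l) \<C>"
      "(i \<cdot> p) \<boxplus> (j \<cdot> q) = idm M X"
    unfolding is_biproduct_def by blast
  have "trivial_extension M C l r X (arrow_of \<C> i X) (arrow_of (src l) j X) (arrow_of X p \<C>) (arrow_of X q (src l))"
    using X t e b
    by unfold_locales (simp_all add: arr_arrow_of arrow_of_sel arrow_eq_iff cmp_sel add_sel)
  then show ?thesis using that by blast
qed

lemma coderivations_extend:
  assumes lift: "\<And>D E i f. coalgebra M D \<Longrightarrow> coalgebra M E \<Longrightarrow> i \<in> coalgebra_hom M D E \<Longrightarrow>
      has_retraction M (cobj D) (cobj E) i \<Longrightarrow> wedge_square_total M D E i \<Longrightarrow> f \<in> coalgebra_hom M D C \<Longrightarrow>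
      \<exists>g\<in>coalgebra_hom M E C. g \<cdot> i = f"
    and V: "bicomodule M C V" and W: "bicomodule M C W" and j: "j \<in> Mor bicom V W"
    and ret: "has_retraction M (bobj V) (bobj W) j" and z: "coderivation z (lact V) (ract V)"
  shows "\<exists>z'. coderivation z' (lact W) (ract W) \<and> z' \<bullet> arrow_of (bobj V) j (bobj W) = z"
proof -
  note [simp] = bicomodule_act(1-9)[OF V] bicomodule_act(1-9)[OF W]
  obtain j' where j'_def: "j' = arrow_of (bobj V) j (bobj W)" and j' [simp]: "arr j'" "src j' = bobj V" "tgt j' = bobj W" "mor j' = j"
    and jc: "left_colinear j' (lact V) (lact W)" "right_colinear j' (ract V) (ract W)"
    using j V W by (rule Mor_bicomE)
  have jl: "lact W \<bullet> j' = (ident \<C> \<boxtimes> j') \<bullet> lact V" and jr: "ract W \<bullet> j' = (j' \<boxtimes> ident \<C>) \<bullet> ract V"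
    using jc by (simp_all add: left_colinear_def right_colinear_def)
  obtain \<rho> where \<rho> [simp]: "arr \<rho>" "src \<rho> = bobj W" "tgt \<rho> = bobj V" and \<rho>j: "\<rho> \<bullet> j' = ident (bobj V)"
    unfolding j'_def by (rule has_retraction_arrow[OF ret]) simp_all
  have [simp]: "arr z" "src z = bobj V" "tgt z = \<C>"
    using z by (simp_all add: coderivation_def)
  obtain X i1 i2 p1 p2 where "trivial_extension M C (lact V) (ract V) X i1 i2 p1 p2"
    by (rule trivial_extension_exists[OF bicomodule_act(10)[OF V]])
  then interpret D: trivial_extension M C "lact V" "ract V" X i1 i2 p1 p2 .
  obtain Y k1 k2 q1 q2 where "trivial_extension M C (lact W) (ract W) Y k1 k2 q1 q2"
    by (rule trivial_extension_exists[OF bicomodule_act(10)[OF W]])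
  then interpret E: trivial_extension M C "lact W" "ract W" Y k1 k2 q1 q2 .
  note [simp] = D.i1 D.i2 D.p1 D.p2 E.i1 E.i2 E.p1 E.p2
  \<comment> \<open>This is \<open>1 \<oplus> j'\<close>, a coalgebra homomorphism because
    \<open>j'\<close> is bicolinear. It is split in \<open>M\<close> by
    \<open>1 \<oplus> \<rho>\<close>.\<close>
  define I where "I = k1 \<bullet> p1 \<^bold>+ k2 \<bullet> j' \<bullet> p2"
  have I [simp]: "arr I" "src I = X" "tgt I = Y" by (simp_all add: I_def cmp_sel add_sel)
  have Ii: "I \<bullet> i1 = k1" "I \<bullet> i2 = k2 \<bullet> j'"
    by (simp_all add: I_def cmp_add_left cmp_sel)
  have Icomul: "(I \<boxtimes> I) \<bullet> D.d = E.d \<bullet> I"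
  proof (rule D.joint_epi)
    show "((I \<boxtimes> I) \<bullet> D.d) \<bullet> i1 = (E.d \<bullet> I) \<bullet> i1"
      by (simp add: D.d_i E.d_i Ii interchange_tail)
    show "((I \<boxtimes> I) \<bullet> D.d) \<bullet> i2 = (E.d \<bullet> I) \<bullet> i2"
      using cmp_tail[OF E.d_i(2), of j'] by (simp add: D.d_i Ii interchange_tail cmp_add_right cmp_add_left jl jr)
  qed (simp_all add: cmp_sel)
  have Icoun: "E.e \<bullet> I = D.e"
    using cmp_tail[OF E.e_i(2), of j'] by - (rule D.joint_epi, simp_all add: Ii E.e_i D.e_i cmp_sel)
  have Ihom: "mor I \<in> coalgebra_hom M D.ext E.ext"
    using Icomul Icoun arrow_of_collapse[OF I(1)] mor_in[OF I(1)]
    by (simp add: coalgebra_hom_iff[OF D.ext_coalgebra E.ext_coalgebra])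
  define R where "R = i1 \<bullet> q1 \<^bold>+ i2 \<bullet> \<rho> \<bullet> q2"
  have R [simp]: "arr R" "src R = Y" "tgt R = X" by (simp_all add: R_def cmp_sel add_sel)
  have RI: "R \<bullet> I = ident X"
    by (rule D.joint_epi) (simp_all add: Ii, simp_all add: R_def cmp_add_left cmp_sel add_sel \<rho>j)
  have Iret: "has_retraction M (cobj D.ext) (cobj E.ext) (mor I)"
    using mor_in[OF I(1)] mor_in[OF R(1)] mor_cmp_eq[OF RI] by (auto simp: has_retraction_def)
  \<comment> \<open>The cokernel of \<open>I\<close> kills the summand \<open>\<C>\<close>, and
    every term of \<open>E.d\<close> has a tensor factor \<open>k1\<close>. So the defining arrow of
    the wedge is zero, and the identity is its kernel.\<close>
  have wedge: "wedge_square_total M D.ext E.ext (mor I)"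
  proof -
    obtain L \<pi> where L: "is_cokernel M X Y (mor I) L \<pi>"
      using cokernel_ex[of X Y "mor I"] mor_in[OF I(1)] by auto
    then have [simp]: "L \<in> Ob M" and \<pi>: "\<pi> \<in> Mor M Y L" and z: "\<pi> \<cdot> mor I = zero_mor M X L"
      by (auto simp: is_cokernel_def)
    define P where "P = arrow_of Y \<pi> L"
    have P [simp]: "arr P" "src P = Y" "tgt P = L" "mor P = \<pi>"
      using \<pi> by (simp_all add: P_def arr_arrow_of arrow_of_sel)
    have "P \<bullet> I = zero_arrow X L"
      using z by (intro arrow_eqI) (simp_all add: cmp_sel)
    then have "P \<bullet> k1 = zero_arrow \<C> L"
      using cmp_tail[of P I "zero_arrow X L" i1] by (simp add: Ii)
    then have "(P \<boxtimes> P) \<bullet> E.d = zero_arrow Y (L \<otimes>\<^sub>o L)"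
      by - (rule E.joint_epi, simp_all add: E.d_i cmp_add_right interchange_tail cmp_sel)
    then have PP: "(\<pi> \<otimes>\<^sub>m \<pi>) \<cdot> comult E.ext = zero_mor M Y (L \<otimes>\<^sub>o L)"
      using mor_cmp_eq[of "P \<boxtimes> P" E.d "zero_arrow Y (L \<otimes>\<^sub>o L)"] by (simp add: E.ext_def)
    have zz: "zero_mor M Y (L \<otimes>\<^sub>o L) \<cdot> h = zero_mor M U (L \<otimes>\<^sub>o L)" if "U \<in> Ob M" "h \<in> Mor M U Y" for U h
      using mor_cmp_eq[of "zero_arrow Y (L \<otimes>\<^sub>o L)" "arrow_of U h Y"] that by (simp add: arr_arrow_of arrow_of_sel)
    have "is_kernel M Y (L \<otimes>\<^sub>o L) ((\<pi> \<otimes>\<^sub>m \<pi>) \<cdot> comult E.ext) Y (idm M Y)"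
      unfolding PP is_kernel_def using zz[of Y "idm M Y"] by (auto simp: idm_in zero_mor_in idm_left)
    then show ?thesis
      using L unfolding wedge_square_total_def is_wedge_square_def by auto
  qed
  have f: "mor (p1 \<^bold>+ z \<bullet> p2) \<in> coalgebra_hom M D.ext C"
    by (rule D.coderivation_hom[OF z])
  obtain g where g: "g \<in> coalgebra_hom M E.ext C" "g \<cdot> mor I = mor (p1 \<^bold>+ z \<bullet> p2)"
    using lift[OF D.ext_coalgebra E.ext_coalgebra Ihom Iret wedge f] by blast
  define G where "G = arrow_of Y g \<C>"
  have gM: "g \<in> Mor M Y \<C>" using g(1) by (simp add: coalgebra_hom_def)
  then have G [simp]: "arr G" "src G = Y" "tgt G = \<C>" "mor G = g"
    by (simp_all add: G_def arr_arrow_of arrow_of_sel)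
  have Gd: "(G \<boxtimes> G) \<bullet> E.d = \<Delta> \<bullet> G"
    using g(1) by (simp add: coalgebra_hom_iff[OF E.ext_coalgebra coalgebra] G_def)
  have GI: "G \<bullet> I = p1 \<^bold>+ z \<bullet> p2"
    using g(2) by (intro arrow_eqI) (simp_all add: cmp_sel add_sel)
  \<comment> \<open>Since \<open>k1 = I \<bullet> i1\<close>, the first component of
    \<open>G\<close> is prescribed by that of \<open>(1, z)\<close>; the second is then a
    coderivation.\<close>
  have "G \<bullet> k1 = ident \<C>"
    using cmp_tail[OF GI, of i1] by (simp add: Ii cmp_add_left cmp_sel)
  then have "coderivation (G \<bullet> k2) (lact W) (ract W)"
    by (intro E.hom_coderivation Gd) simp_all
  moreover have "(G \<bullet> k2) \<bullet> j' = z"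
    using cmp_tail[OF GI, of i2] by (simp add: Ii cmp_add_left cmp_sel)
  ultimately show ?thesis unfolding j'_def by blast
qed

end

section \<open>Lifting coalgebra homomorphisms\<close>

text \<open>The data of condition (b), in terms of arrows, with \<open>Q\<close> the cokernel of \<open>I\<close>, together with
  a bicolinear retraction \<open>s\<close> of the coaction \<open>J \<rightarrow> C \<otimes> J\<close>.\<close>

locale lifting = differentials M C J P for M (structure) and C J P +
  fixes D E I R Q F s
  assumes D: "coalgebra M D" and E: "coalgebra M E"
    and I [simp]: "arr I" "src I = cobj D" "tgt I = cobj E"
    and I_hom: "cmp (tensor I I) (comul D) = cmp (comul E) I" "cmp (coun E) I = coun D"
    and R [simp]: "arr R" "src R = cobj E" "tgt R = cobj D" "cmp R I = ident (cobj D)"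
    and Q: "cokernel_arrow I Q" and QQ: "cmp (tensor Q Q) (comul E) = zero_arrow (cobj E) (tens_ob M (tgt Q) (tgt Q))"
    and F [simp]: "arr F" "src F = cobj D" "tgt F = cobj C"
    and F_hom: "cmp (tensor F F) (comul D) = cmp (comul C) F" "cmp (coun C) F = coun D"
    and s_left: "left_colinear s (cofree (bobj J)) (lact J)"
    and s_right: "right_colinear s (tensor_right (cobj C) (ract J)) (ract J)"
    and s_retraction: "cmp s (lact J) = ident (bobj J)"
begin

notation cmp (infixr "\<bullet>" 75) and add_arrow (infixl "\<^bold>+" 65) and neg ("\<^bold>- _" [81] 80)
  and tensor (infixl "\<boxtimes>" 80)

abbreviation E_obj ("\<E>") where "\<E> \<equiv> cobj E"
abbreviation D_obj ("\<D>") where "\<D> \<equiv> cobj D"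

definition conv (infixl "\<star>" 78) where "a \<star> b = (a \<boxtimes> b) \<bullet> comul E"

lemma E_typing [simp]:
  "\<E> \<in> Ob M" "arr (comul E)" "src (comul E) = \<E>" "tgt (comul E) = \<E> \<otimes>\<^sub>o \<E>" "arr (coun E)" "src (coun E) = \<E>" "tgt (coun E) = \<I>"
  using E comul_typing[of E] coun_typing[of E] by (auto simp: coalgebra_iff)

lemma D_typing [simp]:
  "\<D> \<in> Ob M" "arr (comul D)" "src (comul D) = \<D>" "tgt (comul D) = \<D> \<otimes>\<^sub>o \<D>" "arr (coun D)" "src (coun D) = \<D>" "tgt (coun D) = \<I>"
  using D comul_typing[of D] coun_typing[of D] by (auto simp: coalgebra_iff)

lemma s_typing [simp]: "arr s" "src s = \<C> \<otimes>\<^sub>o \<J>" "tgt s = \<J>"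
  using s_left by (simp_all add: left_colinear_def)

lemma conv_typing [simp]:
  assumes "arr a" "arr b" "src a = \<E>" "src b = \<E>"
  shows "arr (a \<star> b)" "src (a \<star> b) = \<E>" "tgt (a \<star> b) = tgt a \<otimes>\<^sub>o tgt b"
  using assms by (simp_all add: conv_def cmp_sel)

lemma cmp_conv:
  assumes "arr a" "arr b" "arr p" "arr q" "tgt a = src p" "tgt b = src q"
  shows "(p \<boxtimes> q) \<bullet> (a \<star> b) = (p \<bullet> a) \<star> (q \<bullet> b)"
  using assms by (simp add: conv_def interchange_tail)

lemma conv_assoc:
  assumes "arr a" "arr b" "arr c" "src a = \<E>" "src b = \<E>" "src c = \<E>" "tgt a = X" "tgt b = Y" "tgt c = Z"
  shows "al X Y Z \<bullet> ((a \<star> b) \<star> c) = a \<star> (b \<star> c)"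
    and "al' X Y Z \<bullet> (a \<star> (b \<star> c)) = (a \<star> b) \<star> c"
proof -
  have "al \<E> \<E> \<E> \<bullet> (comul E \<boxtimes> ident \<E>) \<bullet> comul E = (ident \<E> \<boxtimes> comul E) \<bullet> comul E"
    using E by (simp add: coalgebra_iff)
  from convolution_assoc[OF this, of a b c]
  show *: "al X Y Z \<bullet> ((a \<star> b) \<star> c) = a \<star> (b \<star> c)"
    using assms by (simp add: conv_def)
  have [simp]: "X \<in> Ob M" "Y \<in> Ob M" "Z \<in> Ob M" using assms arr_Ob by auto
  show "al' X Y Z \<bullet> (a \<star> (b \<star> c)) = (a \<star> b) \<star> c"
    unfolding *[symmetric] using assms by simp
qed

lemma conv_add:
  assumes "arr a" "arr b" "arr c" "src a = \<E>" "src b = \<E>" "src c = \<E>" "tgt a = tgt b"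
  shows "(a \<^bold>+ b) \<star> c = a \<star> c \<^bold>+ b \<star> c" "c \<star> (a \<^bold>+ b) = c \<star> a \<^bold>+ c \<star> b"
  using assms by (simp_all add: conv_def tensor_add_left tensor_add_right cmp_add_left)

lemma conv_counit:
  assumes "arr a" "src a = \<E>"
  shows "lu (tgt a) \<bullet> (coun E \<star> a) = a" "ru (tgt a) \<bullet> (a \<star> coun E) = a"
proof -
  have e: "lu \<E> \<bullet> (coun E \<boxtimes> ident \<E>) \<bullet> comul E = ident \<E>" "ru \<E> \<bullet> (ident \<E> \<boxtimes> coun E) \<bullet> comul E = ident \<E>"
    using E by (simp_all add: coalgebra_iff)
  have "lu (tgt a) \<bullet> (coun E \<star> a) = lu (tgt a) \<bullet> (ident \<I> \<boxtimes> a) \<bullet> (coun E \<boxtimes> ident \<E>) \<bullet> comul E"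
    using assms by (simp add: conv_def interchange_tail)
  then show "lu (tgt a) \<bullet> (coun E \<star> a) = a"
    using cmp_tail[OF lu_natural[of a], of "(coun E \<boxtimes> ident \<E>) \<bullet> comul E"] assms by (simp add: e)
  have "ru (tgt a) \<bullet> (a \<star> coun E) = ru (tgt a) \<bullet> (a \<boxtimes> ident \<I>) \<bullet> (ident \<E> \<boxtimes> coun E) \<bullet> comul E"
    using assms by (simp add: conv_def interchange_tail)
  then show "ru (tgt a) \<bullet> (a \<star> coun E) = a"
    using cmp_tail[OF ru_natural[of a], of "(ident \<E> \<boxtimes> coun E) \<bullet> comul E"] assms by (simp add: e)
qed

lemma conv_restrict: "arr a \<Longrightarrow> arr b \<Longrightarrow> src a = \<E> \<Longrightarrow> src b = \<E> \<Longrightarrow> (a \<star> b) \<bullet> I = ((a \<bullet> I) \<boxtimes> (b \<bullet> I)) \<bullet> comul D"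
  by (simp add: conv_def interchange_tail flip: I_hom(1))

definition vanishes where "vanishes a \<longleftrightarrow> arr a \<and> src a = \<E> \<and> a \<bullet> I = zero_arrow \<D> (tgt a)"

text \<open>Both arrows factor through the cokernel \<open>Q\<close>, and
  \<open>(Q \<boxtimes> Q) \<bullet> comul E = 0\<close> expresses
  \<open>D \<and> D = E\<close>.\<close>

lemma conv_vanishes:
  assumes "vanishes a" "vanishes b"
  shows "a \<star> b = zero_arrow \<E> (tgt a \<otimes>\<^sub>o tgt b)"
proof -
  note q = cokernel_arrowD[OF Q]
  obtain a' where a': "arr a'" "src a' = tgt Q" "tgt a' = tgt a" "a' \<bullet> Q = a"
    using assms(1) by (elim cokernel_factor[OF Q, of a, rotated 3]) (auto simp: vanishes_def)
  obtain b' where b': "arr b'" "src b' = tgt Q" "tgt b' = tgt b" "b' \<bullet> Q = b"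
    using assms(2) by (elim cokernel_factor[OF Q, of b, rotated 3]) (auto simp: vanishes_def)
  have "a \<star> b = (a' \<boxtimes> b') \<bullet> (Q \<boxtimes> Q) \<bullet> comul E"
    using a' b' q by (simp add: conv_def interchange_tail)
  then show ?thesis
    unfolding QQ using a' b' by simp
qed

lemma vanishes_cmp: "vanishes a \<Longrightarrow> arr p \<Longrightarrow> src p = tgt a \<Longrightarrow> vanishes (p \<bullet> a)"
  by (auto simp: vanishes_def cmp_sel)

lemma vanishes_add: "vanishes a \<Longrightarrow> vanishes b \<Longrightarrow> tgt a = tgt b \<Longrightarrow> vanishes (a \<^bold>+ b)"
  using arr_Ob(2)[of b] by (auto simp: vanishes_def cmp_add_left add_sel)

text \<open>Since \<open>P \<Delta> = 0\<close>, also \<open>y = P z\<close>. The arrow \<open>q\<close> is the common defect of \<open>y\<close> and \<open>w\<close> from being right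
  colinear over \<open>g\<^sub>0\<close>; unlike \<open>y\<close>, the arrow \<open>w\<close> is left colinear over \<open>g\<^sub>0\<close>.\<close>

definition g0 where "g0 = F \<bullet> R"
definition z where "z = g0 \<star> g0 \<^bold>+ \<^bold>- (\<Delta> \<bullet> g0)"
definition y where "y = P \<bullet> (g0 \<star> g0)"
definition w where "w = s \<bullet> (g0 \<star> y)"
definition q where "q = (P \<boxtimes> ident \<C>) \<bullet> al' \<C> \<C> \<C> \<bullet> (g0 \<star> z)"

lemma g0_typing [simp]: "arr g0" "src g0 = \<E>" "tgt g0 = \<C>" and g0_I: "g0 \<bullet> I = F"
  by (simp_all add: g0_def cmp_sel)

lemma z_typing [simp]: "arr z" "src z = \<E>" "tgt z = \<C> \<otimes>\<^sub>o \<C>"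
  by (simp_all add: z_def cmp_sel add_sel)

lemma y_typing [simp]: "arr y" "src y = \<E>" "tgt y = \<J>"
  by (simp_all add: y_def cmp_sel)

lemma w_typing [simp]: "arr w" "src w = \<E>" "tgt w = \<J>"
  by (simp_all add: w_def cmp_sel)

lemma q_typing [simp]: "arr q" "src q = \<E>" "tgt q = \<J> \<otimes>\<^sub>o \<C>"
  by (simp_all add: q_def cmp_sel)

lemma z_add: "\<Delta> \<bullet> g0 \<^bold>+ z = g0 \<star> g0"
  using add_commute[of "\<Delta> \<bullet> g0" z] add_commute[of "\<^bold>- (\<Delta> \<bullet> g0)"] by (simp add: z_def add_assoc add_neg cmp_sel)

lemma z_vanishes: "vanishes z"
  by (simp add: vanishes_def) (simp add: z_def cmp_add_left neg_cmp conv_restrict g0_I F_hom add_neg cmp_sel)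

lemma y_vanishes: "vanishes y"
  using cmp_tail[OF P_comult, of F] by (simp add: vanishes_def) (simp add: y_def conv_restrict g0_I F_hom)

lemma w_vanishes: "vanishes w"
proof -
  have "y \<bullet> I = zero_arrow \<D> \<J>" using y_vanishes by (simp add: vanishes_def)
  then have "(g0 \<star> y) \<bullet> I = zero_arrow \<D> (\<C> \<otimes>\<^sub>o \<J>)" by (simp add: conv_restrict cmp_sel)
  then show ?thesis by (simp add: vanishes_def) (simp add: w_def)
qed

text \<open>The discrepancy \<open>z \<star> b\<close> is a product of two arrows vanishing on
  \<open>D\<close>. Next to such a \<open>b\<close>, \<open>g0\<close> may be treated as
  comultiplicative.\<close>

lemma comult_g0_conv: "vanishes b \<Longrightarrow> (\<Delta> \<bullet> g0) \<star> b = (g0 \<star> g0) \<star> b"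
  using conv_vanishes[OF z_vanishes, of b] arr_Ob(2)[of b]
  by (simp add: conv_add cmp_sel vanishes_def flip: z_add)

text \<open>Likewise \<open>\<epsilon> \<bullet> g0\<close> and the counit of \<open>E\<close> agree
  on \<open>D\<close>, so their difference disappears next to \<open>b\<close>.\<close>

lemma counit_g0_conv: 
  assumes b: "vanishes b" shows "(\<epsilon> \<bullet> g0) \<star> b = coun E \<star> b"
proof -
  have [simp]: "arr b" "src b = \<E>" "tgt b \<in> Ob M" using b arr_Ob(2)[of b] by (simp_all add: vanishes_def)
  let ?n = "\<epsilon> \<bullet> g0 \<^bold>+ \<^bold>- coun E"
  have "vanishes ?n"
    by (simp add: vanishes_def cmp_add_left neg_cmp g0_I F_hom I_hom add_neg cmp_sel add_sel)
  from conv_vanishes[OF this b] have "?n \<star> b = zero_arrow \<E> (\<I> \<otimes>\<^sub>o tgt b)"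
    by (simp add: cmp_sel add_sel)
  moreover have "\<epsilon> \<bullet> g0 = ?n \<^bold>+ coun E"
    using add_commute[of "\<^bold>- coun E" "coun E"] by (simp add: add_assoc add_neg cmp_sel)
  then have "(\<epsilon> \<bullet> g0) \<star> b = ?n \<star> b \<^bold>+ coun E \<star> b"
    using conv_add(1)[of ?n "coun E" b] by (simp add: cmp_sel add_sel)
  ultimately show ?thesis by simp
qed

text \<open>Left colinearity of \<open>s\<close> moves the coaction to \<open>g0 \<star> y\<close>,
  where it comultiplies the first factor; there \<open>\<Delta> g0\<close> may be replaced by
  \<open>g0 \<star> g0\<close>.\<close>

lemma w_left: "lact J \<bullet> w = g0 \<star> w"
proof -
  have "lact J \<bullet> w = (ident \<C> \<boxtimes> s) \<bullet> cofree \<J> \<bullet> (g0 \<star> y)"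
    using cmp_tail[of "lact J" s "(ident \<C> \<boxtimes> s) \<bullet> cofree \<J>"] s_left by (simp add: w_def left_colinear_def)
  also have "cofree \<J> \<bullet> (g0 \<star> y) = al \<C> \<C> \<J> \<bullet> ((\<Delta> \<bullet> g0) \<star> y)"
    by (simp add: cofree_def cmp_sel cmp_conv)
  also have "\<dots> = g0 \<star> (g0 \<star> y)"
    by (simp add: comult_g0_conv[OF y_vanishes] conv_assoc)
  finally show ?thesis by (simp add: cmp_sel cmp_conv w_def)
qed

text \<open>The right coaction comultiplies the second factor of \<open>g0 \<star> g0\<close>. The
  defect of \<open>g0\<close> is then paired only with \<open>g0\<close>, which does not vanish on
  \<open>D\<close>, and so it survives as \<open>q\<close>.\<close>

lemma y_right: "ract J \<bullet> y \<^bold>+ q = y \<star> g0"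
proof -
  have "ract J \<bullet> y = (P \<boxtimes> ident \<C>) \<bullet> tensor_right \<C> \<Delta> \<bullet> (g0 \<star> g0)"
    using cmp_tail[OF P_coaction(2)] by (simp add: y_def)
  also have "\<dots> = (P \<boxtimes> ident \<C>) \<bullet> al' \<C> \<C> \<C> \<bullet> (g0 \<star> (\<Delta> \<bullet> g0))"
    by (simp add: tensor_right_def cmp_sel cmp_conv)
  finally have "ract J \<bullet> y \<^bold>+ q = (P \<boxtimes> ident \<C>) \<bullet> al' \<C> \<C> \<C> \<bullet> (g0 \<star> (\<Delta> \<bullet> g0 \<^bold>+ z))"
    by (simp add: q_def conv_add cmp_add_right cmp_sel)
  also have "\<dots> = y \<star> g0"
    unfolding z_add by (simp add: conv_assoc cmp_sel cmp_conv y_def)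
  finally show ?thesis .
qed

text \<open>In \<open>g0 \<star> (g0 \<star> z)\<close> the two copies of \<open>g0\<close> merge
  into \<open>\<Delta> \<bullet> g0\<close>. Colinearity of \<open>P\<close> turns this
  comultiplication into the coaction of \<open>J\<close>, which \<open>s\<close> undoes.\<close>

lemma q_invariant: "(s \<boxtimes> ident \<C>) \<bullet> al' \<C> \<J> \<C> \<bullet> (g0 \<star> q) = q"
proof -
  have 1: "g0 \<star> (g0 \<star> z) = al \<C> \<C> (\<C> \<otimes>\<^sub>o \<C>) \<bullet> (\<Delta> \<boxtimes> (ident \<C> \<boxtimes> ident \<C>)) \<bullet> (g0 \<star> z)"
    by (simp add: cmp_sel cmp_conv comult_g0_conv[OF z_vanishes] conv_assoc del: ident_tensor) (simp add: cmp_sel cmp_conv comult_g0_conv[OF z_vanishes] conv_assoc)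
  have 2: "al' \<C> (\<C> \<otimes>\<^sub>o \<C>) \<C> \<bullet> (ident \<C> \<boxtimes> al' \<C> \<C> \<C>) \<bullet> al \<C> \<C> (\<C> \<otimes>\<^sub>o \<C>) = (al \<C> \<C> \<C> \<boxtimes> ident \<C>) \<bullet> al' (\<C> \<otimes>\<^sub>o \<C>) \<C> \<C>"
    by (simp add: cmp_sel flip: al'_pentagon(2))
  have "al' \<C> \<J> \<C> \<bullet> (g0 \<star> q) = al' \<C> \<J> \<C> \<bullet> (ident \<C> \<boxtimes> (P \<boxtimes> ident \<C>)) \<bullet> (ident \<C> \<boxtimes> al' \<C> \<C> \<C>) \<bullet> (g0 \<star> (g0 \<star> z))"
    by (simp add: q_def cmp_sel cmp_conv)
  also have "\<dots> = ((ident \<C> \<boxtimes> P) \<boxtimes> ident \<C>) \<bullet> al' \<C> (\<C> \<otimes>\<^sub>o \<C>) \<C> \<bullet> (ident \<C> \<boxtimes> al' \<C> \<C> \<C>) \<bullet> (g0 \<star> (g0 \<star> z))"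
    by (subst al_natural'(4)) simp_all
  also have "\<dots> = ((ident \<C> \<boxtimes> P) \<boxtimes> ident \<C>) \<bullet> (al' \<C> (\<C> \<otimes>\<^sub>o \<C>) \<C> \<bullet> (ident \<C> \<boxtimes> al' \<C> \<C> \<C>) \<bullet> al \<C> \<C> (\<C> \<otimes>\<^sub>o \<C>)) \<bullet>
      (\<Delta> \<boxtimes> (ident \<C> \<boxtimes> ident \<C>)) \<bullet> (g0 \<star> z)"
    unfolding 1 by simp
  also have "\<dots> = ((ident \<C> \<boxtimes> P) \<boxtimes> ident \<C>) \<bullet> (al \<C> \<C> \<C> \<boxtimes> ident \<C>) \<bullet> al' (\<C> \<otimes>\<^sub>o \<C>) \<C> \<C> \<bullet> (\<Delta> \<boxtimes> (ident \<C> \<boxtimes> ident \<C>)) \<bullet> (g0 \<star> z)"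
    unfolding 2 by simp
  also have "\<dots> = ((ident \<C> \<boxtimes> P) \<boxtimes> ident \<C>) \<bullet> (al \<C> \<C> \<C> \<boxtimes> ident \<C>) \<bullet> ((\<Delta> \<boxtimes> ident \<C>) \<boxtimes> ident \<C>) \<bullet> al' \<C> \<C> \<C> \<bullet> (g0 \<star> z)"
    by (subst al_natural'(4)) simp_all
  also have "\<dots> = (((ident \<C> \<boxtimes> P) \<bullet> cofree \<C>) \<boxtimes> ident \<C>) \<bullet> al' \<C> \<C> \<C> \<bullet> (g0 \<star> z)"
    by (simp add: cofree_def interchange_tail cmp_sel)
  finally have "(s \<boxtimes> ident \<C>) \<bullet> al' \<C> \<J> \<C> \<bullet> (g0 \<star> q) = ((s \<bullet> lact J \<bullet> P) \<boxtimes> ident \<C>) \<bullet> al' \<C> \<C> \<C> \<bullet> (g0 \<star> z)"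
    by (simp add: interchange_tail cmp_sel flip: P_coaction(1))
  then show ?thesis
    using cmp_tail[OF s_retraction, of P] by (simp add: q_def)
qed

text \<open>Right colinearity of \<open>s\<close> carries the identity for \<open>y\<close> over to
  \<open>w\<close>; the defect becomes \<open>s\<close> applied to \<open>g0 \<star> q\<close>,
  which is \<open>q\<close> again.\<close>

lemma w_right: "ract J \<bullet> w \<^bold>+ q = w \<star> g0"
proof -
  have "ract J \<bullet> w = (s \<boxtimes> ident \<C>) \<bullet> tensor_right \<C> (ract J) \<bullet> (g0 \<star> y)"
    using cmp_tail[of "ract J" s "(s \<boxtimes> ident \<C>) \<bullet> tensor_right \<C> (ract J)"] s_right by (simp add: w_def right_colinear_def)
  also have "\<dots> = (s \<boxtimes> ident \<C>) \<bullet> al' \<C> \<J> \<C> \<bullet> (g0 \<star> (ract J \<bullet> y))"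
    by (simp add: tensor_right_def cmp_sel cmp_conv)
  finally have "ract J \<bullet> w \<^bold>+ (s \<boxtimes> ident \<C>) \<bullet> al' \<C> \<J> \<C> \<bullet> (g0 \<star> q) = (s \<boxtimes> ident \<C>) \<bullet> al' \<C> \<J> \<C> \<bullet> (g0 \<star> (ract J \<bullet> y \<^bold>+ q))"
    by (simp add: conv_add cmp_add_right cmp_sel)
  also have "\<dots> = w \<star> g0"
    unfolding y_right by (simp add: conv_assoc cmp_sel cmp_conv w_def)
  finally show ?thesis unfolding q_invariant .
qed

section \<open>The correction term and its coboundary\<close>

definition \<eta> where "\<eta> = del \<bullet> w"
definition \<mu> where "\<mu> = counit1 \<bullet> z"

lemma \<eta>_\<mu>_typing [simp]: "arr \<eta>" "src \<eta> = \<E>" "tgt \<eta> = \<C>" "arr \<mu>" "src \<mu> = \<E>" "tgt \<mu> = \<C>"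
  by (simp_all add: \<eta>_def \<mu>_def cmp_sel)

text \<open>The term \<open>g0 \<star> \<mu>\<close> is \<open>counit2\<close> applied where
  \<open>q\<close> carries \<open>del \<bullet> P\<close>. Together they form
  \<open>counit1\<close>, which turns \<open>g0 \<star> z\<close> into
  \<open>(\<epsilon> \<bullet> g0) \<star> z\<close> and hence into \<open>z\<close>.\<close>

lemma del_q: "(del \<boxtimes> ident \<C>) \<bullet> q \<^bold>+ g0 \<star> \<mu> = z"
proof -
  have "g0 \<star> \<mu> = (ident \<C> \<boxtimes> counit1) \<bullet> (g0 \<star> z)"
    by (simp add: cmp_sel cmp_conv \<mu>_def)
  also have "\<dots> = (counit2 \<boxtimes> ident \<C>) \<bullet> al' \<C> \<C> \<C> \<bullet> (g0 \<star> z)"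
    by (simp flip: counit2_al')
  finally have "(del \<boxtimes> ident \<C>) \<bullet> q \<^bold>+ g0 \<star> \<mu> = ((del \<bullet> P \<^bold>+ counit2) \<boxtimes> ident \<C>) \<bullet> al' \<C> \<C> \<C> \<bullet> (g0 \<star> z)"
    by (simp add: q_def tensor_add_left cmp_add_left interchange_tail cmp_sel)
  also have "\<dots> = lu (\<C> \<otimes>\<^sub>o \<C>) \<bullet> ((\<epsilon> \<bullet> g0) \<star> z)"
    using cmp_tail[OF counit1_al', of "g0 \<star> z"] unfolding del_P by (simp add: cmp_sel cmp_conv)
  also have "\<dots> = z"
    using conv_counit(1)[of z] by (simp add: counit_g0_conv[OF z_vanishes])
  finally show ?thesis .
qed

text \<open>The coderivation identity of \<open>del\<close> is evaluated at \<open>w\<close>. The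
  left part is exact by \<open>w_left\<close>, while the defect \<open>q\<close> of the right part
  contributes \<open>z\<close> up to \<open>g0 \<star> \<mu>\<close>.\<close>

lemma comult_\<eta>: "\<Delta> \<bullet> \<eta> \<^bold>+ z = g0 \<star> \<eta> \<^bold>+ (\<eta> \<star> g0 \<^bold>+ g0 \<star> \<mu>)"
proof -
  have "\<Delta> \<bullet> del = (ident \<C> \<boxtimes> del) \<bullet> lact J \<^bold>+ (del \<boxtimes> ident \<C>) \<bullet> ract J"
    using del_coderivation by (simp add: coderivation_def)
  from cmp_tail[OF this, of w]
  have "\<Delta> \<bullet> \<eta> = g0 \<star> \<eta> \<^bold>+ (del \<boxtimes> ident \<C>) \<bullet> ract J \<bullet> w"
    by (simp add: \<eta>_def cmp_add_left w_left cmp_sel cmp_conv)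
  moreover have "(del \<boxtimes> ident \<C>) \<bullet> ract J \<bullet> w \<^bold>+ (del \<boxtimes> ident \<C>) \<bullet> q = \<eta> \<star> g0"
    using arg_cong[OF w_right, of "\<lambda>a. (del \<boxtimes> ident \<C>) \<bullet> a"] by (simp add: cmp_add_right cmp_sel cmp_conv \<eta>_def)
  ultimately show ?thesis
    by (metis del_q add_assoc)
qed

text \<open>Up to a unitor, \<open>g0 + \<mu>\<close> is
  \<open>(\<epsilon> \<bullet> g0) \<star> g0\<close>. Adding \<open>z\<close>, which is
  \<open>(\<epsilon> \<bullet> g0) \<star> z\<close>, to its comultiplication gives
  \<open>(g0 + \<mu>) \<star> g0\<close>; the terms \<open>g0 \<star> g0\<close> then
  cancel.\<close>

lemma comult_\<mu>: "\<Delta> \<bullet> \<mu> = \<mu> \<star> g0"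
proof -
  let ?e = "\<epsilon> \<bullet> g0"
  have [simp]: "arr ?e" "src ?e = \<E>" "tgt ?e = \<I>" by (simp_all add: cmp_sel)
  have "counit1 \<bullet> (\<Delta> \<bullet> g0 \<^bold>+ z) = g0 \<^bold>+ \<mu>"
    using cmp_tail[OF counit_comult(1), of g0] by (simp add: cmp_add_right \<mu>_def)
  then have \<mu>: "g0 \<^bold>+ \<mu> = lu \<C> \<bullet> (?e \<star> g0)"
    unfolding z_add by (simp add: counit1_def cmp_sel cmp_conv)
  have z: "lu (\<C> \<otimes>\<^sub>o \<C>) \<bullet> (?e \<star> z) = z"
    using conv_counit(1)[of z] by (simp add: counit_g0_conv[OF z_vanishes])
  have "\<Delta> \<bullet> \<mu> \<^bold>+ (\<Delta> \<bullet> g0 \<^bold>+ z) = \<Delta> \<bullet> (g0 \<^bold>+ \<mu>) \<^bold>+ z"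
    by (simp add: cmp_add_right add_ac)
  also have "\<Delta> \<bullet> (g0 \<^bold>+ \<mu>) = lu (\<C> \<otimes>\<^sub>o \<C>) \<bullet> (?e \<star> (\<Delta> \<bullet> g0))"
    using cmp_tail[OF lu_natural[of \<Delta>], of "?e \<star> g0"] unfolding \<mu> by (simp add: cmp_sel cmp_conv)
  also have "\<dots> \<^bold>+ z = lu (\<C> \<otimes>\<^sub>o \<C>) \<bullet> (?e \<star> (\<Delta> \<bullet> g0 \<^bold>+ z))"
    by (simp add: conv_add cmp_add_right cmp_sel z)
  also have "\<dots> = (lu \<C> \<boxtimes> ident \<C>) \<bullet> al' \<I> \<C> \<C> \<bullet> (?e \<star> (g0 \<star> g0))"
    unfolding z_add using cmp_tail[OF unit_al'(1)[of \<C> \<C>], of "?e \<star> (g0 \<star> g0)"] by simp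
  also have "\<dots> = (g0 \<^bold>+ \<mu>) \<star> g0"
    unfolding \<mu> by (simp add: conv_assoc cmp_sel cmp_conv)
  also have "\<dots> = \<mu> \<star> g0 \<^bold>+ (\<Delta> \<bullet> g0 \<^bold>+ z)"
    unfolding z_add by (simp add: conv_add add_commute)
  finally show ?thesis
    by (rule add_right_cancel) (simp add: cmp_sel add_sel)
qed

definition h where "h = \<eta> \<^bold>+ \<mu>"
definition g where "g = g0 \<^bold>+ \<^bold>- h"

lemma h_typing [simp]: "arr h" "src h = \<E>" "tgt h = \<C>"
  by (simp_all add: h_def add_sel)

lemma g_typing [simp]: "arr g" "src g = \<E>" "tgt g = \<C>"
  by (simp_all add: g_def add_sel)

lemma h_vanishes: "vanishes h"
  unfolding h_def \<eta>_def \<mu>_def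
  by (intro vanishes_add vanishes_cmp w_vanishes z_vanishes) (simp_all add: cmp_sel)

lemma g_add: "g \<^bold>+ h = g0"
  using add_commute[of "\<^bold>- h" h] by (simp add: g_def add_assoc add_neg)

lemma g_I: "g \<bullet> I = F"
  using h_vanishes by (simp add: g_def cmp_add_left neg_cmp g0_I vanishes_def)

text \<open>By \<open>comult_\<mu>\<close> the coboundary of \<open>\<mu>\<close> reduces to
  \<open>g0 \<star> \<mu>\<close>, which is exactly what \<open>comult_\<eta>\<close> leaves
  over.\<close>

lemma comult_h: "\<Delta> \<bullet> h \<^bold>+ z = g0 \<star> h \<^bold>+ h \<star> g0"
proof -
  have "\<Delta> \<bullet> h \<^bold>+ z = (\<Delta> \<bullet> \<eta> \<^bold>+ z) \<^bold>+ \<Delta> \<bullet> \<mu>"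
    by (simp add: h_def cmp_add_right add_ac)
  also have "\<dots> = g0 \<star> h \<^bold>+ h \<star> g0"
    unfolding comult_\<eta> comult_\<mu> by (simp add: h_def conv_add add_ac)
  finally show ?thesis .
qed

text \<open>Since \<open>h \<star> h = 0\<close>, expanding \<open>g0 \<star> g0\<close> with
  \<open>g0 = g + h\<close> gives an equation linear in \<open>h\<close>, and
  \<open>comult_h\<close> is that linear equation.\<close>

lemma g_comult: "g \<star> g = \<Delta> \<bullet> g"
proof -
  have "g0 \<star> g0 = (g \<^bold>+ h) \<star> g0" by (simp add: g_add)
  also have "\<dots> = g \<star> (g \<^bold>+ h) \<^bold>+ h \<star> g0"
    using conv_add(1)[of g h g0] by (simp add: g_add)
  also have "\<dots> = g \<star> g \<^bold>+ (g \<star> h \<^bold>+ h \<star> g0)"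
    by (simp add: conv_add add_assoc)
  also have "g \<star> h = g0 \<star> h"
    using conv_vanishes[OF h_vanishes h_vanishes] conv_add(1)[of g h h] by (simp add: g_add)
  finally have "g \<star> g \<^bold>+ (\<Delta> \<bullet> h \<^bold>+ z) = \<Delta> \<bullet> g0 \<^bold>+ z"
    by (simp add: comult_h z_add)
  also have "\<dots> = \<Delta> \<bullet> g \<^bold>+ (\<Delta> \<bullet> h \<^bold>+ z)"
    unfolding g_add[symmetric] by (simp add: cmp_add_right add_assoc)
  finally show ?thesis
    by (rule add_right_cancel) (simp add: cmp_sel add_sel)
qed

lemma g_counit: "\<epsilon> \<bullet> g = coun E"
proof -
  let ?u = "\<epsilon> \<bullet> g" let ?e = "coun E"
  define n where "n = \<epsilon> \<bullet> g \<^bold>+ \<^bold>- coun E"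
  have [simp]: "arr ?u" "src ?u = \<E>" "tgt ?u = \<I>" by (simp_all add: cmp_sel)
  have n [simp]: "arr n" "src n = \<E>" "tgt n = \<I>" by (simp_all add: n_def add_sel)
  have v: "vanishes n"
    by (simp add: vanishes_def) (simp add: n_def cmp_add_left neg_cmp g_I F_hom I_hom add_neg)
  have u: "?u = ?e \<^bold>+ n"
    using add_commute[of ?e n] add_commute[of "\<^bold>- ?e" ?e] by (simp add: n_def add_assoc add_neg)
  \<comment> \<open>Comultiplicativity makes \<open>?u\<close> idempotent under convolution. With
    \<open>?u = ?e + n\<close> and \<open>n \<star> n = 0\<close> this reads
    \<open>?u = ?u + n \<star> ?e\<close> up to unitors, and convolution with the counit
    \<open>?e\<close> returns \<open>n\<close>.\<close>
  have "?u = lu \<I> \<bullet> (\<epsilon> \<boxtimes> \<epsilon>) \<bullet> \<Delta> \<bullet> g"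
    using cmp_tail[of "lu \<I>" "(\<epsilon> \<boxtimes> \<epsilon>) \<bullet> \<Delta>" \<epsilon> g] counit_unit by simp
  also have "\<dots> = lu \<I> \<bullet> (?u \<star> ?u)"
    by (simp add: cmp_sel cmp_conv flip: g_comult)
  also have "?u \<star> ?u = ?e \<star> ?u \<^bold>+ n \<star> ?u"
    using conv_add(1)[of ?e n ?u] by (simp add: u[symmetric])
  also have "n \<star> ?u = n \<star> ?e"
    unfolding u using conv_vanishes[OF v v] by (simp add: conv_add)
  also have "lu \<I> \<bullet> (?e \<star> ?u \<^bold>+ n \<star> ?e) = ?u \<^bold>+ lu \<I> \<bullet> (n \<star> ?e)"
    using conv_counit(1)[of ?u] by (simp add: cmp_add_right)
  finally have "lu \<I> \<bullet> (n \<star> ?e) = zero_arrow \<E> \<I>"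
    by - (rule add_left_cancel[of ?u], auto simp: cmp_sel)
  then have "lu' \<I> \<bullet> lu \<I> \<bullet> (n \<star> ?e) = zero_arrow \<E> (\<I> \<otimes>\<^sub>o \<I>)"
    by simp
  then have "ru \<I> \<bullet> (n \<star> ?e) = zero_arrow \<E> \<I>"
    by simp
  then have "n = zero_arrow \<E> \<I>"
    using conv_counit(2)[of n] by simp
  then show ?thesis using u by simp
qed

end

lemma (in differentials) coalgebra_hom_lifts:
  assumes inj: "relative_injective bicom (split_mono M C) J"
    and D: "coalgebra M D" and E: "coalgebra M E" and i: "i \<in> coalgebra_hom M D E"
    and ret: "has_retraction M (cobj D) (cobj E) i" and wedge: "wedge_square_total M D E i"
    and f: "f \<in> coalgebra_hom M D C"
  shows "\<exists>g\<in>coalgebra_hom M E C. g \<cdot> i = f"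
proof -
  let ?T = "bicomod_of (cofree \<J>) (tensor_right \<C> (ract J))"
  have bT: "bicoaction (cofree \<J>) (tensor_right \<C> (ract J))"
    using bicoaction_cofree[OF J_bicoaction(3)] by simp
  note T = bicomod_of[OF bT]
  have lT: "mor (lact J) \<in> Mor bicom J ?T"
    using coaction_colinear[OF J_bicoaction(1)] by (intro mor_in_bicom J T(1)) (simp_all add: T)
  \<comment> \<open>The counit retracts the coaction of \<open>J\<close> in \<open>M\<close>, so the
    coaction belongs to the class of split monomorphisms. Extending the identity of \<open>J\<close>
    along it produces \<open>s\<close>.\<close>
  let ?R = "lu \<J> \<bullet> (\<epsilon> \<boxtimes> ident \<J>)"
  have "?R \<bullet> lact J = ident \<J>"
    using left_coactionD(5)[OF J_bicoaction(2)] by simp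
  then have "has_retraction M (bobj J) (bobj ?T) (mor (lact J))"
    using mor_in[of "lact J"] mor_in[of ?R] mor_cmp_eq[of ?R "lact J" "ident \<J>"] unfolding has_retraction_def
    by (auto simp: T cmp_sel)
  then have "split_mono M C J ?T (mor (lact J))"
    by (rule split_monoI[OF J T(1) lT])
  then have "(\<lambda>g. comp bicom g (mor (lact J))) ` Mor bicom ?T J = Mor bicom J J"
    using inj J T(1) by (simp add: relative_injective_def)
  moreover have "idm M \<J> \<in> Mor bicom J J"
    using category.idm_in[of bicom J] preadditive_bicom J by (simp add: preadditive_category_def)
  ultimately have "idm M \<J> \<in> (\<lambda>g. g \<cdot> mor (lact J)) ` Mor bicom ?T J"
    by simp
  then obtain s0 where s0: "s0 \<in> Mor bicom ?T J" "s0 \<cdot> mor (lact J) = idm M \<J>"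
    by auto
  obtain s where s: "arr s" "src s = bobj ?T" "tgt s = \<J>" "mor s = s0" "left_colinear s (lact ?T) (lact J)" "right_colinear s (ract ?T) (ract J)"
    using s0(1) T(1) J by (rule Mor_bicomE)
  have sl: "s \<bullet> lact J = ident \<J>"
    using s s0(2) by (intro arrow_eqI) (simp_all add: T cmp_sel)

  have ob [simp]: "cobj D \<in> Ob M" "cobj E \<in> Ob M" using D E by (simp_all add: coalgebra_iff)
  define I F where "I = arrow_of (cobj D) i (cobj E)" and "F = arrow_of (cobj D) f \<C>"
  have iM: "i \<in> Mor M (cobj D) (cobj E)" and fM: "f \<in> Mor M (cobj D) \<C>"
    using i f by (simp_all add: coalgebra_hom_def)
  have i_arrow: "arr I" "src I = cobj D" "tgt I = cobj E" "mor I = i" and f_arrow: "arr F" "src F = cobj D" "tgt F = \<C>" "mor F = f"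
    using iM fM by (simp_all add: I_def F_def arr_arrow_of arrow_of_sel)
  obtain R where R: "arr R" "src R = cobj E" "tgt R = cobj D" "R \<bullet> I = ident (cobj D)"
    unfolding I_def by (rule has_retraction_arrow[OF ret]) simp_all
  obtain L \<pi> where L: "is_cokernel M (cobj D) (cobj E) i L \<pi>"
    and k: "is_kernel M (cobj E) (L \<otimes>\<^sub>o L) ((\<pi> \<otimes>\<^sub>m \<pi>) \<cdot> comult E) (cobj E) (idm M (cobj E))"
    using wedge unfolding wedge_square_total_def is_wedge_square_def by blast
  have [simp]: "L \<in> Ob M" and \<pi>: "\<pi> \<in> Mor M (cobj E) L" and cok: "cokernel_arrow I (arrow_of (cobj E) \<pi> L)"
    using L by (auto simp: is_cokernel_iff I_def)
  define Q where "Q = arrow_of (cobj E) \<pi> L"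
  have Q: "arr Q" "src Q = cobj E" "tgt Q = L" "mor Q = \<pi>"
    using \<pi> by (simp_all add: Q_def arr_arrow_of arrow_of_sel)
  have cE: "arr (comul E)" "src (comul E) = cobj E" "tgt (comul E) = cobj E \<otimes>\<^sub>o cobj E" "mor (comul E) = comult E"
    using E comul_typing[of E] by (auto simp: coalgebra_iff)
  \<comment> \<open>A kernel is killed by its arrow; as the kernel is the identity here, the arrow
    itself is zero.\<close>
  have "((\<pi> \<otimes>\<^sub>m \<pi>) \<cdot> comult E) \<cdot> idm M (cobj E) = zero_mor M (cobj E) (L \<otimes>\<^sub>o L)"
    and "(\<pi> \<otimes>\<^sub>m \<pi>) \<cdot> comult E \<in> Mor M (cobj E) (L \<otimes>\<^sub>o L)"
    using k by (auto simp: is_kernel_def)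
  then have "(\<pi> \<otimes>\<^sub>m \<pi>) \<cdot> comult E = zero_mor M (cobj E) (L \<otimes>\<^sub>o L)"
    using idm_right[of "cobj E" "L \<otimes>\<^sub>o L"] by simp
  then have QQ: "(Q \<boxtimes> Q) \<bullet> comul E = zero_arrow (cobj E) (L \<otimes>\<^sub>o L)"
    using Q cE by (intro arrow_eqI) (simp_all add: cmp_sel)
  interpret lifting M C J P D E I R Q F s
    using D E i_arrow f_arrow R Q QQ cok s sl i f
    by unfold_locales (simp_all add: coalgebra_hom_iff[OF D E] coalgebra_hom_iff[OF D coalgebra] I_def F_def Q_def T)
  have "mor g \<in> coalgebra_hom M E C"
    using g_comult g_counit arrow_of_collapse[of g] mor_in[of g] by (simp add: coalgebra_hom_iff[OF E coalgebra] conv_def)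
  moreover have "mor g \<cdot> i = f"
    using mor_cmp_eq[OF g_I] i_arrow f_arrow by simp
  ultimately show ?thesis by blast
qed

theorem theorem5p5:
  fixes M :: "('o, 'm, 'z) mon_cat_scheme" and C :: "('o, 'm) coalg"
  assumes "abelian_monoidal_category M" and "coalgebra M C"
  shows "(\<forall>V\<in>Ob (bicomodule_cat M C). trivial_group (Hochschild_cohomology M C 2 V)) \<longleftrightarrow>
         (\<forall>D E i. coalgebra M D \<and> coalgebra M E \<and> i \<in> coalgebra_hom M D E \<and>
             has_retraction M (cobj D) (cobj E) i \<and> wedge_square_total M D E i \<longrightarrow>
             (\<forall>f\<in>coalgebra_hom M D C. \<exists>g\<in>coalgebra_hom M E C. comp M g i = f))"
proof -
  interpret coalgebra_in M C
    using assms by (simp add: coalgebra_in_def coalgebra_in_axioms_def)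
  obtain J P where "differentials M C J P"
    and cok: "is_cokernel bicom (regular_bicomodule C) square (comult C) J (mor P)"
    by (rule differentials_exist)
  then interpret differentials M C J P by simp
  show ?thesis
    unfolding Hochschild_vanishing_iff[OF cok]
  proof (intro iffI allI impI ballI)
    fix D E i f
    assume "relative_injective bicom (split_mono M C) J"
      and "coalgebra M D \<and> coalgebra M E \<and> i \<in> coalgebra_hom M D E \<and>
             has_retraction M (cobj D) (cobj E) i \<and> wedge_square_total M D E i"
      and "f \<in> coalgebra_hom M D C"
    then show "\<exists>g\<in>coalgebra_hom M E C. comp M g i = f"
      using coalgebra_hom_lifts by blast
  next
    assume lift: "\<forall>D E i. coalgebra M D \<and> coalgebra M E \<and> i \<in> coalgebra_hom M D E \<and>
             has_retraction M (cobj D) (cobj E) i \<and> wedge_square_total M D E i \<longrightarrow>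
             (\<forall>f\<in>coalgebra_hom M D C. \<exists>g\<in>coalgebra_hom M E C. comp M g i = f)"
    show "relative_injective bicom (split_mono M C) J"
      by (rule relative_injective_if_coderivations_extend, rule coderivations_extend) (use lift in blast)+
  qed
qed

end
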